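(* Let $\mathbb{K}$ be a field of characteristic $p>0$ and let $(C,D,\Omega)$ be a Cartan triple with $D=\mathrm{diag}(c_1,\dots,c_n)$ such that each $c_i$ is a power of $p$. Let $(Q^\circ,X)$ be the finite EI quiver associated to $(C,D,\Omega)$. Then there is an isomorphism of $\mathbb{K}$-algebras $$\Pi(Q^\circ,X)\cong\Pi(C,D,\Omega)$$ between the preprojective algebra of the EI quiver $(Q^\circ,X)$ and the generalized preprojective algebra of $(C,D,\Omega)$.
   Context: **Cartan triples.** Let $n\ge1$. A Cartan matrix is $C=(c_{ij})\in M_n(\mathbb{Z})$ with (C1) $c_{ii}=2$; (C2) $c_{ij}\le0$ for $i\ne j$, and $c_{ij}<0$ iff $c_{ji}<0$; (C3) there is a diagonal matrix $D=\mathrm{diag}(c_1,\dots,c_n)$, $c_i\in\mathbb{Z}_{\ge1}$, with $DC$ symmetric; such $D$ is a symmetrizer of $C$. When $c_{ij}<0$ put $g_{ij}=|\gcd(c_{ij},c_{ji})|$ and $f_{ij}=|c_{ij}|/g_{ij}$. An orientation of $C$ is a subset $\Omega\subset\{1,\dots,n\}^2$ with (O1) $\{(i,j),(j,i)\}\cap\Omega\ne\emptyset$ iff $c_{ij}<0$; (O2) for each sequence $(i_1,\dots,i_{t+1})$, $t\ge1$, with $(i_s,i_{s+1})\in\Omega$ for all $1\le s\le t$, one has $i_1\ne i_{t+1}$. A Cartan triple $(C,D,\Omega)$ consists of a Cartan matrix, a symmetrizer and an orientation. **Generalized preprojective algebra $\Pi(C,D,\Omega)$.** Let $\Omega^\ast=\{(j,i)\mid(i,j)\in\Omega\}$,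 $\overline\Omega=\Omega\sqcup\Omega^\ast$, $\overline\Omega(-,i)=\{j\mid(j,i)\in\overline\Omega\}$, $\mathrm{sgn}(i,j)=1$ if $(i,j)\in\Omega$ and $-1$ if $(i,j)\in\Omega^\ast$. Let $\widetilde Q$ be the quiver with vertices $1,\dots,n$, arrows $\alpha_{ij}^{(g)}:j\to i$ for $(i,j)\in\overline\Omega$, $1\le g\le g_{ij}$, and a loop $\varepsilon_i$ at each vertex $i$. Then $\Pi(C,D,\Omega)=\mathbb{K}\widetilde Q/\widetilde I$ (paths composed right to left), where $\widetilde I$ is the two-sided ideal generated by the relations $\varepsilon_k^{c_k}=0$ for all $k$; $\varepsilon_i^{f_{ji}}\alpha_{ij}^{(g)}=\alpha_{ij}^{(g)}\varepsilon_j^{f_{ij}}$ for all $(i,j)\in\overline\Omega$, $1\le g\le g_{ij}$; and for each $i$ $$\sum_{j\in\overline\Omega(-,i)}\sum_{g=1}^{g_{ji}}\sum_{f=0}^{f_{ji}-1}\mathrm{sgn}(i,j)\,\varepsilon_i^f\alpha_{ij}^{(g)}\alpha_{ji}^{(g)}\varepsilon_i^{f_{ji}-1-f}=0.$$ **Bisets.** For groups $G_1,G_2$, a $(G_1,G_2)$-biset is a set $Y$ with commuting left $G_1$-action and right $G_2$-action. Its dual is the $(G_2,G_1)$-biset $Y^\ast=\{y^\ast\mid y\in Y\}$ with $y^\ast g_1=(g_1^{-1}y)^\ast$, $g_2y^\ast=(yg_2^{-1})^\ast$. The product $Y\times_{G_2}Z$ is $Y\times Z$ modulo $(yg,z)\sim(y,gz)$.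 **EI quivers and their preprojective algebras.** A finite EI quiver $(Q,X)$ is a finite quiver $Q$ with a finite group $X(i)$ for each $i\in Q_0$ and a finite nonempty $(X(t(\alpha)),X(s(\alpha)))$-biset $X(\alpha)$ for each $\alpha\in Q_1$; it is acyclic if $Q$ has no oriented cycles. For a path $p=\alpha_m\cdots\alpha_1$ (right to left), $X(p)=X(\alpha_m)\times_{X(t(\alpha_{m-1}))}\cdots\times_{X(t(\alpha_1))}X(\alpha_1)$, and $X(e_i)=X(i)$ for trivial paths. The category $\mathcal{C}(Q,X)$ has objects $Q_0$, $\mathrm{Hom}(x,y)=\bigsqcup_pX(p)$ over paths $p$ from $x$ to $y$, with composition induced by $X(p)\times_{X(t(q))}X(q)\cong X(pq)$. Its category algebra has the morphisms as basis and product given by composition (zero if not composable). For $(Q,X)$ acyclic, $\overline Q$ is $Q$ with a reverse arrow $\alpha^\ast$ added for each $\alpha\in Q_1$, $\overline X(i)=X(i)$, $\overline X(\alpha)=X(\alpha)$, $\overline X(\alpha^\ast)=X(\alpha)^\ast$. With $L_\alpha$ (resp. $R_\alpha$) representatives of the left $X(t(\alpha))$-orbits (resp. right $X(s(\alpha))$-orbits) of $X(\alpha)$, set $\Pi(Q,X)=\mathbb{K}\mathcal{C}(\overline Q,\overline X)/(\rho)$, $\rho=\sum_{\alpha\in Q_1}\big(\sum_{b\in R_\alpha}bb^\ast-\sum_{c\in L_\alpha}c^\ast c\big)$. **The EI quiver of $(C,D,\Omega)$.** $Q^\circ$ has vertices $1,\dots,n$ and arrows $\alpha_{ij}^{(g)}:j\to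 i$ for $(i,j)\in\Omega$, $1\le g\le g_{ij}$ (it is acyclic by (O2)). $X(i)=\langle\eta_i\mid\eta_i^{c_i}=1\rangle$ is cyclic of order $c_i$. For $(i,j)\in\Omega$ let $k_{ij}=\gcd(c_i,c_j)$ and $G_{ij}=\langle\eta_{ij}\mid\eta_{ij}^{k_{ij}}=1\rangle$, embedded in $X(i)$ by $\eta_{ij}\mapsto\eta_i^{c_i/k_{ij}}$ and in $X(j)$ by $\eta_{ij}\mapsto\eta_j^{c_j/k_{ij}}$; set $X(\alpha_{ij}^{(g)})=X(i)\times_{G_{ij}}X(j)$ for each $1\le g\le g_{ij}$. *)

theory Defs
  imports
    "HOL-Analysis.Finite_Cartesian_Product"
    "HOL-Algebra.QuotRing"
    "HOL-Algebra.Module"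
    "HOL-Algebra.Elementary_Groups"
    "HOL-Library.Poly_Mapping"
    "Graph_Theory.Arc_Walk"
begin

section \<open>Algebras over a field\<close>

text \<open>
  A (unital, associative, not necessarily commutative) algebra over the field \<open>'k\<close> is carried by
  the record \<^type>\<open>module\<close>, i.e. a ring together with a scalar multiplication. Two-sided ideals are
  those of the underlying ring; in a unital algebra they are automatically closed under scalars.
\<close>

definition quotient_algebra :: "('k, 'm) module \<Rightarrow> 'm set \<Rightarrow> ('k, 'm set) module" where
  "quotient_algebra A I =
    \<lparr>carrier = carrier (A Quot I), mult = mult (A Quot I), one = one (A Quot I),
     zero = zero (A Quot I), add = add (A Quot I),
     smult = (\<lambda>c X. \<Union>x\<in>X. I +>\<^bsub>A\<^esub> (c \<odot>\<^bsub>A\<^esub> x))\<rparr>"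

definition algebra_iso :: "('k, 'm) module \<Rightarrow> ('k, 'l) module \<Rightarrow> ('m \<Rightarrow> 'l) set" where
  "algebra_iso A B =
    {h \<in> ring_iso A B. \<forall>c. \<forall>x\<in>carrier A. h (c \<odot>\<^bsub>A\<^esub> x) = c \<odot>\<^bsub>B\<^esub> h x}"

definition algebras_isomorphic :: "('k, 'm) module \<Rightarrow> ('k, 'l) module \<Rightarrow> bool" where
  "algebras_isomorphic A B \<longleftrightarrow> algebra_iso A B \<noteq> {}"

section \<open>Category algebras and path algebras\<close>

record ('o, 'm) cat =
  Obj :: "'o set"
  Mor :: "'m set"
  Dom :: "'m \<Rightarrow> 'o"
  Cod :: "'m \<Rightarrow> 'o"
  Ident :: "'o \<Rightarrow> 'm"
  Comp :: "'m \<Rightarrow> 'm \<Rightarrow> 'm"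

text \<open>\<open>Comp \<C> a b\<close> is the composite of \<open>a\<close> after \<open>b\<close>, defined when \<open>Dom \<C> a = Cod \<C> b\<close>.\<close>

abbreviation basis :: "'m \<Rightarrow> 'm \<Rightarrow>\<^sub>0 'k::field" where
  "basis m \<equiv> Poly_Mapping.single m 1"

definition category_algebra :: "('o, 'm) cat \<Rightarrow> ('k::field, 'm \<Rightarrow>\<^sub>0 'k) module" where
  "category_algebra \<C> =
    \<lparr>carrier = {f. Poly_Mapping.keys f \<subseteq> Mor \<C>},
     mult = (\<lambda>f g. \<Sum>a\<in>Poly_Mapping.keys f. \<Sum>b\<in>Poly_Mapping.keys g.
        if Dom \<C> a = Cod \<C> b
        then Poly_Mapping.single (Comp \<C> a b) (Poly_Mapping.lookup f a * Poly_Mapping.lookup g b)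
        else 0),
     one = (\<Sum>x\<in>Obj \<C>. basis (Ident \<C> x)),
     zero = 0,
     add = (+),
     smult = (\<lambda>c. Poly_Mapping.map ((*) c))\<rparr>"

text \<open>
  A quiver is a directed multigraph \<^typ>\<open>('v, 'a) pre_digraph\<close>; the arrow \<open>a\<close> goes from \<open>tail Q a\<close>
  to \<open>head Q a\<close>. A path \<open>\<alpha>\<^sub>m\<dots>\<alpha>\<^sub>1\<close> of positive length is the list \<open>[\<alpha>\<^sub>m, \<dots>, \<alpha>\<^sub>1]\<close>, in the order in
  which it is written (right to left), whereas \<open>awalk\<close> lists arrows in the order of traversal.
\<close>

definition nontrivial_paths :: "('v, 'a) pre_digraph \<Rightarrow> 'a list set" where
  "nontrivial_paths Q =
    {p. p \<noteq> [] \<and> pre_digraph.awalk Q (tail Q (last p)) (rev p) (head Q (hd p))}"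

definition acyclic_quiver :: "('v, 'a) pre_digraph \<Rightarrow> bool" where
  "acyclic_quiver Q \<longleftrightarrow> \<not> (\<exists>p\<in>nontrivial_paths Q. tail Q (last p) = head Q (hd p))"

datatype ('v, 'a) qpath = Trivial 'v | Arrows "'a list"

fun qpath_comp :: "('v, 'a) qpath \<Rightarrow> ('v, 'a) qpath \<Rightarrow> ('v, 'a) qpath" where
  "qpath_comp (Trivial _) q = q"
| "qpath_comp p (Trivial _) = p"
| "qpath_comp (Arrows p) (Arrows q) = Arrows (p @ q)"

definition path_category :: "('v, 'a) pre_digraph \<Rightarrow> ('v, ('v, 'a) qpath) cat" where
  "path_category Q =
    \<lparr>Obj = verts Q,
     Mor = Trivial ` verts Q \<union> Arrows ` nontrivial_paths Q,
     Dom = (\<lambda>m. case m of Trivial v \<Rightarrow> v | Arrows p \<Rightarrow> tail Q (last p)),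
     Cod = (\<lambda>m. case m of Trivial v \<Rightarrow> v | Arrows p \<Rightarrow> head Q (hd p)),
     Ident = Trivial,
     Comp = qpath_comp\<rparr>"

definition path_algebra ::
    "('v, 'a) pre_digraph \<Rightarrow> ('k::field, ('v, 'a) qpath \<Rightarrow>\<^sub>0 'k) module" where
  "path_algebra Q = category_algebra (path_category Q)"

section \<open>Bisets\<close>

record ('g, 'h, 'y) biset =
  pts :: "'y set"
  lact :: "'g \<Rightarrow> 'y \<Rightarrow> 'y"
  ract :: "'y \<Rightarrow> 'h \<Rightarrow> 'y"

definition is_biset :: "'g monoid \<Rightarrow> 'h monoid \<Rightarrow> ('g, 'h, 'y) biset \<Rightarrow> bool" where
  "is_biset G H Y \<longleftrightarrow>
    (\<forall>y\<in>pts Y. lact Y \<one>\<^bsub>G\<^esub> y = y \<and> ract Y y \<one>\<^bsub>H\<^esub> = y) \<and>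
    (\<forall>y\<in>pts Y. \<forall>g\<in>carrier G. lact Y g y \<in> pts Y) \<and>
    (\<forall>y\<in>pts Y. \<forall>h\<in>carrier H. ract Y y h \<in> pts Y) \<and>
    (\<forall>y\<in>pts Y. \<forall>g\<in>carrier G. \<forall>g'\<in>carrier G. lact Y (g \<otimes>\<^bsub>G\<^esub> g') y = lact Y g (lact Y g' y)) \<and>
    (\<forall>y\<in>pts Y. \<forall>h\<in>carrier H. \<forall>h'\<in>carrier H. ract Y y (h \<otimes>\<^bsub>H\<^esub> h') = ract Y (ract Y y h) h') \<and>
    (\<forall>y\<in>pts Y. \<forall>g\<in>carrier G. \<forall>h\<in>carrier H. ract Y (lact Y g y) h = lact Y g (ract Y y h))"

text \<open>The element \<open>y\<^sup>*\<close> of the dual biset is represented by \<open>y\<close> itself.\<close>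

definition dual_biset ::
    "'g monoid \<Rightarrow> 'h monoid \<Rightarrow> ('g, 'h, 'y) biset \<Rightarrow> ('h, 'g, 'y) biset" where
  "dual_biset G H Y =
    \<lparr>pts = pts Y,
     lact = (\<lambda>h y. ract Y y (inv\<^bsub>H\<^esub> h)),
     ract = (\<lambda>y g. lact Y (inv\<^bsub>G\<^esub> g) y)\<rparr>"

definition generated_equiv :: "'a set \<Rightarrow> ('a \<Rightarrow> 'a \<Rightarrow> bool) \<Rightarrow> ('a \<times> 'a) set" where
  "generated_equiv A r = {(x, y). x \<in> A \<and> y \<in> A \<and> equivclp r x y}"

definition biset_prod_rel ::
    "('g, 'h, 'y) biset \<Rightarrow> 'h monoid \<Rightarrow> ('h, 'l, 'z) biset \<Rightarrow> (('y \<times> 'z) \<times> ('y \<times> 'z)) set" where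
  "biset_prod_rel Y H Z = generated_equiv (pts Y \<times> pts Z)
    (\<lambda>u v. \<exists>y\<in>pts Y. \<exists>z\<in>pts Z. \<exists>h\<in>carrier H. u = (ract Y y h, z) \<and> v = (y, lact Z h z))"

definition biset_prod ::
    "('g, 'h, 'y) biset \<Rightarrow> 'h monoid \<Rightarrow> ('h, 'l, 'z) biset \<Rightarrow> ('g, 'l, ('y \<times> 'z) set) biset" where
  "biset_prod Y H Z =
    \<lparr>pts = (pts Y \<times> pts Z) // biset_prod_rel Y H Z,
     lact = (\<lambda>g \<xi>. \<Union>(y, z)\<in>\<xi>. biset_prod_rel Y H Z `` {(lact Y g y, z)}),
     ract = (\<lambda>\<xi> k. \<Union>(y, z)\<in>\<xi>. biset_prod_rel Y H Z `` {(y, ract Z z k)})\<rparr>"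

text \<open>A group \<open>G\<close> as a biset over itself on one side and, through \<open>\<phi> : H \<rightarrow> G\<close>, over \<open>H\<close> on the other.\<close>

definition restrict_right :: "'g monoid \<Rightarrow> ('h \<Rightarrow> 'g) \<Rightarrow> ('g, 'h, 'g) biset" where
  "restrict_right G \<phi> = \<lparr>pts = carrier G, lact = mult G, ract = (\<lambda>x h. x \<otimes>\<^bsub>G\<^esub> \<phi> h)\<rparr>"

definition restrict_left :: "('h \<Rightarrow> 'g) \<Rightarrow> 'g monoid \<Rightarrow> ('h, 'g, 'g) biset" where
  "restrict_left \<phi> G = \<lparr>pts = carrier G, lact = (\<lambda>h x. \<phi> h \<otimes>\<^bsub>G\<^esub> x), ract = mult G\<rparr>"

definition left_orbit_reps :: "'g monoid \<Rightarrow> ('g, 'h, 'y) biset \<Rightarrow> 'y set \<Rightarrow> bool" where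
  "left_orbit_reps G Y L \<longleftrightarrow>
    L \<subseteq> pts Y \<and> (\<forall>y\<in>pts Y. \<exists>!l. l \<in> L \<and> l \<in> {lact Y g y |g. g \<in> carrier G})"

definition right_orbit_reps :: "'h monoid \<Rightarrow> ('g, 'h, 'y) biset \<Rightarrow> 'y set \<Rightarrow> bool" where
  "right_orbit_reps H Y R \<longleftrightarrow>
    R \<subseteq> pts Y \<and> (\<forall>y\<in>pts Y. \<exists>!r. r \<in> R \<and> r \<in> {ract Y y h |h. h \<in> carrier H})"

section \<open>EI quivers and their preprojective algebras\<close>

record ('v, 'a, 'g, 'x) ei_quiver =
  quiver :: "('v, 'a) pre_digraph"
  grp :: "'v \<Rightarrow> 'g monoid"
  bis :: "'a \<Rightarrow> ('g, 'g, 'x) biset"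

definition finite_ei_quiver :: "('v, 'a, 'g, 'x) ei_quiver \<Rightarrow> bool" where
  "finite_ei_quiver E \<longleftrightarrow>
    fin_digraph (quiver E) \<and>
    (\<forall>v\<in>verts (quiver E). group (grp E v) \<and> finite (carrier (grp E v))) \<and>
    (\<forall>a\<in>arcs (quiver E).
      is_biset (grp E (head (quiver E) a)) (grp E (tail (quiver E) a)) (bis E a) \<and>
      finite (pts (bis E a)) \<and> pts (bis E a) \<noteq> {})"

text \<open>
  For a path \<open>p = [\<alpha>\<^sub>m, \<dots>, \<alpha>\<^sub>1]\<close> of positive length, the iterated product
  \<open>X(\<alpha>\<^sub>m) \<times> \<dots> \<times> X(\<alpha>\<^sub>1)\<close> over the groups at the inner vertices is the set of lists
  \<open>[x\<^sub>m, \<dots>, x\<^sub>1]\<close> with \<open>x\<^sub>k \<in> X(\<alpha>\<^sub>k)\<close>, modulo the equivalence relation generated by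
  \<open>[\<dots>, y g, z, \<dots>] \<sim> [\<dots>, y, g z, \<dots>]\<close> at any two neighbouring positions.
\<close>

definition path_tuples :: "('v, 'a, 'g, 'x) ei_quiver \<Rightarrow> 'a list \<Rightarrow> 'x list set" where
  "path_tuples E p = {xs. list_all2 (\<lambda>x a. x \<in> pts (bis E a)) xs p}"

definition path_rel :: "('v, 'a, 'g, 'x) ei_quiver \<Rightarrow> 'a list \<Rightarrow> ('x list \<times> 'x list) set" where
  "path_rel E p = generated_equiv (path_tuples E p)
    (\<lambda>us vs. \<exists>xs\<in>path_tuples E p. \<exists>k. Suc k < length p \<and>
      (\<exists>g\<in>carrier (grp E (tail (quiver E) (p ! k))).
        us = xs[k := ract (bis E (p ! k)) (xs ! k) g] \<and>
        vs = xs[Suc k := lact (bis E (p ! Suc k)) g (xs ! Suc k)]))"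

definition path_biset :: "('v, 'a, 'g, 'x) ei_quiver \<Rightarrow> 'a list \<Rightarrow> 'x list set set" where
  "path_biset E p = path_tuples E p // path_rel E p"

text \<open>
  Morphisms of the category of an EI quiver: \<open>Elt v g\<close> is \<open>g \<in> X(e\<^sub>v) = X(v)\<close>, and \<open>PathElt p \<xi>\<close>
  is \<open>\<xi> \<in> X(p)\<close> for a path \<open>p\<close> of positive length.
\<close>

datatype ('v, 'a, 'g, 'x) ei_mor = Elt 'v 'g | PathElt "'a list" "'x list set"

fun ei_comp :: "('v, 'a, 'g, 'x) ei_quiver \<Rightarrow>
    ('v, 'a, 'g, 'x) ei_mor \<Rightarrow> ('v, 'a, 'g, 'x) ei_mor \<Rightarrow> ('v, 'a, 'g, 'x) ei_mor" where
  "ei_comp E (Elt v g) (Elt _ h) = Elt v (g \<otimes>\<^bsub>grp E v\<^esub> h)"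
| "ei_comp E (Elt _ g) (PathElt p \<xi>) = PathElt p
    (path_rel E p `` {lact (bis E (hd p)) g (hd xs) # tl xs |xs. xs \<in> \<xi>})"
| "ei_comp E (PathElt p \<xi>) (Elt _ h) = PathElt p
    (path_rel E p `` {butlast xs @ [ract (bis E (last p)) (last xs) h] |xs. xs \<in> \<xi>})"
| "ei_comp E (PathElt p \<xi>) (PathElt q \<upsilon>) = PathElt (p @ q)
    (path_rel E (p @ q) `` {xs @ ys |xs ys. xs \<in> \<xi> \<and> ys \<in> \<upsilon>})"

definition ei_category ::
    "('v, 'a, 'g, 'x) ei_quiver \<Rightarrow> ('v, ('v, 'a, 'g, 'x) ei_mor) cat" where
  "ei_category E =
    \<lparr>Obj = verts (quiver E),
     Mor = {Elt v g |v g. v \<in> verts (quiver E) \<and> g \<in> carrier (grp E v)} \<union>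
       {PathElt p \<xi> |p \<xi>. p \<in> nontrivial_paths (quiver E) \<and> \<xi> \<in> path_biset E p},
     Dom = (\<lambda>m. case m of Elt v _ \<Rightarrow> v | PathElt p _ \<Rightarrow> tail (quiver E) (last p)),
     Cod = (\<lambda>m. case m of Elt v _ \<Rightarrow> v | PathElt p _ \<Rightarrow> head (quiver E) (hd p)),
     Ident = (\<lambda>v. Elt v \<one>\<^bsub>grp E v\<^esub>),
     Comp = ei_comp E\<rparr>"

text \<open>\<open>Inl a\<close> is the arrow \<open>a\<close> of the original quiver and \<open>Inr a\<close> is the reverse arrow \<open>a\<^sup>*\<close>.\<close>

definition double_quiver :: "('v, 'a) pre_digraph \<Rightarrow> ('v, 'a + 'a) pre_digraph" where
  "double_quiver Q =
    \<lparr>verts = verts Q, arcs = arcs Q <+> arcs Q,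
     tail = case_sum (tail Q) (head Q), head = case_sum (head Q) (tail Q)\<rparr>"

definition double_ei :: "('v, 'a, 'g, 'x) ei_quiver \<Rightarrow> ('v, 'a + 'a, 'g, 'x) ei_quiver" where
  "double_ei E =
    \<lparr>quiver = double_quiver (quiver E), grp = grp E,
     bis = case_sum (bis E)
       (\<lambda>a. dual_biset (grp E (head (quiver E) a)) (grp E (tail (quiver E) a)) (bis E a))\<rparr>"

definition arrow_elt :: "'a \<Rightarrow> 'x \<Rightarrow> ('v, 'a, 'g, 'x) ei_mor" where
  "arrow_elt a x = PathElt [a] {[x]}"

definition ei_preproj_relation ::
    "('v, 'a, 'g, 'x) ei_quiver \<Rightarrow> ('a \<Rightarrow> 'x set) \<Rightarrow> ('a \<Rightarrow> 'x set) \<Rightarrow>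
      ('v, 'a + 'a, 'g, 'x) ei_mor \<Rightarrow>\<^sub>0 'k::field" where
  "ei_preproj_relation E L R =
    (let A = category_algebra (ei_category (double_ei E)) in
      \<Sum>a\<in>arcs (quiver E).
        (\<Sum>b\<in>R a. basis (arrow_elt (Inl a) b) \<otimes>\<^bsub>A\<^esub> basis (arrow_elt (Inr a) b)) -
        (\<Sum>c\<in>L a. basis (arrow_elt (Inr a) c) \<otimes>\<^bsub>A\<^esub> basis (arrow_elt (Inl a) c)))"

text \<open>The representatives of the left and right orbits of the \<open>X(\<alpha>)\<close> are passed as \<open>L\<close> and \<open>R\<close>.\<close>

definition orbit_reps ::
    "('v, 'a, 'g, 'x) ei_quiver \<Rightarrow> ('a \<Rightarrow> 'x set) \<Rightarrow> ('a \<Rightarrow> 'x set) \<Rightarrow> bool" where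
  "orbit_reps E L R \<longleftrightarrow> (\<forall>a\<in>arcs (quiver E).
    left_orbit_reps (grp E (head (quiver E) a)) (bis E a) (L a) \<and>
    right_orbit_reps (grp E (tail (quiver E) a)) (bis E a) (R a))"

definition ei_preproj_algebra ::
    "('v, 'a, 'g, 'x) ei_quiver \<Rightarrow> ('a \<Rightarrow> 'x set) \<Rightarrow> ('a \<Rightarrow> 'x set) \<Rightarrow>
      ('k::field, (('v, 'a + 'a, 'g, 'x) ei_mor \<Rightarrow>\<^sub>0 'k) set) module" where
  "ei_preproj_algebra E L R =
    (let A = category_algebra (ei_category (double_ei E)) in
      quotient_algebra A (Idl\<^bsub>A\<^esub> {ei_preproj_relation E L R}))"

section \<open>Cartan triples\<close>

definition symmetrizer :: "int^'n^'n \<Rightarrow> int^'n^'n \<Rightarrow> bool" where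
  "symmetrizer C D \<longleftrightarrow>
    (\<forall>i j. i \<noteq> j \<longrightarrow> D $ i $ j = 0) \<and> (\<forall>i. D $ i $ i \<ge> 1) \<and> transpose (D ** C) = D ** C"

definition cartan_matrix :: "int^'n^'n \<Rightarrow> bool" where
  "cartan_matrix C \<longleftrightarrow>
    (\<forall>i. C $ i $ i = 2) \<and>
    (\<forall>i j. i \<noteq> j \<longrightarrow> C $ i $ j \<le> 0 \<and> (C $ i $ j < 0 \<longleftrightarrow> C $ j $ i < 0)) \<and>
    (\<exists>D. symmetrizer C D)"

definition orientation :: "int^'n^'n \<Rightarrow> ('n \<times> 'n) set \<Rightarrow> bool" where
  "orientation C \<Omega> \<longleftrightarrow>
    (\<forall>i j. {(i, j), (j, i)} \<inter> \<Omega> \<noteq> {} \<longleftrightarrow> C $ i $ j < 0) \<and>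
    (\<forall>t\<ge>1. \<forall>s :: nat \<Rightarrow> 'n. (\<forall>k\<in>{1..t}. (s k, s (k + 1)) \<in> \<Omega>) \<longrightarrow> s 1 \<noteq> s (t + 1))"

definition cartan_triple :: "int^'n^'n \<Rightarrow> int^'n^'n \<Rightarrow> ('n \<times> 'n) set \<Rightarrow> bool" where
  "cartan_triple C D \<Omega> \<longleftrightarrow> cartan_matrix C \<and> symmetrizer C D \<and> orientation C \<Omega>"

definition cartan_g :: "int^'n^'n \<Rightarrow> 'n \<Rightarrow> 'n \<Rightarrow> nat" where
  "cartan_g C i j = nat \<bar>gcd (C $ i $ j) (C $ j $ i)\<bar>"

definition cartan_f :: "int^'n^'n \<Rightarrow> 'n \<Rightarrow> 'n \<Rightarrow> nat" where
  "cartan_f C i j = nat \<bar>C $ i $ j\<bar> div cartan_g C i j"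

definition diag_entry :: "int^'n^'n \<Rightarrow> 'n \<Rightarrow> nat" where
  "diag_entry D i = nat (D $ i $ i)"

section \<open>The generalized preprojective algebra\<close>

definition double_orientation :: "('n \<times> 'n) set \<Rightarrow> ('n \<times> 'n) set" where
  "double_orientation \<Omega> = \<Omega> \<union> \<Omega>\<inverse>"

definition orientation_sgn :: "('n \<times> 'n) set \<Rightarrow> 'n \<Rightarrow> 'n \<Rightarrow> 'k::field" where
  "orientation_sgn \<Omega> i j = (if (i, j) \<in> \<Omega> then 1 else - 1)"

text \<open>\<open>Arr i j g\<close> is the arrow \<open>\<alpha>\<^sub>i\<^sub>j\<close> with upper index \<open>g\<close>, from \<open>j\<close> to \<open>i\<close>; \<open>Loop i\<close> is \<open>\<epsilon>\<^sub>i\<close>.\<close>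

datatype 'n gp_arrow = Arr 'n 'n nat | Loop 'n

definition gp_quiver :: "int^'n^'n \<Rightarrow> ('n \<times> 'n) set \<Rightarrow> ('n, 'n gp_arrow) pre_digraph" where
  "gp_quiver C \<Omega> =
    \<lparr>verts = UNIV,
     arcs = {Arr i j g |i j g. (i, j) \<in> double_orientation \<Omega> \<and> g \<in> {1..cartan_g C i j}} \<union> range Loop,
     tail = (\<lambda>a. case a of Arr i j g \<Rightarrow> j | Loop i \<Rightarrow> i),
     head = (\<lambda>a. case a of Arr i j g \<Rightarrow> i | Loop i \<Rightarrow> i)\<rparr>"

definition gp_relations ::
    "int^'n^'n \<Rightarrow> int^'n^'n \<Rightarrow> ('n \<times> 'n) set \<Rightarrow> (('n, 'n gp_arrow) qpath \<Rightarrow>\<^sub>0 'k::field) set" where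
  "gp_relations C D \<Omega> =
    (let A = path_algebra (gp_quiver C \<Omega>);
         \<epsilon> = (\<lambda>i. basis (Arrows [Loop i]));
         \<alpha> = (\<lambda>i j g. basis (Arrows [Arr i j g]))
     in
      {\<epsilon> k [^]\<^bsub>A\<^esub> diag_entry D k |k. True} \<union>
      {\<epsilon> i [^]\<^bsub>A\<^esub> cartan_f C j i \<otimes>\<^bsub>A\<^esub> \<alpha> i j g - \<alpha> i j g \<otimes>\<^bsub>A\<^esub> \<epsilon> j [^]\<^bsub>A\<^esub> cartan_f C i j |i j g.
        (i, j) \<in> double_orientation \<Omega> \<and> g \<in> {1..cartan_g C i j}} \<union>
      {\<Sum>j | (j, i) \<in> double_orientation \<Omega>.
         \<Sum>g = 1..cartan_g C j i. \<Sum>f = 0..cartan_f C j i - 1.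
           orientation_sgn \<Omega> i j \<odot>\<^bsub>A\<^esub>
             (\<epsilon> i [^]\<^bsub>A\<^esub> f \<otimes>\<^bsub>A\<^esub> \<alpha> i j g \<otimes>\<^bsub>A\<^esub> \<alpha> j i g \<otimes>\<^bsub>A\<^esub> \<epsilon> i [^]\<^bsub>A\<^esub> (cartan_f C j i - 1 - f)) |i. True})"

definition generalized_preproj_algebra ::
    "int^'n^'n \<Rightarrow> int^'n^'n \<Rightarrow> ('n \<times> 'n) set \<Rightarrow>
      ('k::field, (('n, 'n gp_arrow) qpath \<Rightarrow>\<^sub>0 'k) set) module" where
  "generalized_preproj_algebra C D \<Omega> =
    (let A = path_algebra (gp_quiver C \<Omega>) in quotient_algebra A (Idl\<^bsub>A\<^esub> (gp_relations C D \<Omega>)))"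

section \<open>The EI quiver of a Cartan triple\<close>

text \<open>
  The cyclic group \<open>\<langle>\<eta> | \<eta>\<^sup>c = 1\<rangle>\<close> is \<open>integer_mod_group c\<close>, with \<open>\<eta>\<^sup>t\<close> represented by \<open>t mod c\<close>. For \<open>k\<close>
  dividing \<open>c\<close>, \<open>cyclic_embedding k c\<close> is the homomorphism from the cyclic group of order \<open>k\<close>
  sending the generator to \<open>\<eta>\<close> to the power \<open>c div k\<close>.
\<close>

definition cyclic_embedding :: "nat \<Rightarrow> nat \<Rightarrow> int \<Rightarrow> int" where
  "cyclic_embedding k c t = (t * int (c div k)) mod int c"

definition cartan_quiver :: "int^'n^'n \<Rightarrow> ('n \<times> 'n) set \<Rightarrow> ('n, 'n \<times> 'n \<times> nat) pre_digraph" where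
  "cartan_quiver C \<Omega> =
    \<lparr>verts = UNIV,
     arcs = {(i, j, g). (i, j) \<in> \<Omega> \<and> g \<in> {1..cartan_g C i j}},
     tail = (\<lambda>(i, j, g). j),
     head = (\<lambda>(i, j, g). i)\<rparr>"

definition cartan_ei_quiver ::
    "int^'n^'n \<Rightarrow> int^'n^'n \<Rightarrow> ('n \<times> 'n) set \<Rightarrow>
      ('n, 'n \<times> 'n \<times> nat, int, (int \<times> int) set) ei_quiver" where
  "cartan_ei_quiver C D \<Omega> =
    \<lparr>quiver = cartan_quiver C \<Omega>,
     grp = (\<lambda>i. integer_mod_group (diag_entry D i)),
     bis = (\<lambda>(i, j, g).
       let ci = diag_entry D i; cj = diag_entry D j; k = gcd ci cj in
       biset_prod
         (restrict_right (integer_mod_group ci) (cyclic_embedding k ci))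
         (integer_mod_group k)
         (restrict_left (cyclic_embedding k cj) (integer_mod_group cj)))\<rparr>"

end

theory Submission
  imports Defs "HOL-Computational_Algebra.Primes"
begin

text \<open>
  Both quotients are compared through their homomorphisms to an arbitrary algebra. Since all \<open>c\<^sub>i\<close>
  are powers of \<open>p\<close>, putting \<open>\<epsilon>\<^sub>i = \<eta>\<^sub>i - 1\<close> identifies the group algebra of \<open>X(i)\<close> with
  \<open>\<bbbK>[\<epsilon>\<^sub>i]/(\<epsilon>\<^sub>i\<^bsup>c\<^sub>i\<^esup>)\<close>, and \<open>\<epsilon>\<^sup>F = \<eta>\<^sup>F - 1\<close> for the exponents \<open>F = f\<^sub>j\<^sub>i = c\<^sub>i / gcd(c\<^sub>i, c\<^sub>j)\<close>, so that the
  generator \<open>x\<close> of \<open>X(\<alpha>\<^sub>i\<^sub>j)\<close> satisfies the same commutation relation as \<open>\<alpha>\<^sub>i\<^sub>j\<close>. For the mesh relations one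
  uses that in characteristic \<open>p\<close>, for \<open>F\<close> a power of \<open>p\<close>,
  \<open>\<Sum>\<^sub>a\<^sub><\<^sub>F (1 + \<epsilon>)\<^sup>a M (1 + \<epsilon>)\<^bsup>F - 1 - a\<^esup> = \<Sum>\<^sub>a\<^sub><\<^sub>F \<epsilon>\<^sup>a M \<epsilon>\<^bsup>F - 1 - a\<^esup>\<close>, the coefficient of \<open>\<epsilon>\<^sup>r M \<epsilon>\<^sup>s\<close> on the left
  being the binomial coefficient \<open>F choose (r + s + 1)\<close>. Sending \<open>\<alpha>\<^sub>i\<^sub>j\<close> to \<open>x\<close> and \<open>\<alpha>\<^sub>j\<^sub>i\<close> to \<open>x\<^sup>* \<eta>\<^sub>i\<^bsup>-F\<^esup>\<close>, the mesh relation
  at \<open>i\<close> becomes \<open>\<rho> \<eta>\<^sub>i\<^bsup>-1\<^esup>\<close>; the twist by \<open>\<eta>\<^sub>i\<^bsup>-F\<^esup>\<close> makes the correction factor independent of \<open>j\<close>.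
\<close>

text \<open>Why one twist serves both ends of an arrow: an orbit representative contributes a
  conjugate eta^s M eta^(-s) to rho, whereas the two exponents in a mesh term add up to F - 1.
  Multiplying the conjugate by eta^(-1) gives eta^s (M eta^(-F)) eta^(F-1-s), so the exponents fit
  once eta^(-F) is absorbed in M. At the head i one has M = x x', and x' absorbs eta_i^(-F). At the
  tail j one has M = x' x, and the same twisted x' yields x' eta_i^(-F) x = x' x eta_j^(-F'), F'
  being the exponent at j, because the biset identifies eta_i^F x with x eta_j^F'. What is left over
  at a vertex k is eta_k^(-1), a unit of the corner at k, so the single element rho and the family
  of mesh relations vanish together. The number F has two origins that must be matched: it is the
  Cartan exponent f_ji, and it is the index of G_ij in X(i), which counts the right orbits of
  X(\<alpha>). The symmetry of DC makes them equal.\<close>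

hide_const (open) Multiset.mult

section \<open>Unital algebras and their homomorphisms\<close>

text \<open>Scalars range over a whole type, so only vectors need membership hypotheses.
  Compatibility with the product is required on both sides because the algebra need not be
  commutative.\<close>

locale unital_algebra = ring A for A :: "('k::field, 'm) module" (structure) +
  assumes smult_closed [simp, intro]: "x \<in> carrier A \<Longrightarrow> c \<odot> x \<in> carrier A"
    and smult_l_distr: "x \<in> carrier A \<Longrightarrow> (c + d) \<odot> x = c \<odot> x \<oplus> d \<odot> x"
    and smult_r_distr: "x \<in> carrier A \<Longrightarrow> y \<in> carrier A \<Longrightarrow> c \<odot> (x \<oplus> y) = c \<odot> x \<oplus> c \<odot> y"
    and smult_assoc: "x \<in> carrier A \<Longrightarrow> (c * d) \<odot> x = c \<odot> (d \<odot> x)"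
    and smult_one [simp]: "x \<in> carrier A \<Longrightarrow> 1 \<odot> x = x"
    and smult_mult_left: "x \<in> carrier A \<Longrightarrow> y \<in> carrier A \<Longrightarrow> (c \<odot> x) \<otimes> y = c \<odot> (x \<otimes> y)"
    and smult_mult_right: "x \<in> carrier A \<Longrightarrow> y \<in> carrier A \<Longrightarrow> x \<otimes> (c \<odot> y) = c \<odot> (x \<otimes> y)"
begin

lemma smult_zero_left [simp]:
  assumes "x \<in> carrier A" shows "0 \<odot> x = \<zero>"
proof -
  have "0 \<odot> x \<oplus> 0 \<odot> x = 0 \<odot> x"
    using smult_l_distr[OF assms, of 0 0] by simp
  then show ?thesis using assms by (metis add.l_cancel_one' smult_closed)
qed

lemma smult_zero_right [simp]: "c \<odot> \<zero> = \<zero>"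
proof -
  have "c \<odot> \<zero> \<oplus> c \<odot> \<zero> = c \<odot> \<zero>"
    using smult_r_distr[of \<zero> \<zero> c] by simp
  then show ?thesis by (metis add.l_cancel_one' smult_closed zero_closed)
qed

end

definition alg_hom :: "('k, 'm) module \<Rightarrow> ('k, 'l) module \<Rightarrow> ('m \<Rightarrow> 'l) set" where
  "alg_hom A B = {h \<in> ring_hom A B. \<forall>c. \<forall>x\<in>carrier A. h (c \<odot>\<^bsub>A\<^esub> x) = c \<odot>\<^bsub>B\<^esub> h x}"

lemma alg_homI:
  assumes "\<And>x. x \<in> carrier A \<Longrightarrow> h x \<in> carrier B"
    and "\<And>x y. x \<in> carrier A \<Longrightarrow> y \<in> carrier A \<Longrightarrow> h (x \<otimes>\<^bsub>A\<^esub> y) = h x \<otimes>\<^bsub>B\<^esub> h y"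
    and "\<And>x y. x \<in> carrier A \<Longrightarrow> y \<in> carrier A \<Longrightarrow> h (x \<oplus>\<^bsub>A\<^esub> y) = h x \<oplus>\<^bsub>B\<^esub> h y"
    and "h \<one>\<^bsub>A\<^esub> = \<one>\<^bsub>B\<^esub>"
    and "\<And>c x. x \<in> carrier A \<Longrightarrow> h (c \<odot>\<^bsub>A\<^esub> x) = c \<odot>\<^bsub>B\<^esub> h x"
  shows "h \<in> alg_hom A B"
  using assms by (auto simp: alg_hom_def ring_hom_def)

lemma alg_homD:
  assumes "h \<in> alg_hom A B"
  shows "x \<in> carrier A \<Longrightarrow> h x \<in> carrier B"
    and "x \<in> carrier A \<Longrightarrow> y \<in> carrier A \<Longrightarrow> h (x \<otimes>\<^bsub>A\<^esub> y) = h x \<otimes>\<^bsub>B\<^esub> h y"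
    and "x \<in> carrier A \<Longrightarrow> y \<in> carrier A \<Longrightarrow> h (x \<oplus>\<^bsub>A\<^esub> y) = h x \<oplus>\<^bsub>B\<^esub> h y"
    and "h \<one>\<^bsub>A\<^esub> = \<one>\<^bsub>B\<^esub>"
    and "x \<in> carrier A \<Longrightarrow> h (c \<odot>\<^bsub>A\<^esub> x) = c \<odot>\<^bsub>B\<^esub> h x"
  using assms by (auto simp: alg_hom_def ring_hom_def)

lemma alg_hom_comp:
  assumes "f \<in> alg_hom A B" "g \<in> alg_hom B C"
  shows "g \<circ> f \<in> alg_hom A C"
  using assms by (auto intro!: alg_homI simp: alg_homD[OF assms(1)] alg_homD[OF assms(2)])

locale unital_algebra_hom =
  A?: unital_algebra A + B?: unital_algebra B
  for A :: "('k::field, 'm) module" (structure) and B :: "('k, 'l) module" (structure) +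
  fixes h
  assumes alg_hom: "h \<in> alg_hom A B"
begin

sublocale ring_hom_ring A B h
  using alg_hom by unfold_locales (simp add: alg_hom_def)

lemma hom_smult [simp]: "x \<in> carrier A \<Longrightarrow> h (c \<odot>\<^bsub>A\<^esub> x) = c \<odot>\<^bsub>B\<^esub> h x"
  using alg_hom by (rule alg_homD)

lemma hom_minus [simp]:
  "x \<in> carrier A \<Longrightarrow> y \<in> carrier A \<Longrightarrow> h (x \<ominus>\<^bsub>A\<^esub> y) = h x \<ominus>\<^bsub>B\<^esub> h y"
  by (simp add: A.minus_eq B.minus_eq)

text \<open>The kernel is an ideal, so it contains the ideal generated by any of its subsets. This
  passes from the relations of a presentation to everything they generate.\<close>

lemma vanishes_on_genideal:
  assumes "S \<subseteq> carrier A" "\<And>x. x \<in> S \<Longrightarrow> h x = \<zero>\<^bsub>B\<^esub>" "x \<in> Idl\<^bsub>A\<^esub> S"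
  shows "h x = \<zero>\<^bsub>B\<^esub>"
proof -
  have "S \<subseteq> a_kernel A B h"
    using assms(1,2) unfolding a_kernel_def' by blast
  then have "Idl\<^bsub>A\<^esub> S \<subseteq> a_kernel A B h"
    by (rule A.genideal_minimal[OF kernel_is_ideal])
  then show ?thesis using assms(3) unfolding a_kernel_def' by blast
qed

end

lemma algebras_isomorphicI:
  assumes "f \<in> alg_hom A B" "g \<in> alg_hom B A"
    and "\<And>x. x \<in> carrier A \<Longrightarrow> g (f x) = x" "\<And>x. x \<in> carrier B \<Longrightarrow> f (g x) = x"
  shows "algebras_isomorphic A B"
proof -
  have "bij_betw f (carrier A) (carrier B)"
    using assms(3,4) alg_homD(1)[OF assms(1)] alg_homD(1)[OF assms(2)]
    by (intro bij_betw_byWitness[where f' = g]) auto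
  then have "f \<in> algebra_iso A B"
    using assms(1) by (simp add: algebra_iso_def alg_hom_def ring_iso_def)
  then show ?thesis by (auto simp: algebras_isomorphic_def)
qed

section \<open>Quotient algebras and their universal property\<close>

locale algebra_ideal = unital_algebra A + ideal I A
  for A :: "('k::field, 'm) module" (structure) and I
begin

abbreviation "\<Q> \<equiv> quotient_algebra A I"

lemma quotient_simps:
  "carrier \<Q> = (+>) I ` carrier A" "\<one>\<^bsub>\<Q>\<^esub> = I +> \<one>" "\<zero>\<^bsub>\<Q>\<^esub> = I"
  "x \<in> carrier A \<Longrightarrow> y \<in> carrier A \<Longrightarrow> (I +> x) \<otimes>\<^bsub>\<Q>\<^esub> (I +> y) = I +> (x \<otimes> y)"
  "x \<in> carrier A \<Longrightarrow> y \<in> carrier A \<Longrightarrow> (I +> x) \<oplus>\<^bsub>\<Q>\<^esub> (I +> y) = I +> (x \<oplus> y)"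
  by (auto simp: quotient_algebra_def FactRing_def A_RCOSETS_defs a_r_coset_def[symmetric]
      rcoset_mult_add a_rcos_sum)

lemma coset_eq_iff:
  assumes "x \<in> carrier A" "y \<in> carrier A"
  shows "I +> x = I +> y \<longleftrightarrow> x \<ominus> y \<in> I"
  using assms quotient_eq_iff_same_a_r_cos[OF is_ideal] by blast

text \<open>A scalar c acts as left multiplication by c times the unit, so ring ideals are stable
  under scalars.\<close>

lemma smult_in_ideal:
  assumes "x \<in> I" shows "c \<odot> x \<in> I"
proof -
  have x: "x \<in> carrier A" using assms by (rule a_Hcarr)
  then have "c \<odot> x = (c \<odot> \<one>) \<otimes> x" by (simp add: smult_mult_left)
  then show ?thesis using assms by (simp add: I_l_closed)
qed

text \<open>The scalar action on the quotient is a union over all representatives of a coset. The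
  cosets united all agree, since representatives differ by elements of I and I is stable under
  scalars.\<close>

lemma quotient_smult:
  assumes "x \<in> carrier A"
  shows "c \<odot>\<^bsub>\<Q>\<^esub> (I +> x) = I +> (c \<odot> x)"
proof -
  have eq: "I +> (c \<odot> y) = I +> (c \<odot> x)" if "y \<in> I +> x" for y
  proof -
    obtain k where k: "k \<in> I" "y = k \<oplus> x"
      using \<open>y \<in> I +> x\<close> by (auto simp: a_r_coset_def')
    have kc: "k \<in> carrier A" using k(1) by (rule a_Hcarr)
    have "c \<odot> y \<ominus> c \<odot> x = c \<odot> k"
      using k kc assms by (simp add: smult_r_distr minus_eq a_assoc r_neg)
    then show ?thesis
      using coset_eq_iff[of "c \<odot> y" "c \<odot> x"] k kc assms smult_in_ideal by simp
  qed
  have "x \<in> I +> x" using assms by (rule a_rcos_self)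
  then have "(\<Union>y\<in>I +> x. I +> (c \<odot> y)) = I +> (c \<odot> x)"
    by (intro SUP_eq_const eq) blast
  then show ?thesis
    unfolding quotient_algebra_def module.simps .
qed

lemma unital_algebra_quotient: "unital_algebra \<Q>"
proof -
  interpret Q: ring "A Quot I" by (rule quotient_is_ring)
  \<comment> \<open>The quotient algebra and \<open>A Quot I\<close> are different records with the
    same ring fields, so the ring laws are carried over field by field.\<close>
  have Q: "carrier (A Quot I) = carrier \<Q>" "mult (A Quot I) = mult \<Q>" "one (A Quot I) = one \<Q>"
    "zero (A Quot I) = zero \<Q>" "add (A Quot I) = add \<Q>"
    by (simp_all add: quotient_algebra_def)
  have "abelian_group \<Q>"
    by (rule abelian_groupI, simp_all only: Q[symmetric])
      (rule Q.add.m_closed Q.zero_closed Q.add.m_assoc Q.add.m_comm Q.add.l_one Q.add.l_inv_ex; assumption)+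
  moreover have "Group.monoid \<Q>"
    by (rule monoidI) (simp_all only: Q[symmetric] Q.m_closed Q.m_assoc Q.one_closed Q.l_one Q.r_one)
  ultimately have "ring \<Q>"
    by (rule ringI) (simp_all only: Q[symmetric] Q.l_distr Q.r_distr)
  moreover have "unital_algebra_axioms \<Q>"
    by (unfold_locales; unfold quotient_simps(1); elim imageE; hypsubst)
      (simp_all add: quotient_smult quotient_simps(4,5) smult_l_distr smult_r_distr
        smult_assoc smult_mult_left smult_mult_right)
  ultimately show ?thesis
    by (rule unital_algebra.intro)
qed

lemma coset_alg_hom: "(+>) I \<in> alg_hom A \<Q>"
  by (intro alg_homI) (simp_all add: quotient_simps quotient_smult)

lemma alg_hom_eq_zero_coset: "x \<in> I \<Longrightarrow> I +> x = \<zero>\<^bsub>\<Q>\<^esub>"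
  by (simp add: quotient_simps(3) a_rcos_const)

lemma quotient_lift:
  assumes B: "unital_algebra B" and f: "f \<in> alg_hom A B"
    and ker: "\<And>x. x \<in> I \<Longrightarrow> f x = \<zero>\<^bsub>B\<^esub>"
  obtains g where "g \<in> alg_hom \<Q> B" "\<And>x. x \<in> carrier A \<Longrightarrow> g (I +> x) = f x"
proof
  interpret B: unital_algebra B by (rule B)
  interpret f: unital_algebra_hom A B f by unfold_locales (rule f)
  \<comment> \<open>The map f is constant on each coset of I, so the image of a coset is a singleton
    and \<open>the_elem\<close> reads off its value.\<close>
  let ?g = "\<lambda>X. the_elem (f ` X)"
  show g: "?g (I +> x) = f x" if "x \<in> carrier A" for x
  proof -
    have "f y = f x" if "y \<in> I +> x" for y
    proof -
      obtain k where k: "k \<in> I" "y = k \<oplus> x"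
        using \<open>y \<in> I +> x\<close> by (auto simp: a_r_coset_def')
      have "k \<in> carrier A" using k(1) by (rule a_Hcarr)
      then show ?thesis using k ker[OF k(1)] \<open>x \<in> carrier A\<close> by simp
    qed
    moreover have "x \<in> I +> x" using \<open>x \<in> carrier A\<close> by (rule a_rcos_self)
    ultimately have "f ` (I +> x) = {f x}" by blast
    then show ?thesis by (metis the_elem_eq)
  qed
  show "?g \<in> alg_hom \<Q> B"
    by (intro alg_homI; unfold quotient_simps(1,2); (elim imageE)?; hypsubst?)
      (simp_all add: quotient_simps(4,5) quotient_smult g)
qed

end

section \<open>Category algebras\<close>

text \<open>Finiteness is asked of the objects only, so that the identities have a sum. The quivers
  to which this is applied have loops or two-way arrows, hence in general infinitely many
  morphisms.\<close>

locale finite_category =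
  fixes \<C> :: "('o, 'm) cat"
  assumes finite_Obj: "finite (Obj \<C>)"
    and Ident_in: "x \<in> Obj \<C> \<Longrightarrow> Ident \<C> x \<in> Mor \<C>"
    and Dom_Ident: "x \<in> Obj \<C> \<Longrightarrow> Dom \<C> (Ident \<C> x) = x"
    and Cod_Ident: "x \<in> Obj \<C> \<Longrightarrow> Cod \<C> (Ident \<C> x) = x"
    and Dom_in: "a \<in> Mor \<C> \<Longrightarrow> Dom \<C> a \<in> Obj \<C>"
    and Cod_in: "a \<in> Mor \<C> \<Longrightarrow> Cod \<C> a \<in> Obj \<C>"
    and Comp_in: "\<lbrakk>a \<in> Mor \<C>; b \<in> Mor \<C>; Dom \<C> a = Cod \<C> b\<rbrakk> \<Longrightarrow> Comp \<C> a b \<in> Mor \<C>"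
    and Dom_Comp: "\<lbrakk>a \<in> Mor \<C>; b \<in> Mor \<C>; Dom \<C> a = Cod \<C> b\<rbrakk> \<Longrightarrow> Dom \<C> (Comp \<C> a b) = Dom \<C> b"
    and Cod_Comp: "\<lbrakk>a \<in> Mor \<C>; b \<in> Mor \<C>; Dom \<C> a = Cod \<C> b\<rbrakk> \<Longrightarrow> Cod \<C> (Comp \<C> a b) = Cod \<C> a"
    and Comp_assoc: "\<lbrakk>a \<in> Mor \<C>; b \<in> Mor \<C>; c \<in> Mor \<C>; Dom \<C> a = Cod \<C> b; Dom \<C> b = Cod \<C> c\<rbrakk>
      \<Longrightarrow> Comp \<C> (Comp \<C> a b) c = Comp \<C> a (Comp \<C> b c)"
    and Comp_Ident: "a \<in> Mor \<C> \<Longrightarrow> Comp \<C> a (Ident \<C> (Dom \<C> a)) = a"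
    and Ident_Comp: "a \<in> Mor \<C> \<Longrightarrow> Comp \<C> (Ident \<C> (Cod \<C> a)) a = a"

lemma lookup_map_times: "Poly_Mapping.lookup (Poly_Mapping.map ((*) c) f) x = c * Poly_Mapping.lookup f x"
  for f :: "'a \<Rightarrow>\<^sub>0 'k::field"
  by (auto simp: Poly_Mapping.map.rep_eq when_def)

lemma category_algebra_simps:
  "carrier (category_algebra \<C>) = {f. Poly_Mapping.keys f \<subseteq> Mor \<C>}"
  "one (category_algebra \<C>) = (\<Sum>x\<in>Obj \<C>. basis (Ident \<C> x))"
  "zero (category_algebra \<C>) = 0"
  "add (category_algebra \<C>) = (+)"
  "smult (category_algebra \<C>) = (\<lambda>c. Poly_Mapping.map ((*) c))"
  by (simp_all add: category_algebra_def)

text \<open>The product is defined over the exact supports, which change under addition. Over a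
  fixed finite superset the summands are visibly additive in each factor.\<close>

lemma category_algebra_mult_superset:
  assumes "finite S" "finite T" "Poly_Mapping.keys f \<subseteq> S" "Poly_Mapping.keys g \<subseteq> T"
  shows "f \<otimes>\<^bsub>category_algebra \<C>\<^esub> g = (\<Sum>a\<in>S. \<Sum>b\<in>T.
    if Dom \<C> a = Cod \<C> b
    then Poly_Mapping.single (Comp \<C> a b) (Poly_Mapping.lookup f a * Poly_Mapping.lookup g b) else 0)"
proof -
  have "f \<otimes>\<^bsub>category_algebra \<C>\<^esub> g = (\<Sum>a\<in>Poly_Mapping.keys f. \<Sum>b\<in>T.
    if Dom \<C> a = Cod \<C> b
    then Poly_Mapping.single (Comp \<C> a b) (Poly_Mapping.lookup f a * Poly_Mapping.lookup g b) else 0)"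
    unfolding category_algebra_def
    using assms by (simp, intro sum.cong refl sum.mono_neutral_left) (auto simp: in_keys_iff)
  also have "\<dots> = (\<Sum>a\<in>S. \<Sum>b\<in>T.
    if Dom \<C> a = Cod \<C> b
    then Poly_Mapping.single (Comp \<C> a b) (Poly_Mapping.lookup f a * Poly_Mapping.lookup g b) else 0)"
    using assms by (intro sum.mono_neutral_left) (auto intro!: sum.neutral simp: in_keys_iff)
  finally show ?thesis .
qed

lemma category_algebra_add_left:
  "(f + g) \<otimes>\<^bsub>category_algebra \<C>\<^esub> h = f \<otimes>\<^bsub>category_algebra \<C>\<^esub> h + g \<otimes>\<^bsub>category_algebra \<C>\<^esub> h"
proof -
  let ?S = "Poly_Mapping.keys f \<union> Poly_Mapping.keys g"
  have "Poly_Mapping.keys (f + g) \<subseteq> ?S" by (rule keys_add)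
  then show ?thesis
    by (simp add: category_algebra_mult_superset[of ?S "Poly_Mapping.keys h"] lookup_add
        distrib_right single_add sum.distrib[symmetric] if_distrib[of "\<lambda>x. _ + x"] cong: if_cong)
qed

lemma category_algebra_add_right:
  "h \<otimes>\<^bsub>category_algebra \<C>\<^esub> (f + g) = h \<otimes>\<^bsub>category_algebra \<C>\<^esub> f + h \<otimes>\<^bsub>category_algebra \<C>\<^esub> g"
proof -
  let ?S = "Poly_Mapping.keys f \<union> Poly_Mapping.keys g"
  have "Poly_Mapping.keys (f + g) \<subseteq> ?S" by (rule keys_add)
  then show ?thesis
    by (simp add: category_algebra_mult_superset[of "Poly_Mapping.keys h" ?S] lookup_add
        distrib_left single_add sum.distrib[symmetric] if_distrib[of "\<lambda>x. _ + x"] cong: if_cong)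
qed

lemma category_algebra_zero_left [simp]: "0 \<otimes>\<^bsub>category_algebra \<C>\<^esub> f = 0"
  by (simp add: category_algebra_def)

lemma category_algebra_zero_right [simp]: "f \<otimes>\<^bsub>category_algebra \<C>\<^esub> 0 = 0"
  by (simp add: category_algebra_def)

lemma category_algebra_sum_left:
  "(\<Sum>x\<in>S. f x) \<otimes>\<^bsub>category_algebra \<C>\<^esub> g = (\<Sum>x\<in>S. f x \<otimes>\<^bsub>category_algebra \<C>\<^esub> g)"
  by (induction S rule: infinite_finite_induct) (auto simp: category_algebra_add_left)

lemma category_algebra_sum_right:
  "g \<otimes>\<^bsub>category_algebra \<C>\<^esub> (\<Sum>x\<in>S. f x) = (\<Sum>x\<in>S. g \<otimes>\<^bsub>category_algebra \<C>\<^esub> f x)"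
  by (induction S rule: infinite_finite_induct) (auto simp: category_algebra_add_right)

lemma category_algebra_single:
  "Poly_Mapping.single a c \<otimes>\<^bsub>category_algebra \<C>\<^esub> Poly_Mapping.single b d =
    (if Dom \<C> a = Cod \<C> b then Poly_Mapping.single (Comp \<C> a b) (c * d) else 0)"
  by (subst category_algebra_mult_superset[of "{a}" "{b}"]) auto

section \<open>The category algebra as a unital algebra, and its universal property\<close>

context finite_category
begin

abbreviation "\<A> \<equiv> category_algebra \<C>"

lemma basis_closed: "m \<in> Mor \<C> \<Longrightarrow> Poly_Mapping.single m c \<in> carrier \<A>"
  by (auto simp: category_algebra_simps)

text \<open>A finitely supported function arises by adding one new key at a time. This reduces
  identities in the category algebra to scalar multiples of single morphisms.\<close>

lemma carrier_induct [consumes 1, case_names zero single add]: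
  assumes "f \<in> carrier \<A>" and zero: "P 0"
    and single: "\<And>m c. m \<in> Mor \<C> \<Longrightarrow> P (Poly_Mapping.single m c)"
    and add: "\<And>f g. f \<in> carrier \<A> \<Longrightarrow> g \<in> carrier \<A> \<Longrightarrow> P f \<Longrightarrow> P g \<Longrightarrow> P (f + g)"
  shows "P f"
  using assms(1)
proof (induction f rule: update_induct)
  case const
  show ?case by (rule zero)
next
  case (update f a b)
  have f: "f \<in> carrier \<A>" and a: "a \<in> Mor \<C>"
    using update by (auto simp: category_algebra_simps keys_update)
  have "Poly_Mapping.update a b f = f + Poly_Mapping.single a b"
    using update(1)
    by (intro poly_mapping_eqI) (auto simp: lookup_update lookup_add lookup_single when_def in_keys_iff)
  then show ?case using add[OF f basis_closed[OF a] update(3)[OF f] single[OF a]] by simp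
qed

lemma add_closed: "f \<in> carrier \<A> \<Longrightarrow> g \<in> carrier \<A> \<Longrightarrow> f + g \<in> carrier \<A>"
  using keys_add[of f g] by (auto simp: category_algebra_simps)

lemma mult_closed:
  assumes "f \<in> carrier \<A>" "g \<in> carrier \<A>"
  shows "f \<otimes>\<^bsub>\<A>\<^esub> g \<in> carrier \<A>"
  using assms(1)
proof (induction f rule: carrier_induct)
  case (single m c)
  from assms(2) show ?case
  proof (induction g rule: carrier_induct)
    case (single m' c')
    then show ?case
      using \<open>m \<in> Mor \<C>\<close> by (auto simp: category_algebra_single category_algebra_simps Comp_in)
  next
    case (add f g)
    then show ?case by (simp add: category_algebra_add_right add_closed)
  qed (simp add: category_algebra_simps)
next
  case (add f f')
  then show ?case by (simp add: category_algebra_add_left add_closed)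
qed (simp add: category_algebra_simps)

lemma mult_assoc:
  assumes "f \<in> carrier \<A>" "g \<in> carrier \<A>" "h \<in> carrier \<A>"
  shows "(f \<otimes>\<^bsub>\<A>\<^esub> g) \<otimes>\<^bsub>\<A>\<^esub> h = f \<otimes>\<^bsub>\<A>\<^esub> (g \<otimes>\<^bsub>\<A>\<^esub> h)"
  using assms(1)
proof (induction f rule: carrier_induct)
  case f: (single a c)
  from assms(2) show ?case
  proof (induction g rule: carrier_induct)
    case g: (single b c')
    from assms(3) show ?case
    proof (induction h rule: carrier_induct)
      case h: (single d c'')
      show ?case using f g h
        by (auto simp: category_algebra_single Dom_Comp Cod_Comp Comp_assoc mult.assoc)
    qed (simp_all add: category_algebra_add_right)
  qed (simp_all add: category_algebra_add_left category_algebra_add_right)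
qed (simp_all add: category_algebra_add_left)

lemma one_mult_aux:
  assumes "f \<in> carrier \<A>"
  shows "\<one>\<^bsub>\<A>\<^esub> \<otimes>\<^bsub>\<A>\<^esub> f = f" "f \<otimes>\<^bsub>\<A>\<^esub> \<one>\<^bsub>\<A>\<^esub> = f"
proof -
  show "\<one>\<^bsub>\<A>\<^esub> \<otimes>\<^bsub>\<A>\<^esub> f = f"
    using assms
  proof (induction f rule: carrier_induct)
    case (single a c)
    have "\<one>\<^bsub>\<A>\<^esub> \<otimes>\<^bsub>\<A>\<^esub> Poly_Mapping.single a c =
        (\<Sum>x\<in>Obj \<C>. if x = Cod \<C> a then Poly_Mapping.single a c else 0)"
      using single Ident_Comp Dom_Ident
      by (auto simp: category_algebra_simps category_algebra_sum_left category_algebra_single intro!: sum.cong)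
    then show ?case using finite_Obj Cod_in[OF single] by simp
  qed (simp_all add: category_algebra_add_right)
  show "f \<otimes>\<^bsub>\<A>\<^esub> \<one>\<^bsub>\<A>\<^esub> = f"
    using assms
  proof (induction f rule: carrier_induct)
    case (single a c)
    have "Poly_Mapping.single a c \<otimes>\<^bsub>\<A>\<^esub> \<one>\<^bsub>\<A>\<^esub> =
        (\<Sum>x\<in>Obj \<C>. if x = Dom \<C> a then Poly_Mapping.single a c else 0)"
      using single Comp_Ident Cod_Ident
      by (auto simp: category_algebra_simps category_algebra_sum_right category_algebra_single intro!: sum.cong)
    then show ?case using finite_Obj Dom_in[OF single] by simp
  qed (simp_all add: category_algebra_add_left)
qed

lemma smult_single: "c \<odot>\<^bsub>\<A>\<^esub> Poly_Mapping.single m d = Poly_Mapping.single m (c * d)"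
  by (simp add: category_algebra_simps)

lemma unital_algebra_category_algebra: "unital_algebra \<A>"
proof -
  have "abelian_group \<A>"
  proof (rule abelian_groupI, goal_cases)
    case (1 x y)
    then show ?case using add_closed by (simp add: category_algebra_simps)
  next
    case (6 x)
    then have "- x \<in> carrier \<A>" "- x \<oplus>\<^bsub>\<A>\<^esub> x = \<zero>\<^bsub>\<A>\<^esub>"
      by (auto simp: category_algebra_simps in_keys_iff subset_iff)
    then show ?case by blast
  qed (auto simp: category_algebra_simps add_ac)
  moreover have one: "\<one>\<^bsub>\<A>\<^esub> \<in> carrier \<A>"
    using Ident_in by (auto simp: category_algebra_simps dest!: subsetD[OF Poly_Mapping.keys_sum])
  then have "Group.monoid \<A>"
    by (intro monoidI) (auto simp: mult_closed mult_assoc one_mult_aux)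
  ultimately have "ring \<A>"
    by (intro ringI) (auto simp: category_algebra_simps(4) category_algebra_add_left category_algebra_add_right)
  then interpret ring \<A> .
  have smult_add: "c \<odot>\<^bsub>\<A>\<^esub> (x + y) = c \<odot>\<^bsub>\<A>\<^esub> x + c \<odot>\<^bsub>\<A>\<^esub> y" for c x y
    by (intro poly_mapping_eqI) (simp add: category_algebra_simps lookup_map_times lookup_add distrib_left)
  have smult_0: "c \<odot>\<^bsub>\<A>\<^esub> 0 = 0" for c
    by (intro poly_mapping_eqI) (simp add: category_algebra_simps lookup_map_times)
  have l: "(c \<odot>\<^bsub>\<A>\<^esub> x) \<otimes>\<^bsub>\<A>\<^esub> y = c \<odot>\<^bsub>\<A>\<^esub> (x \<otimes>\<^bsub>\<A>\<^esub> y)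
      \<and> x \<otimes>\<^bsub>\<A>\<^esub> (c \<odot>\<^bsub>\<A>\<^esub> y) = c \<odot>\<^bsub>\<A>\<^esub> (x \<otimes>\<^bsub>\<A>\<^esub> y)"
    if x: "x \<in> carrier \<A>" and y: "y \<in> carrier \<A>" for c x y
    using x
  proof (induction x rule: carrier_induct)
    case (single m d)
    from y show ?case
    proof (induction y rule: carrier_induct)
      case (single m' d')
      show ?case by (simp add: smult_single smult_0 category_algebra_single mult_ac)
    qed (simp_all add: category_algebra_add_right smult_add smult_0)
  qed (simp_all add: smult_0 smult_add category_algebra_add_left)
  show ?thesis
  proof unfold_locales
    show "c \<odot>\<^bsub>\<A>\<^esub> x \<in> carrier \<A>" if "x \<in> carrier \<A>" for c x
      using that by (auto simp: category_algebra_simps lookup_map_times in_keys_iff subset_iff)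
    show "(c \<odot>\<^bsub>\<A>\<^esub> x) \<otimes>\<^bsub>\<A>\<^esub> y = c \<odot>\<^bsub>\<A>\<^esub> (x \<otimes>\<^bsub>\<A>\<^esub> y)"
      "x \<otimes>\<^bsub>\<A>\<^esub> (c \<odot>\<^bsub>\<A>\<^esub> y) = c \<odot>\<^bsub>\<A>\<^esub> (x \<otimes>\<^bsub>\<A>\<^esub> y)"
      if "x \<in> carrier \<A>" "y \<in> carrier \<A>" for c x y
      using l[OF that] by simp_all
  qed (simp_all add: category_algebra_simps poly_mapping_eq_iff fun_eq_iff
      lookup_map_times lookup_add distrib_left distrib_right mult.assoc)
qed

sublocale unital_algebra \<A>
  by (rule unital_algebra_category_algebra)

lemma sum_closed:
  assumes "\<And>x. x \<in> S \<Longrightarrow> g x \<in> carrier \<A>"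
  shows "(\<Sum>x\<in>S. g x) \<in> carrier \<A>"
  using assms
  by (induction S rule: infinite_finite_induct) (simp_all add: add_closed, simp_all add: category_algebra_simps)

lemma diff_closed: "f \<in> carrier \<A> \<Longrightarrow> g \<in> carrier \<A> \<Longrightarrow> f - g \<in> carrier \<A>"
  using keys_diff[of f g] by (auto simp: category_algebra_simps)

lemma minus_eq_diff:
  assumes "f \<in> carrier \<A>" "g \<in> carrier \<A>"
  shows "f \<ominus>\<^bsub>\<A>\<^esub> g = f - g"
proof -
  have "- g \<in> carrier \<A>" "- g + g = 0"
    using assms(2) by (auto simp: category_algebra_simps in_keys_iff subset_iff)
  then have "\<ominus>\<^bsub>\<A>\<^esub> g = - g"
    using assms(2) minus_equality[of "- g" g] by (simp add: category_algebra_simps)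
  then show ?thesis
    unfolding a_minus_def by (simp add: category_algebra_simps)
qed

lemma hom_sum:
  assumes B: "unital_algebra B" and h: "h \<in> alg_hom \<A> B"
    and g: "\<And>x. x \<in> S \<Longrightarrow> g x \<in> carrier \<A>"
  shows "h (\<Sum>x\<in>S. g x) = (\<Oplus>\<^bsub>B\<^esub>x\<in>S. h (g x))"
proof -
  interpret B: unital_algebra B by (rule B)
  interpret h: unital_algebra_hom \<A> B h by unfold_locales (rule h)
  have h0: "h 0 = \<zero>\<^bsub>B\<^esub>" using h.hom_zero by (simp add: category_algebra_simps)
  have hadd: "h (x + y) = h x \<oplus>\<^bsub>B\<^esub> h y" if "x \<in> carrier \<A>" "y \<in> carrier \<A>" for x y
    using h.hom_add[OF that] by (simp add: category_algebra_simps)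
  show ?thesis
    using g
  proof (induction S rule: infinite_finite_induct)
    case (insert x S)
    then show ?case
      by (simp add: hadd sum_closed B.finsum_insert Pi_def)
  qed (simp_all add: h0 B.finsum_infinite)
qed

lemma alg_hom_eqI:
  assumes B: "unital_algebra B" and f: "f \<in> alg_hom \<A> B" and g: "g \<in> alg_hom \<A> B"
    and eq: "\<And>m. m \<in> Mor \<C> \<Longrightarrow> f (basis m) = g (basis m)"
    and x: "x \<in> carrier \<A>"
  shows "f x = g x"
proof -
  interpret B: unital_algebra B by (rule B)
  interpret f: unital_algebra_hom \<A> B f by unfold_locales (rule f)
  interpret g: unital_algebra_hom \<A> B g by unfold_locales (rule g)
  from x show ?thesis
  proof (induction x rule: carrier_induct)
    case zero
    then show ?case using f.hom_zero g.hom_zero by (simp add: category_algebra_simps)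
  next
    case (single m c)
    then show ?case
      using f.hom_smult[of "basis m" c] g.hom_smult[of "basis m" c] eq[OF single]
      by (simp add: basis_closed smult_single)
  next
    case (add a b)
    then show ?case
      using f.hom_add[of a b] g.hom_add[of a b] by (simp add: category_algebra_simps)
  qed
qed

text \<open>The universal property of the category algebra. The zero case of \<open>F_mult\<close>
  is a genuine condition, since B has no notion of domain or codomain.\<close>

lemma linear_extension:
  fixes B :: "('k::field, 'l) module" (structure)
  assumes B: "unital_algebra B"
    and F: "\<And>m. m \<in> Mor \<C> \<Longrightarrow> F m \<in> carrier B"
    and F_mult: "\<And>a b. a \<in> Mor \<C> \<Longrightarrow> b \<in> Mor \<C> \<Longrightarrow>
      F a \<otimes> F b = (if Dom \<C> a = Cod \<C> b then F (Comp \<C> a b) else \<zero>)"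
    and F_one: "(\<Oplus>x\<in>Obj \<C>. F (Ident \<C> x)) = \<one>"
  obtains h where "h \<in> alg_hom \<A> B" "\<And>m. m \<in> Mor \<C> \<Longrightarrow> h (basis m) = F m"
proof
  interpret B: unital_algebra B by (rule B)
  define h where "h f = (\<Oplus>m\<in>Poly_Mapping.keys f. Poly_Mapping.lookup f m \<odot> F m)" for f
  \<comment> \<open>The support of a sum depends on both summands; evaluating over a common finite
    superset makes additivity a matter of splitting one sum.\<close>
  have superset: "h f = (\<Oplus>m\<in>S. Poly_Mapping.lookup f m \<odot> F m)"
    if "finite S" "Poly_Mapping.keys f \<subseteq> S" "S \<subseteq> Mor \<C>" for f S
    unfolding h_def using that F
    by (intro B.add.finprod_mono_neutral_cong_left) (auto simp: in_keys_iff)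
  have closed: "h f \<in> carrier B" if "f \<in> carrier \<A>" for f
    using that F by (auto simp: h_def category_algebra_simps intro!: B.finsum_closed)
  have hadd: "h (f + g) = h f \<oplus> h g" if "f \<in> carrier \<A>" "g \<in> carrier \<A>" for f g
  proof -
    let ?S = "Poly_Mapping.keys f \<union> Poly_Mapping.keys g"
    have S: "finite ?S" "?S \<subseteq> Mor \<C>" using that by (auto simp: category_algebra_simps)
    have "h (f + g) = (\<Oplus>m\<in>?S. Poly_Mapping.lookup f m \<odot> F m \<oplus> Poly_Mapping.lookup g m \<odot> F m)"
      using S(2) F by (subst superset[OF S(1) keys_add S(2)], intro B.finsum_cong')
        (auto simp: lookup_add B.smult_l_distr)
    also have "\<dots> = (\<Oplus>m\<in>?S. Poly_Mapping.lookup f m \<odot> F m) \<oplus> (\<Oplus>m\<in>?S. Poly_Mapping.lookup g m \<odot> F m)"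
      using S(2) F by (intro B.finsum_addf) auto
    also have "\<dots> = h f \<oplus> h g"
      using superset[OF S(1) _ S(2), of f] superset[OF S(1) _ S(2), of g] by simp
    finally show ?thesis .
  qed
  have h0: "h 0 = \<zero>" by (simp add: h_def)
  have hsingle: "h (Poly_Mapping.single m c) = c \<odot> F m" if "m \<in> Mor \<C>" for m c
    using that F by (subst superset[of "{m}"]) (auto simp: B.finsum_singleton)
  then show "h (basis m) = F m" if "m \<in> Mor \<C>" for m
    using that F by simp
  have smult: "h (c \<odot>\<^bsub>\<A>\<^esub> f) = c \<odot> h f" if "f \<in> carrier \<A>" for c f
    using that
  proof (induction f rule: carrier_induct)
    case zero
    show ?case using smult_zero_right[of c] by (simp add: category_algebra_simps h0)
  next
    case (single m d)
    then show ?case using F by (simp add: smult_single hsingle B.smult_assoc)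
  next
    case (add f g)
    then show ?case
      using smult_r_distr[of f g c] hadd
      by (simp add: category_algebra_simps(4) closed B.smult_r_distr)
  qed
  have mult: "h (f \<otimes>\<^bsub>\<A>\<^esub> g) = h f \<otimes> h g" if "f \<in> carrier \<A>" "g \<in> carrier \<A>" for f g
    using that(1)
  proof (induction f rule: carrier_induct)
    case f: (single a c)
    from that(2) show ?case
    proof (induction g rule: carrier_induct)
      case g: (single b d)
      show ?case
        using f g F F_mult[OF f g]
        by (auto simp: category_algebra_single hsingle h0 Comp_in B.smult_mult_left B.smult_mult_right
            B.smult_assoc[symmetric] mult.commute)
    next
      case (add g g')
      then show ?case using f
        by (simp add: category_algebra_add_right hadd
            mult_closed basis_closed closed B.r_distr)
    qed (simp add: h0 f hsingle F)
  next
    case (add f f')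
    then show ?case using that(2)
      by (simp add: category_algebra_add_left hadd
          mult_closed closed B.l_distr)
  qed (simp add: h0 closed that(2))
  have sum: "h (\<Sum>x\<in>S. g x) = (\<Oplus>x\<in>S. h (g x))" if "\<And>x. x \<in> S \<Longrightarrow> g x \<in> carrier \<A>" for g and S :: "'o set"
    using that
  proof (induction S rule: infinite_finite_induct)
    case (insert x S)
    then show ?case
      by (simp add: hadd
          sum_closed B.finsum_insert Pi_def closed)
  qed (simp_all add: h0 B.finsum_infinite)
  have "h \<one>\<^bsub>\<A>\<^esub> = (\<Oplus>x\<in>Obj \<C>. h (basis (Ident \<C> x)))"
    using Ident_in by (simp add: category_algebra_simps(2) sum basis_closed)
  also have "\<dots> = (\<Oplus>x\<in>Obj \<C>. F (Ident \<C> x))"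
    using F Ident_in by (intro B.finsum_cong') (auto simp: hsingle)
  finally have one: "h \<one>\<^bsub>\<A>\<^esub> = \<one>"
    by (simp add: F_one)
  show "h \<in> alg_hom \<A> B"
    by (intro alg_homI) (simp_all add: closed mult one smult, simp add: category_algebra_simps(4) hadd)
qed

end

section \<open>Path algebras\<close>

definition list_prod :: "('a, 'b) monoid_scheme \<Rightarrow> 'a list \<Rightarrow> 'a" where
  "list_prod G xs = foldr (mult G) xs \<one>\<^bsub>G\<^esub>"

lemma list_prod_simps [simp]:
  "list_prod G [] = \<one>\<^bsub>G\<^esub>" "list_prod G (x # xs) = x \<otimes>\<^bsub>G\<^esub> list_prod G xs"
  by (simp_all add: list_prod_def)

context Group.monoid
begin

lemma list_prod_closed [simp, intro]: "set xs \<subseteq> carrier G \<Longrightarrow> list_prod G xs \<in> carrier G"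
  by (induction xs) auto

lemma list_prod_append:
  "set xs \<subseteq> carrier G \<Longrightarrow> set ys \<subseteq> carrier G \<Longrightarrow> list_prod G (xs @ ys) = list_prod G xs \<otimes> list_prod G ys"
  by (induction xs) (auto simp: m_assoc)

lemma list_prod_absorb_left:
  assumes "xs \<noteq> []" "set xs \<subseteq> carrier G" "e \<in> carrier G" "e \<otimes> hd xs = hd xs"
  shows "e \<otimes> list_prod G xs = list_prod G xs"
  using assms by (cases xs) (auto simp: m_assoc[symmetric])

lemma list_prod_absorb_right:
  assumes "xs \<noteq> []" "set xs \<subseteq> carrier G" "e \<in> carrier G" "last xs \<otimes> e = last xs"
  shows "list_prod G xs \<otimes> e = list_prod G xs"
  using assms by (induction xs) (auto simp: m_assoc split: if_splits)

end

locale complete_idempotents = unital_algebra B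
  for B :: "('k::field, 'm) module" (structure) +
  fixes V :: "'v set" and e :: "'v \<Rightarrow> 'm"
  assumes finite_V: "finite V"
    and e_closed [simp, intro]: "v \<in> V \<Longrightarrow> e v \<in> carrier B"
    and e_mult: "u \<in> V \<Longrightarrow> v \<in> V \<Longrightarrow> e u \<otimes> e v = (if u = v then e u else \<zero>)"
    and e_sum: "(\<Oplus>v\<in>V. e v) = \<one>"
begin

text \<open>Two orthogonal idempotents stand between x and y. This supplies the zero case of
  \<open>linear_extension\<close> for morphisms that do not compose.\<close>

lemma mult_mismatch:
  assumes "x \<in> carrier B" "y \<in> carrier B" "u \<in> V" "v \<in> V" "u \<noteq> v" "x \<otimes> e u = x" "e v \<otimes> y = y"
  shows "x \<otimes> y = \<zero>"
proof -
  have "x \<otimes> y = x \<otimes> (e u \<otimes> e v) \<otimes> y"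
    using assms by (metis e_closed m_assoc m_closed)
  then show ?thesis using assms by (simp add: e_mult)
qed

end

section \<open>Paths written right to left, and the universal property of the path algebra\<close>

lemma cas_last: "pre_digraph.cas G u p v \<Longrightarrow> p \<noteq> [] \<Longrightarrow> head G (last p) = v"
  by (induction p arbitrary: u) (auto simp: pre_digraph.cas.simps split: if_splits)

context wf_digraph
begin

lemma nontrivial_paths_not_Nil: "p \<in> nontrivial_paths G \<Longrightarrow> p \<noteq> []"
  by (simp add: nontrivial_paths_def)

lemma nontrivial_paths_single: "[a] \<in> nontrivial_paths G \<longleftrightarrow> a \<in> arcs G"
  by (auto simp: nontrivial_paths_def awalk_simps)

text \<open>Paths are written right to left while walks are listed in the order of traversal, so an
  arrow put in front of a path is an arc appended to the walk.\<close>

lemma nontrivial_paths_Cons: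
  assumes "p \<noteq> []"
  shows "a # p \<in> nontrivial_paths G \<longleftrightarrow>
    a \<in> arcs G \<and> p \<in> nontrivial_paths G \<and> tail G a = head G (hd p)"
proof -
  have "awalk (tail G (last p)) (rev p @ [a]) (head G a) \<longleftrightarrow>
      awalk (tail G (last p)) (rev p) (tail G a) \<and> a \<in> arcs G"
    by (auto simp: awalk_simps)
  also have "awalk (tail G (last p)) (rev p) (tail G a) \<and> a \<in> arcs G \<longleftrightarrow>
     awalk (tail G (last p)) (rev p) (head G (hd p)) \<and> tail G a = head G (hd p) \<and> a \<in> arcs G"
    using assms cas_last[of G "tail G (last p)" "rev p" "tail G a"]
    by (auto simp: awalk_def last_rev)
  finally show ?thesis
    using assms by (auto simp: nontrivial_paths_def)
qed

lemma nontrivial_paths_append: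
  assumes "p \<noteq> []" "q \<noteq> []"
  shows "p @ q \<in> nontrivial_paths G \<longleftrightarrow>
    p \<in> nontrivial_paths G \<and> q \<in> nontrivial_paths G \<and> tail G (last p) = head G (hd q)"
  using assms(1)
proof (induction p)
  case (Cons a p)
  then show ?case
    using assms(2)
    by (cases "p = []") (auto simp: nontrivial_paths_Cons nontrivial_paths_single)
qed simp

lemma nontrivial_paths_arcs: "p \<in> nontrivial_paths G \<Longrightarrow> set p \<subseteq> arcs G"
  by (auto simp: nontrivial_paths_def awalk_def)

lemma nontrivial_paths_ends:
  assumes "p \<in> nontrivial_paths G"
  shows "hd p \<in> arcs G" "last p \<in> arcs G" "head G (hd p) \<in> verts G" "tail G (last p) \<in> verts G"
  using nontrivial_paths_arcs[OF assms] nontrivial_paths_not_Nil[OF assms]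
  by (auto intro!: head_in_verts tail_in_verts)

lemma nontrivial_paths_induct [consumes 1, case_names single Cons]:
  assumes "p \<in> nontrivial_paths G"
    and single: "\<And>a. a \<in> arcs G \<Longrightarrow> P [a]"
    and Cons: "\<And>a p. a \<in> arcs G \<Longrightarrow> p \<in> nontrivial_paths G \<Longrightarrow> tail G a = head G (hd p) \<Longrightarrow> P p \<Longrightarrow> P (a # p)"
  shows "P p"
  using assms(1)
proof (induction p)
  case Nil
  then show ?case by (simp add: nontrivial_paths_def)
next
  case (Cons a p)
  then show ?case
    using assms(2,3) by (cases "p = []") (auto simp: nontrivial_paths_Cons nontrivial_paths_single)
qed

end

lemma qpath_comp_assoc: "qpath_comp (qpath_comp a b) c = qpath_comp a (qpath_comp b c)"
  by (cases a; cases b; cases c) simp_all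

lemma path_category_simps:
  "Obj (path_category Q) = verts Q" "Ident (path_category Q) = Trivial"
  "Comp (path_category Q) = qpath_comp"
  "Mor (path_category Q) = Trivial ` verts Q \<union> Arrows ` nontrivial_paths Q"
  "Dom (path_category Q) (Trivial v) = v" "Cod (path_category Q) (Trivial v) = v"
  "Dom (path_category Q) (Arrows p) = tail Q (last p)"
  "Cod (path_category Q) (Arrows p) = head Q (hd p)"
  by (simp_all add: path_category_def)

context fin_digraph
begin

lemma finite_category_path_category: "finite_category (path_category G)"
proof -
  have comp: "qpath_comp a b \<in> Mor (path_category G) \<and>
      Dom (path_category G) (qpath_comp a b) = Dom (path_category G) b \<and>
      Cod (path_category G) (qpath_comp a b) = Cod (path_category G) a"
    if ab: "a \<in> Mor (path_category G)" "b \<in> Mor (path_category G)"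
      "Dom (path_category G) a = Cod (path_category G) b" for a b
  proof (cases "(a, b)" rule: qpath_comp.cases)
    case (3 p q)
    then have pq: "p \<in> nontrivial_paths G" "q \<in> nontrivial_paths G" "tail G (last p) = head G (hd q)"
      using ab by (auto simp: path_category_simps)
    then have "p \<noteq> []" "q \<noteq> []" using nontrivial_paths_not_Nil by blast+
    then show ?thesis using 3 pq by (simp add: path_category_simps nontrivial_paths_append)
  qed (use ab in \<open>auto simp: path_category_simps\<close>)
  have unit: "qpath_comp a (Trivial (Dom (path_category G) a)) = a"
    if "a \<in> Mor (path_category G)" for a
    by (cases a) (use that in \<open>auto simp: path_category_simps\<close>)
  have ends: "Dom (path_category G) a \<in> verts G" "Cod (path_category G) a \<in> verts G"
    if "a \<in> Mor (path_category G)" for a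
    using that nontrivial_paths_ends by (auto simp: path_category_simps)
  show ?thesis
    by (rule finite_category.intro; unfold path_category_simps(1,2,3))
      (use comp ends unit in \<open>simp_all add: qpath_comp_assoc path_category_simps\<close>)
qed

sublocale path: finite_category "path_category G"
  by (rule finite_category_path_category)

text \<open>A path goes to the product of the images of its arrows. Composition of paths is
  concatenation, so multiplicativity is that of list products, and the idempotents take care of
  trivial paths and of pairs that do not compose.\<close>

lemma path_algebra_hom:
  fixes B :: "('k::field, 'm) module"
  assumes e: "complete_idempotents B (verts G) e"
    and y: "\<And>a. a \<in> arcs G \<Longrightarrow> y a \<in> carrier B"
      "\<And>a. a \<in> arcs G \<Longrightarrow> e (head G a) \<otimes>\<^bsub>B\<^esub> y a = y a"
      "\<And>a. a \<in> arcs G \<Longrightarrow> y a \<otimes>\<^bsub>B\<^esub> e (tail G a) = y a"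
  obtains h where "h \<in> alg_hom (path_algebra G) B"
    "\<And>v. v \<in> verts G \<Longrightarrow> h (basis (Trivial v)) = e v"
    "\<And>a. a \<in> arcs G \<Longrightarrow> h (basis (Arrows [a])) = y a"
proof -
  interpret complete_idempotents B "verts G" e by (rule e)
  define F where "F m = (case m of Trivial v \<Rightarrow> e v | Arrows p \<Rightarrow> list_prod B (map y p))" for m
  have y_closed: "set (map y p) \<subseteq> carrier B" if "p \<in> nontrivial_paths G" for p
    using nontrivial_paths_arcs[OF that] y(1) by auto
  have F_closed: "F m \<in> carrier B" if "m \<in> Mor (path_category G)" for m
    using that y_closed by (auto simp: F_def path_category_simps)
  have left: "e (Cod (path_category G) m) \<otimes>\<^bsub>B\<^esub> F m = F m" if "m \<in> Mor (path_category G)" for m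
  proof (cases m)
    case (Arrows p)
    with that have p: "p \<in> nontrivial_paths G" by (auto simp: path_category_simps)
    show ?thesis
      using list_prod_absorb_left[OF _ y_closed[OF p]] nontrivial_paths_ends[OF p] nontrivial_paths_not_Nil[OF p]
      by (simp add: Arrows F_def path_category_simps hd_map y)
  qed (use that in \<open>auto simp: F_def path_category_simps e_mult\<close>)
  have right: "F m \<otimes>\<^bsub>B\<^esub> e (Dom (path_category G) m) = F m" if "m \<in> Mor (path_category G)" for m
  proof (cases m)
    case (Arrows p)
    with that have p: "p \<in> nontrivial_paths G" by (auto simp: path_category_simps)
    show ?thesis
      using list_prod_absorb_right[OF _ y_closed[OF p]] nontrivial_paths_ends[OF p] nontrivial_paths_not_Nil[OF p]
      by (simp add: Arrows F_def path_category_simps last_map y)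
  qed (use that in \<open>auto simp: F_def path_category_simps e_mult\<close>)
  have mult: "F a \<otimes>\<^bsub>B\<^esub> F b =
      (if Dom (path_category G) a = Cod (path_category G) b then F (Comp (path_category G) a b) else \<zero>\<^bsub>B\<^esub>)"
    if ab: "a \<in> Mor (path_category G)" "b \<in> Mor (path_category G)" for a b
  proof (cases "Dom (path_category G) a = Cod (path_category G) b")
    case False
    have v: "Dom (path_category G) a \<in> verts G" "Cod (path_category G) b \<in> verts G"
      using path.Dom_in[OF ab(1)] path.Cod_in[OF ab(2)] by (simp_all add: path_category_simps(1))
    show ?thesis
      using mult_mismatch[OF F_closed[OF ab(1)] F_closed[OF ab(2)] v False right[OF ab(1)] left[OF ab(2)]]
        False by simp
  next
    case True
    show ?thesis
    proof (cases a; cases b)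
      fix v q assume "a = Trivial v" "b = Arrows q"
      then show ?thesis using True left[OF ab(2)] by (simp add: F_def path_category_simps)
    next
      fix p v assume "a = Arrows p" "b = Trivial v"
      then show ?thesis using True right[OF ab(1)] by (simp add: F_def path_category_simps)
    next
      fix p q assume "a = Arrows p" "b = Arrows q"
      then show ?thesis
        using True ab list_prod_append[of "map y p" "map y q"] y_closed[of p] y_closed[of q]
        by (auto simp: F_def path_category_simps)
    qed (use True ab in \<open>auto simp: F_def path_category_simps e_mult\<close>)
  qed
  obtain h where h: "h \<in> alg_hom (category_algebra (path_category G)) B"
    "\<And>m. m \<in> Mor (path_category G) \<Longrightarrow> h (basis m) = F m"
    using path.linear_extension[OF unital_algebra_axioms F_closed mult]
    by (auto simp: F_def path_category_simps e_sum)
  show thesis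
  proof (rule that)
    show "h \<in> alg_hom (path_algebra G) B" using h(1) by (simp add: path_algebra_def)
    show "h (basis (Trivial v)) = e v" if "v \<in> verts G" for v
      using h(2)[of "Trivial v"] that by (auto simp: F_def path_category_simps)
    show "h (basis (Arrows [a])) = y a" if "a \<in> arcs G" for a
      using h(2)[of "Arrows [a]"] that y(1)[OF that]
      by (auto simp: F_def path_category_simps nontrivial_paths_single)
  qed
qed

lemma path_algebra_hom_eqI:
  assumes B: "unital_algebra B" and f: "f \<in> alg_hom (path_algebra G) B" and g: "g \<in> alg_hom (path_algebra G) B"
    and v: "\<And>v. v \<in> verts G \<Longrightarrow> f (basis (Trivial v)) = g (basis (Trivial v))"
    and a: "\<And>a. a \<in> arcs G \<Longrightarrow> f (basis (Arrows [a])) = g (basis (Arrows [a]))"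
    and x: "x \<in> carrier (path_algebra G)"
  shows "f x = g x"
proof (rule path.alg_hom_eqI[OF B f[unfolded path_algebra_def] g[unfolded path_algebra_def]])
  show "x \<in> carrier (category_algebra (path_category G))" using x by (simp add: path_algebra_def)
  fix m assume m: "m \<in> Mor (path_category G)"
  have "f (basis (Arrows p)) = g (basis (Arrows p))" if "p \<in> nontrivial_paths G" for p
    using that
  proof (induction p rule: nontrivial_paths_induct)
    case (Cons a p)
    have eq: "basis (Arrows (a # p)) = basis (Arrows [a]) \<otimes>\<^bsub>path_algebra G\<^esub> basis (Arrows p)"
      using Cons by (simp add: path_algebra_def category_algebra_single path_category_simps)
    have cl: "basis (Arrows [a]) \<in> carrier (path_algebra G)" "basis (Arrows p) \<in> carrier (path_algebra G)"
      using Cons by (auto simp: path_algebra_def path_category_simps nontrivial_paths_single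
          intro!: path.basis_closed)
    show ?case
      unfolding eq alg_homD(2)[OF f cl] alg_homD(2)[OF g cl] using Cons a by simp
  qed (rule a)
  then show "f (basis m) = g (basis m)"
    using m v by (auto simp: path_category_simps)
qed

end

section \<open>Category algebras of EI quivers\<close>

lemma equiv_generated_equiv: "equiv A (generated_equiv A r)"
  by (auto simp: equiv_def generated_equiv_def refl_on_def sym_def trans_def
      intro: equivclp_sym equivclp_trans)

lemma generated_equiv_map:
  assumes "(x, y) \<in> generated_equiv A r"
    and "\<And>x y. r x y \<Longrightarrow> equivclp s (f x) (f y)" "f x \<in> B" "f y \<in> B"
  shows "(f x, f y) \<in> generated_equiv B s"
proof -
  have "equivclp r x y" using assms(1) by (simp add: generated_equiv_def)
  then have "equivclp s (f x) (f y)"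
  proof (induction rule: equivclp_induct)
    case (step y z)
    then show ?case using assms(2) by (meson equivclp_sym equivclp_trans)
  qed simp
  then show ?thesis using assms(3,4) by (simp add: generated_equiv_def)
qed

lemma generated_equiv_invariant:
  assumes "(x, y) \<in> generated_equiv A r" "\<And>x y. r x y \<Longrightarrow> f x = f y"
  shows "f x = f y"
proof -
  have "equivclp r x y" using assms(1) by (simp add: generated_equiv_def)
  then show ?thesis by (induction rule: equivclp_induct) (use assms(2) in force)+
qed

section \<open>Iterated biset products along a path: moves, classes and end actions\<close>

definition path_step ::
    "('v, 'a, 'g, 'x) ei_quiver \<Rightarrow> 'a list \<Rightarrow> 'x list \<Rightarrow> 'x list \<Rightarrow> bool" where
  "path_step E p us vs \<longleftrightarrow> (\<exists>xs\<in>path_tuples E p. \<exists>k. Suc k < length p \<and>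
      (\<exists>g\<in>carrier (grp E (tail (quiver E) (p ! k))).
        us = xs[k := ract (bis E (p ! k)) (xs ! k) g] \<and>
        vs = xs[Suc k := lact (bis E (p ! Suc k)) g (xs ! Suc k)]))"

lemma path_rel_eq: "path_rel E p = generated_equiv (path_tuples E p) (path_step E p)"
  by (simp add: path_rel_def path_step_def[abs_def])

text \<open>Replaces updates at an index by a splitting of the path around two adjacent arrows.
  Concatenation then only lengthens the outer pieces q and r, and an action at an end can be located
  relative to the split.\<close>

lemma path_step_iff:
  "path_step E p us vs \<longleftrightarrow> (\<exists>q a b r xs y z ys g. p = q @ a # b # r \<and>
    us = xs @ ract (bis E a) y g # z # ys \<and> vs = xs @ y # lact (bis E b) g z # ys \<and>
    xs \<in> path_tuples E q \<and> y \<in> pts (bis E a) \<and> z \<in> pts (bis E b) \<and> ys \<in> path_tuples E r \<and>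
    g \<in> carrier (grp E (tail (quiver E) a)))" (is "_ \<longleftrightarrow> ?R")
proof
  assume "path_step E p us vs"
  then obtain xs k g where xs: "xs \<in> path_tuples E p" and k: "Suc k < length p"
    and g: "g \<in> carrier (grp E (tail (quiver E) (p ! k)))"
    and us: "us = xs[k := ract (bis E (p ! k)) (xs ! k) g]"
    and vs: "vs = xs[Suc k := lact (bis E (p ! Suc k)) g (xs ! Suc k)]"
    unfolding path_step_def by blast
  have len: "length xs = length p" using xs by (auto simp: path_tuples_def list_all2_lengthD)
  have split: "zs = take k zs @ zs ! k # zs ! Suc k # drop (Suc (Suc k)) zs" if "Suc k < length zs" for zs :: "'z list"
    using that by (metis Cons_nth_drop_Suc Suc_lessD append_take_drop_id)
  have us': "us = take k xs @ ract (bis E (p ! k)) (xs ! k) g # xs ! Suc k # drop (Suc (Suc k)) xs"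
    unfolding us using k len by (subst split[of xs]) (simp_all add: list_update_append)
  have vs': "vs = take k xs @ xs ! k # lact (bis E (p ! Suc k)) g (xs ! Suc k) # drop (Suc (Suc k)) xs"
    unfolding vs using k len by (subst split[of xs]) (simp_all add: list_update_append)
  show ?R
    apply (rule exI[of _ "take k p"], rule exI[of _ "p ! k"], rule exI[of _ "p ! Suc k"],
        rule exI[of _ "drop (Suc (Suc k)) p"], rule exI[of _ "take k xs"], rule exI[of _ "xs ! k"],
        rule exI[of _ "xs ! Suc k"], rule exI[of _ "drop (Suc (Suc k)) xs"], rule exI[of _ g])
    using split[OF k] us' vs' g k xs len
    by (auto simp: path_tuples_def list_all2_conv_all_nth)
next
  assume ?R
  then obtain q a b r xs y z ys g where *: "p = q @ a # b # r"
    "us = xs @ ract (bis E a) y g # z # ys" "vs = xs @ y # lact (bis E b) g z # ys"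
    "xs \<in> path_tuples E q" "y \<in> pts (bis E a)" "z \<in> pts (bis E b)" "ys \<in> path_tuples E r"
    "g \<in> carrier (grp E (tail (quiver E) a))"
    by blast
  have len: "length xs = length q" using * by (auto simp: path_tuples_def list_all2_lengthD)
  show "path_step E p us vs"
    unfolding path_step_def
    by (rule bexI[of _ "xs @ y # z # ys"], rule exI[of _ "length q"], intro conjI, simp add: *(1),
        rule bexI[of _ g])
      (use * len in \<open>auto simp: path_tuples_def list_all2_append nth_append list_update_append\<close>)
qed

lemma path_stepI:
  "\<lbrakk>p = q @ a # b # r; us = xs @ ract (bis E a) y g # z # ys; vs = xs @ y # lact (bis E b) g z # ys;
    xs \<in> path_tuples E q; y \<in> pts (bis E a); z \<in> pts (bis E b); ys \<in> path_tuples E r;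
    g \<in> carrier (grp E (tail (quiver E) a))\<rbrakk> \<Longrightarrow> path_step E p us vs"
  unfolding path_step_iff by blast

definition path_class :: "('v, 'a, 'g, 'x) ei_quiver \<Rightarrow> 'a list \<Rightarrow> 'x list \<Rightarrow> 'x list set" where
  "path_class E p xs = path_rel E p `` {xs}"

definition left_act :: "('v, 'a, 'g, 'x) ei_quiver \<Rightarrow> 'a list \<Rightarrow> 'g \<Rightarrow> 'x list \<Rightarrow> 'x list" where
  "left_act E p g xs = lact (bis E (hd p)) g (hd xs) # tl xs"

definition right_act :: "('v, 'a, 'g, 'x) ei_quiver \<Rightarrow> 'a list \<Rightarrow> 'x list \<Rightarrow> 'g \<Rightarrow> 'x list" where
  "right_act E p xs h = butlast xs @ [ract (bis E (last p)) (last xs) h]"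

lemma path_class_self: "xs \<in> path_tuples E p \<Longrightarrow> xs \<in> path_class E p xs"
  unfolding path_class_def path_rel_eq using equiv_class_self[OF equiv_generated_equiv] .

lemma path_class_memD: "ys \<in> path_class E p xs \<Longrightarrow> (xs, ys) \<in> path_rel E p \<and> ys \<in> path_tuples E p"
  by (auto simp: path_class_def path_rel_eq generated_equiv_def)

lemma path_biset_eq: "path_biset E p = path_class E p ` path_tuples E p"
  by (auto simp: path_biset_def quotient_def path_class_def)

text \<open>A single arrow has no pair of neighbouring positions, so its relation is equality. This
  justifies the encoding of \<open>arrow_elt\<close> by a singleton class.\<close>

lemma path_class_single: "x \<in> pts (bis E a) \<Longrightarrow> path_class E [a] [x] = {[x]}"
proof -
  assume x: "x \<in> pts (bis E a)"
  have "us = vs" if "(us, vs) \<in> path_rel E [a]" for us vs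
    using generated_equiv_invariant[OF that[unfolded path_rel_eq], of id]
    by (auto simp: path_step_def)
  then show ?thesis
    using path_class_self[of "[x]" E "[a]"] x
    by (auto simp: path_class_def path_tuples_def)
qed

lemma path_tuples_Nil [simp]: "xs \<in> path_tuples E [] \<longleftrightarrow> xs = []"
  by (simp add: path_tuples_def)

lemma path_tuples_Cons [simp]:
  "x # xs \<in> path_tuples E (a # p) \<longleftrightarrow> x \<in> pts (bis E a) \<and> xs \<in> path_tuples E p"
  by (simp add: path_tuples_def)

lemma path_tuples_length: "xs \<in> path_tuples E p \<Longrightarrow> length xs = length p"
  by (simp add: path_tuples_def list_all2_lengthD)

lemma path_tuples_ConsE:
  assumes "xs \<in> path_tuples E (a # p)"
  obtains x xs' where "xs = x # xs'" "x \<in> pts (bis E a)" "xs' \<in> path_tuples E p"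
  using assms by (cases xs) (auto simp: path_tuples_def)

lemma path_tuples_append:
  "xs \<in> path_tuples E p \<Longrightarrow> ys \<in> path_tuples E q \<Longrightarrow> xs @ ys \<in> path_tuples E (p @ q)"
  by (simp add: path_tuples_def list_all2_appendI)

lemma path_tuples_snocE:
  assumes "xs \<in> path_tuples E (p @ [a])"
  obtains x xs' where "xs = xs' @ [x]" "x \<in> pts (bis E a)" "xs' \<in> path_tuples E p"
  using assms by (auto simp: path_tuples_def list_all2_append2 list_all2_Cons2)

lemma path_step_append_right:
  assumes "path_step E p us vs" "ws \<in> path_tuples E r"
  shows "path_step E (p @ r) (us @ ws) (vs @ ws)"
proof -
  from assms(1) obtain q a b r' xs y z ys g where *: "p = q @ a # b # r'"
    "us = xs @ ract (bis E a) y g # z # ys" "vs = xs @ y # lact (bis E b) g z # ys"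
    "xs \<in> path_tuples E q" "y \<in> pts (bis E a)" "z \<in> pts (bis E b)" "ys \<in> path_tuples E r'"
    "g \<in> carrier (grp E (tail (quiver E) a))"
    unfolding path_step_iff by blast
  show ?thesis
      by (rule path_stepI[where q = q and a = a and b = b and r = "r' @ r" and xs = xs and y = y and z = z and ys = "ys @ ws" and g = g])
      (use * assms(2) in \<open>auto intro: path_tuples_append\<close>)
qed

lemma path_step_append_left:
  assumes "path_step E p us vs" "ws \<in> path_tuples E r"
  shows "path_step E (r @ p) (ws @ us) (ws @ vs)"
proof -
  from assms(1) obtain q a b r' xs y z ys g where *: "p = q @ a # b # r'"
    "us = xs @ ract (bis E a) y g # z # ys" "vs = xs @ y # lact (bis E b) g z # ys"
    "xs \<in> path_tuples E q" "y \<in> pts (bis E a)" "z \<in> pts (bis E b)" "ys \<in> path_tuples E r'"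
    "g \<in> carrier (grp E (tail (quiver E) a))"
    unfolding path_step_iff by blast
  show ?thesis
      by (rule path_stepI[where q = "r @ q" and a = a and b = b and r = r' and xs = "ws @ xs" and y = y and z = z and ys = ys and g = g])
      (use * assms(2) in \<open>auto intro: path_tuples_append\<close>)
qed

locale ei_quiver_data =
  fixes E :: "('v, 'a, 'g, 'x) ei_quiver"
  assumes finite_ei_quiver: "finite_ei_quiver E"
begin

abbreviation "Q \<equiv> quiver E"

sublocale fin_digraph Q
  using finite_ei_quiver by (simp add: finite_ei_quiver_def)

lemma group_grp: "v \<in> verts Q \<Longrightarrow> group (grp E v)"
  using finite_ei_quiver by (simp add: finite_ei_quiver_def)

lemma biset_laws:
  assumes "a \<in> arcs Q" "y \<in> pts (bis E a)"
  shows "lact (bis E a) \<one>\<^bsub>grp E (head Q a)\<^esub> y = y" "ract (bis E a) y \<one>\<^bsub>grp E (tail Q a)\<^esub> = y"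
    "g \<in> carrier (grp E (head Q a)) \<Longrightarrow> lact (bis E a) g y \<in> pts (bis E a)"
    "h \<in> carrier (grp E (tail Q a)) \<Longrightarrow> ract (bis E a) y h \<in> pts (bis E a)"
    "g \<in> carrier (grp E (head Q a)) \<Longrightarrow> g' \<in> carrier (grp E (head Q a)) \<Longrightarrow>
      lact (bis E a) (g \<otimes>\<^bsub>grp E (head Q a)\<^esub> g') y = lact (bis E a) g (lact (bis E a) g' y)"
    "h \<in> carrier (grp E (tail Q a)) \<Longrightarrow> h' \<in> carrier (grp E (tail Q a)) \<Longrightarrow>
      ract (bis E a) y (h \<otimes>\<^bsub>grp E (tail Q a)\<^esub> h') = ract (bis E a) (ract (bis E a) y h) h'"
    "g \<in> carrier (grp E (head Q a)) \<Longrightarrow> h \<in> carrier (grp E (tail Q a)) \<Longrightarrow>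
      ract (bis E a) (lact (bis E a) g y) h = lact (bis E a) g (ract (bis E a) y h)"
proof -
  have "is_biset (grp E (head Q a)) (grp E (tail Q a)) (bis E a)"
    using finite_ei_quiver assms(1) by (simp add: finite_ei_quiver_def)
  then show "lact (bis E a) \<one>\<^bsub>grp E (head Q a)\<^esub> y = y" "ract (bis E a) y \<one>\<^bsub>grp E (tail Q a)\<^esub> = y"
    "g \<in> carrier (grp E (head Q a)) \<Longrightarrow> lact (bis E a) g y \<in> pts (bis E a)"
    "h \<in> carrier (grp E (tail Q a)) \<Longrightarrow> ract (bis E a) y h \<in> pts (bis E a)"
    "g \<in> carrier (grp E (head Q a)) \<Longrightarrow> g' \<in> carrier (grp E (head Q a)) \<Longrightarrow>
      lact (bis E a) (g \<otimes>\<^bsub>grp E (head Q a)\<^esub> g') y = lact (bis E a) g (lact (bis E a) g' y)"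
    "h \<in> carrier (grp E (tail Q a)) \<Longrightarrow> h' \<in> carrier (grp E (tail Q a)) \<Longrightarrow>
      ract (bis E a) y (h \<otimes>\<^bsub>grp E (tail Q a)\<^esub> h') = ract (bis E a) (ract (bis E a) y h) h'"
    "g \<in> carrier (grp E (head Q a)) \<Longrightarrow> h \<in> carrier (grp E (tail Q a)) \<Longrightarrow>
      ract (bis E a) (lact (bis E a) g y) h = lact (bis E a) g (ract (bis E a) y h)"
    using assms(2) unfolding is_biset_def by simp_all
qed

lemma left_act_closed:
  assumes "p \<in> nontrivial_paths Q" "xs \<in> path_tuples E p" "g \<in> carrier (grp E (head Q (hd p)))"
  shows "left_act E p g xs \<in> path_tuples E p"
proof (cases p)
  case Nil
  then show ?thesis using assms(1) nontrivial_paths_not_Nil by blast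
next
  case (Cons a q)
  then show ?thesis
    using assms(2,3) biset_laws nontrivial_paths_ends[OF assms(1)]
    by (auto elim!: path_tuples_ConsE simp: left_act_def)
qed

lemma right_act_closed:
  assumes "p \<in> nontrivial_paths Q" "xs \<in> path_tuples E p" "h \<in> carrier (grp E (tail Q (last p)))"
  shows "right_act E p xs h \<in> path_tuples E p"
proof (cases p rule: rev_cases)
  case Nil
  then show ?thesis using assms(1) nontrivial_paths_not_Nil by blast
next
  case (snoc q a)
  then show ?thesis
    using assms(2,3) biset_laws nontrivial_paths_ends[OF assms(1)]
    by (auto elim!: path_tuples_snocE simp: right_act_def intro!: path_tuples_append)
qed

text \<open>If the move touches the first entry, the two actions meet in one biset and commute
  there; otherwise they concern different entries.\<close>

lemma path_step_left_act:
  assumes p: "p \<in> nontrivial_paths Q" and step: "path_step E p us vs"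
    and h: "h \<in> carrier (grp E (head Q (hd p)))"
  shows "path_step E p (left_act E p h us) (left_act E p h vs)"
proof -
  from step obtain q a b r xs y z ys g where *: "p = q @ a # b # r"
    "us = xs @ ract (bis E a) y g # z # ys" "vs = xs @ y # lact (bis E b) g z # ys"
    "xs \<in> path_tuples E q" "y \<in> pts (bis E a)" "z \<in> pts (bis E b)" "ys \<in> path_tuples E r"
    "g \<in> carrier (grp E (tail (quiver E) a))"
    unfolding path_step_iff by blast
  show ?thesis
  proof (cases q)
    case Nil
    then have "xs = []" "a \<in> arcs Q" using * p nontrivial_paths_arcs[OF p] by auto
    show ?thesis
      by (rule path_stepI[where q = "[]" and a = a and b = b and r = r and xs = "[]" and y = "lact (bis E a) h y" and z = z and ys = ys and g = g])
        (use * Nil \<open>xs = []\<close> \<open>a \<in> arcs Q\<close> biset_laws h in \<open>auto simp: left_act_def\<close>)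
  next
    case (Cons c q')
    then have c: "c \<in> arcs Q" using * nontrivial_paths_arcs[OF p] by auto
    obtain x xs' where xs: "xs = x # xs'" "x \<in> pts (bis E c)" "xs' \<in> path_tuples E q'"
      using * Cons by (auto elim: path_tuples_ConsE)
    show ?thesis
      by (rule path_stepI[where q = q and a = a and b = b and r = r and xs = "lact (bis E c) h x # xs'" and y = y and z = z and ys = ys and g = g])
        (use * Cons xs c biset_laws h in \<open>auto simp: left_act_def\<close>)
  qed
qed

lemma path_step_right_act:
  assumes p: "p \<in> nontrivial_paths Q" and step: "path_step E p us vs"
    and h: "h \<in> carrier (grp E (tail Q (last p)))"
  shows "path_step E p (right_act E p us h) (right_act E p vs h)"
proof -
  from step obtain q a b r xs y z ys g where *: "p = q @ a # b # r"
    "us = xs @ ract (bis E a) y g # z # ys" "vs = xs @ y # lact (bis E b) g z # ys"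
    "xs \<in> path_tuples E q" "y \<in> pts (bis E a)" "z \<in> pts (bis E b)" "ys \<in> path_tuples E r"
    "g \<in> carrier (grp E (tail (quiver E) a))"
    unfolding path_step_iff by blast
  show ?thesis
  proof (cases r rule: rev_cases)
    case Nil
    then have "ys = []" using * by auto
    have b: "b \<in> arcs Q" using * nontrivial_paths_arcs[OF p] by auto
    \<comment> \<open>The left action of g from the move and the right action of h meet in the biset
      of the last arrow b; that g belongs to the group acting there follows from
      composability.\<close>
    have "tail Q a = head Q b"
      using p nontrivial_paths_append[of "q @ [a]" "b # r"] *(1) by simp
    with b have comm: "lact (bis E b) g (ract (bis E b) z h) = ract (bis E b) (lact (bis E b) g z) h"
      using biset_laws(7)[OF b *(6), of g h] h * Nil by simp
    show ?thesis
      by (rule path_stepI[where q = q and a = a and b = b and r = r and xs = xs and y = y and z = "ract (bis E b) z h" and ys = ys and g = g])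
        (use * Nil \<open>ys = []\<close> b comm biset_laws h in \<open>auto simp: right_act_def butlast_append\<close>)
  next
    case (snoc r' c)
    then have c: "c \<in> arcs Q" using * nontrivial_paths_arcs[OF p] by auto
    obtain x ys' where ys: "ys = ys' @ [x]" "x \<in> pts (bis E c)" "ys' \<in> path_tuples E r'"
      using * snoc by (auto elim: path_tuples_snocE)
    show ?thesis
      by (rule path_stepI[where q = q and a = a and b = b and r = r and xs = xs and y = y and z = z and ys = "ys' @ [ract (bis E c) x h]" and g = g])
        (use * snoc ys c biset_laws h in \<open>auto simp: right_act_def butlast_append intro!: path_tuples_append\<close>)
  qed
qed

lemma path_class_eqI: "(xs, ys) \<in> path_rel E p \<Longrightarrow> path_class E p xs = path_class E p ys"
  unfolding path_class_def path_rel_eq by (rule equiv_class_eq[OF equiv_generated_equiv])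

lemma path_class_map:
  assumes f: "\<And>us vs. path_step E p us vs \<Longrightarrow> path_step E q (f us) (f vs)"
    "\<And>us. us \<in> path_tuples E p \<Longrightarrow> f us \<in> path_tuples E q"
    and xs: "xs \<in> path_tuples E p" and ys: "ys \<in> path_class E p xs"
  shows "path_class E q (f ys) = path_class E q (f xs)"
proof -
  have xy: "(xs, ys) \<in> generated_equiv (path_tuples E p) (path_step E p)" and ys': "ys \<in> path_tuples E p"
    using path_class_memD[OF ys] unfolding path_rel_eq by blast+
  have "(f xs, f ys) \<in> generated_equiv (path_tuples E q) (path_step E q)"
  proof (rule generated_equiv_map[OF xy _ f(2)[OF xs] f(2)[OF ys']])
    fix us vs assume "path_step E p us vs"
    then show "equivclp (path_step E q) (f us) (f vs)"
      by (intro r_into_equivclp f(1))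
  qed
  then show ?thesis
    using path_class_eqI[of "f xs" "f ys" q] by (simp only: path_rel_eq)
qed

text \<open>\<open>ei_comp\<close> applies an operation to all representatives and saturates the
  result. When the operation respects single moves, all classes obtained coincide.\<close>

lemma path_class_image:
  assumes f: "\<And>us vs. path_step E p us vs \<Longrightarrow> path_step E q (f us) (f vs)"
    "\<And>us. us \<in> path_tuples E p \<Longrightarrow> f us \<in> path_tuples E q" and xs: "xs \<in> path_tuples E p"
  shows "path_rel E q `` {f us |us. us \<in> path_class E p xs} = path_class E q (f xs)"
proof -
  have "path_rel E q `` {f us |us. us \<in> path_class E p xs} = (\<Union>us\<in>path_class E p xs. path_class E q (f us))"
    unfolding path_class_def[of E q] by blast
  also have "\<dots> = path_class E q (f xs)"
    using path_class_self[OF xs] by (intro SUP_eq_const path_class_map[OF f xs]) blast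
  finally show ?thesis .
qed

lemma ei_comp_Elt_PathElt:
  assumes "p \<in> nontrivial_paths Q" "xs \<in> path_tuples E p" "g \<in> carrier (grp E (head Q (hd p)))"
  shows "ei_comp E (Elt v g) (PathElt p (path_class E p xs)) = PathElt p (path_class E p (left_act E p g xs))"
  using path_class_image[of p p "left_act E p g" xs] assms path_step_left_act left_act_closed
  by (simp add: left_act_def)

lemma ei_comp_PathElt_Elt:
  assumes "p \<in> nontrivial_paths Q" "xs \<in> path_tuples E p" "g \<in> carrier (grp E (tail Q (last p)))"
  shows "ei_comp E (PathElt p (path_class E p xs)) (Elt v g) = PathElt p (path_class E p (right_act E p xs g))"
  using path_class_image[of p p "\<lambda>xs. right_act E p xs g" xs] assms path_step_right_act right_act_closed
  by (simp add: right_act_def)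

lemma ei_comp_PathElt_PathElt:
  assumes "xs \<in> path_tuples E p" "ys \<in> path_tuples E q"
  shows "ei_comp E (PathElt p (path_class E p xs)) (PathElt q (path_class E q ys)) =
    PathElt (p @ q) (path_class E (p @ q) (xs @ ys))"
proof -
  have eq: "path_class E (p @ q) (us @ vs) = path_class E (p @ q) (xs @ ys)"
    if "us \<in> path_class E p xs" "vs \<in> path_class E q ys" for us vs
  proof -
    have vs: "vs \<in> path_tuples E q" using path_class_memD[OF that(2)] by blast
    \<comment> \<open>One factor is varied at a time: the left tuple with the right one fixed, and
      conversely.\<close>
    have 1: "path_class E (p @ q) (us @ vs) = path_class E (p @ q) (xs @ vs)"
      using vs by (intro path_class_map[OF _ _ assms(1) that(1)] path_step_append_right path_tuples_append)
    have 2: "path_class E (p @ q) (xs @ vs) = path_class E (p @ q) (xs @ ys)"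
      using assms(1) by (intro path_class_map[OF _ _ assms(2) that(2)] path_step_append_left path_tuples_append)
    show ?thesis using 1 2 by simp
  qed
  have "path_rel E (p @ q) `` {us @ vs |us vs. us \<in> path_class E p xs \<and> vs \<in> path_class E q ys} =
      (\<Union>us\<in>path_class E p xs. \<Union>vs\<in>path_class E q ys. path_class E (p @ q) (us @ vs))"
    unfolding path_class_def[of E "p @ q"] by blast
  also have "\<dots> = path_class E (p @ q) (xs @ ys)"
    using path_class_self[OF assms(1)] path_class_self[OF assms(2)] eq
    by (intro SUP_eq_const) blast+
  finally show ?thesis by simp
qed

text \<open>This is the defining move of the biset product at the junction of p and q. It makes
  composition associative when a group element stands between two paths.\<close>

lemma path_class_ract_lact:
  assumes "p \<in> nontrivial_paths Q" "q \<in> nontrivial_paths Q" "tail Q (last p) = head Q (hd q)"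
    "xs \<in> path_tuples E p" "ys \<in> path_tuples E q" "g \<in> carrier (grp E (head Q (hd q)))"
  shows "path_class E (p @ q) (right_act E p xs g @ ys) = path_class E (p @ q) (xs @ left_act E q g ys)"
proof -
  obtain p' a b q' where pq: "p = p' @ [a]" "q = b # q'"
    using assms(1,2) nontrivial_paths_not_Nil by (metis neq_Nil_conv rev_exhaust)
  obtain xs' x y ys' where xy: "xs = xs' @ [x]" "x \<in> pts (bis E a)" "xs' \<in> path_tuples E p'"
    "ys = y # ys'" "y \<in> pts (bis E b)" "ys' \<in> path_tuples E q'"
    using assms(4,5) unfolding pq by (metis path_tuples_ConsE path_tuples_snocE)
  have "path_step E (p @ q) (right_act E p xs g @ ys) (xs @ left_act E q g ys)"
    unfolding path_step_iff
    by (rule exI[of _ p'], rule exI[of _ a], rule exI[of _ b], rule exI[of _ q'],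
        rule exI[of _ xs'], rule exI[of _ x], rule exI[of _ y], rule exI[of _ ys'], rule exI[of _ g])
      (use assms pq xy in \<open>auto simp: right_act_def left_act_def\<close>)
  moreover have "right_act E p xs g @ ys \<in> path_tuples E (p @ q)" "xs @ left_act E q g ys \<in> path_tuples E (p @ q)"
    using assms by (auto intro!: path_tuples_append right_act_closed left_act_closed)
  ultimately show ?thesis
    by (intro path_class_eqI) (auto simp: path_rel_eq generated_equiv_def)
qed

section \<open>The category of an EI quiver\<close>

abbreviation "\<E> \<equiv> ei_category E"

lemma ei_category_simps:
  "Obj \<E> = verts Q" "Comp \<E> = ei_comp E" "Ident \<E> v = Elt v \<one>\<^bsub>grp E v\<^esub>"
  "Dom \<E> (Elt v g) = v" "Cod \<E> (Elt v g) = v"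
  "Dom \<E> (PathElt p \<xi>) = tail Q (last p)" "Cod \<E> (PathElt p \<xi>) = head Q (hd p)"
  by (simp_all add: ei_category_def)

lemma Mor_Elt: "Elt v g \<in> Mor \<E> \<longleftrightarrow> v \<in> verts Q \<and> g \<in> carrier (grp E v)"
  by (auto simp: ei_category_def)

lemma Mor_PathElt:
  "PathElt p \<xi> \<in> Mor \<E> \<longleftrightarrow> p \<in> nontrivial_paths Q \<and> (\<exists>xs\<in>path_tuples E p. \<xi> = path_class E p xs)"
  by (auto simp: ei_category_def path_biset_eq)

lemma Mor_cases:
  assumes "m \<in> Mor \<E>"
  obtains (Elt) v g where "m = Elt v g" "v \<in> verts Q" "g \<in> carrier (grp E v)"
  | (PathElt) p xs where "m = PathElt p (path_class E p xs)" "p \<in> nontrivial_paths Q" "xs \<in> path_tuples E p"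
  using assms by (cases m) (auto simp: Mor_Elt Mor_PathElt)

lemma left_act_append:
  "p \<noteq> [] \<Longrightarrow> xs \<in> path_tuples E p \<Longrightarrow> left_act E (p @ q) g (xs @ ys) = left_act E p g xs @ ys"
  by (cases p) (auto simp: left_act_def elim!: path_tuples_ConsE)

lemma right_act_append:
  "q \<noteq> [] \<Longrightarrow> ys \<in> path_tuples E q \<Longrightarrow> right_act E (p @ q) (xs @ ys) g = xs @ right_act E q ys g"
  by (cases q rule: rev_cases) (auto simp: right_act_def butlast_append elim!: path_tuples_snocE)

lemma left_act_mult:
  assumes "p \<in> nontrivial_paths Q" "xs \<in> path_tuples E p"
    "g \<in> carrier (grp E (head Q (hd p)))" "h \<in> carrier (grp E (head Q (hd p)))"
  shows "left_act E p (g \<otimes>\<^bsub>grp E (head Q (hd p))\<^esub> h) xs = left_act E p g (left_act E p h xs)"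
  using assms biset_laws nontrivial_paths_ends[OF assms(1)] nontrivial_paths_not_Nil[OF assms(1)]
  by (cases p) (auto simp: left_act_def elim!: path_tuples_ConsE)

lemma right_act_mult:
  assumes "p \<in> nontrivial_paths Q" "xs \<in> path_tuples E p"
    "g \<in> carrier (grp E (tail Q (last p)))" "h \<in> carrier (grp E (tail Q (last p)))"
  shows "right_act E p xs (g \<otimes>\<^bsub>grp E (tail Q (last p))\<^esub> h) = right_act E p (right_act E p xs g) h"
  using assms biset_laws nontrivial_paths_ends[OF assms(1)] nontrivial_paths_not_Nil[OF assms(1)]
  by (cases p rule: rev_cases) (auto simp: right_act_def elim!: path_tuples_snocE)

lemma left_act_one:
  assumes "p \<in> nontrivial_paths Q" "xs \<in> path_tuples E p"
  shows "left_act E p \<one>\<^bsub>grp E (head Q (hd p))\<^esub> xs = xs"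
  using assms biset_laws nontrivial_paths_ends[OF assms(1)] nontrivial_paths_not_Nil[OF assms(1)]
  by (cases p) (auto simp: left_act_def elim!: path_tuples_ConsE)

lemma right_act_one:
  assumes "p \<in> nontrivial_paths Q" "xs \<in> path_tuples E p"
  shows "right_act E p xs \<one>\<^bsub>grp E (tail Q (last p))\<^esub> = xs"
  using assms biset_laws nontrivial_paths_ends[OF assms(1)] nontrivial_paths_not_Nil[OF assms(1)]
  by (cases p rule: rev_cases) (auto simp: right_act_def elim!: path_tuples_snocE)

lemma left_right_act:
  assumes "p \<in> nontrivial_paths Q" "xs \<in> path_tuples E p"
    "g \<in> carrier (grp E (head Q (hd p)))" "h \<in> carrier (grp E (tail Q (last p)))"
  shows "left_act E p g (right_act E p xs h) = right_act E p (left_act E p g xs) h"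
proof (cases p)
  case (Cons a q)
  obtain x xs' where xs: "xs = x # xs'" "x \<in> pts (bis E a)" "xs' \<in> path_tuples E q"
    using assms(2) unfolding Cons by (rule path_tuples_ConsE)
  \<comment> \<open>For a path of length one both actions hit the same entry and the biset law is
    needed; otherwise they act on different entries.\<close>
  have "xs' = [] \<longleftrightarrow> q = []"
    using path_tuples_length[OF xs(3)] by auto
  then show ?thesis
    using assms(3,4) Cons xs biset_laws(7)[of a x g h] nontrivial_paths_ends(1)[OF assms(1)]
    by (auto simp: left_act_def right_act_def)
qed (use assms(1) nontrivial_paths_not_Nil in blast)

end

context ei_quiver_data
begin

lemma grp_monoid:
  assumes "v \<in> verts Q"
  shows "\<one>\<^bsub>grp E v\<^esub> \<in> carrier (grp E v)"
    and "g \<in> carrier (grp E v) \<Longrightarrow> h \<in> carrier (grp E v) \<Longrightarrow> g \<otimes>\<^bsub>grp E v\<^esub> h \<in> carrier (grp E v)"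
    and "g \<in> carrier (grp E v) \<Longrightarrow> h \<in> carrier (grp E v) \<Longrightarrow> k \<in> carrier (grp E v) \<Longrightarrow>
      g \<otimes>\<^bsub>grp E v\<^esub> h \<otimes>\<^bsub>grp E v\<^esub> k = g \<otimes>\<^bsub>grp E v\<^esub> (h \<otimes>\<^bsub>grp E v\<^esub> k)"
  using monoid.one_closed monoid.m_closed monoid.m_assoc group.is_monoid[OF group_grp[OF assms]] by metis+

lemma Comp_Mor:
  assumes "a \<in> Mor \<E>" "b \<in> Mor \<E>" "Dom \<E> a = Cod \<E> b"
  shows "ei_comp E a b \<in> Mor \<E> \<and> Dom \<E> (ei_comp E a b) = Dom \<E> b \<and> Cod \<E> (ei_comp E a b) = Cod \<E> a"
  using assms(1)
proof (cases a rule: Mor_cases)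
  case a: (Elt v g)
  from assms(2) show ?thesis
  proof (cases b rule: Mor_cases)
    case b: (Elt w h)
    show ?thesis using a b assms(3) by (simp add: ei_category_simps Mor_Elt grp_monoid)
  next
    case b: (PathElt q ys)
    have g: "g \<in> carrier (grp E (head Q (hd q)))" using a b assms(3) by (simp add: ei_category_simps)
    show ?thesis
      unfolding a(1) b(1) ei_comp_Elt_PathElt[OF b(2,3) g]
      using a b assms(3) left_act_closed[OF b(2,3) g] by (auto simp: ei_category_simps Mor_PathElt)
  qed
next
  case a: (PathElt p xs)
  from assms(2) show ?thesis
  proof (cases b rule: Mor_cases)
    case b: (Elt w h)
    have h: "h \<in> carrier (grp E (tail Q (last p)))" using a b assms(3) by (simp add: ei_category_simps)
    show ?thesis
      unfolding a(1) b(1) ei_comp_PathElt_Elt[OF a(2,3) h]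
      using a b assms(3) right_act_closed[OF a(2,3) h] by (auto simp: ei_category_simps Mor_PathElt)
  next
    case b: (PathElt q ys)
    have ne: "p \<noteq> []" "q \<noteq> []" using a(2) b(2) nontrivial_paths_not_Nil by blast+
    show ?thesis
      unfolding a(1) b(1) ei_comp_PathElt_PathElt[OF a(3) b(3)]
      using a b assms(3) ne path_tuples_append[OF a(3) b(3)]
      by (auto simp: ei_category_simps Mor_PathElt nontrivial_paths_append)
  qed
qed

lemma Comp_unit:
  assumes "a \<in> Mor \<E>"
  shows "ei_comp E a (Elt (Dom \<E> a) \<one>\<^bsub>grp E (Dom \<E> a)\<^esub>) = a"
    and "ei_comp E (Elt (Cod \<E> a) \<one>\<^bsub>grp E (Cod \<E> a)\<^esub>) a = a"
    and "Dom \<E> a \<in> verts Q" "Cod \<E> a \<in> verts Q"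
  using assms
proof (atomize(full), cases a rule: Mor_cases)
  case a: (Elt v g)
  interpret group "grp E v" using a(2) by (rule group_grp)
  show "ei_comp E a (Elt (Dom \<E> a) \<one>\<^bsub>grp E (Dom \<E> a)\<^esub>) = a \<and>
      ei_comp E (Elt (Cod \<E> a) \<one>\<^bsub>grp E (Cod \<E> a)\<^esub>) a = a \<and> Dom \<E> a \<in> verts Q \<and> Cod \<E> a \<in> verts Q"
    using a by (simp add: ei_category_simps)
next
  case a: (PathElt p xs)
  have one: "\<one>\<^bsub>grp E (tail Q (last p))\<^esub> \<in> carrier (grp E (tail Q (last p)))"
    "\<one>\<^bsub>grp E (head Q (hd p))\<^esub> \<in> carrier (grp E (head Q (hd p)))"
    using nontrivial_paths_ends[OF a(2)] by (simp_all add: grp_monoid)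
  show "ei_comp E a (Elt (Dom \<E> a) \<one>\<^bsub>grp E (Dom \<E> a)\<^esub>) = a \<and>
      ei_comp E (Elt (Cod \<E> a) \<one>\<^bsub>grp E (Cod \<E> a)\<^esub>) a = a \<and> Dom \<E> a \<in> verts Q \<and> Cod \<E> a \<in> verts Q"
    unfolding a(1) ei_category_simps ei_comp_Elt_PathElt[OF a(2,3) one(2)] ei_comp_PathElt_Elt[OF a(2,3) one(1)]
    using left_act_one[OF a(2,3)] right_act_one[OF a(2,3)] nontrivial_paths_ends[OF a(2)] by simp
qed

text \<open>The cases differ by which factors are group elements. A group element between two paths
  requires the move at the junction, a path between two group elements requires that left and right
  actions commute, and the remaining cases are action laws or associativity of
  concatenation.\<close>

lemma Comp_assoc:
  assumes "a \<in> Mor \<E>" "b \<in> Mor \<E>" "c \<in> Mor \<E>" "Dom \<E> a = Cod \<E> b" "Dom \<E> b = Cod \<E> c"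
  shows "ei_comp E (ei_comp E a b) c = ei_comp E a (ei_comp E b c)"
  using assms(2)
proof (cases b rule: Mor_cases)
  case b: (Elt v h)
  interpret G: group "grp E v" using b(2) by (rule group_grp)
  show ?thesis
    using assms(1)
  proof (cases a rule: Mor_cases)
    case a: (Elt u g)
    have u: "u = v" using assms(4) a b by (simp add: ei_category_simps)
    from assms(3) show ?thesis
    proof (cases c rule: Mor_cases)
      case c: (Elt w k)
      then show ?thesis using assms(5) a b by (simp add: ei_category_simps grp_monoid(3) u)
    next
      case c: (PathElt q ys)
      then have "v = head Q (hd q)" using assms(5) b by (simp add: ei_category_simps)
      then show ?thesis
        unfolding a b c u using a(3) b(3) c(2,3) u G.m_closed
        by (simp add: ei_comp_Elt_PathElt left_act_closed left_act_mult del: ei_comp.simps(2,3,4))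
    qed
  next
    case a: (PathElt p xs)
    have v: "v = tail Q (last p)" using assms(4) a b by (simp add: ei_category_simps)
    from assms(3) show ?thesis
    proof (cases c rule: Mor_cases)
      case c: (Elt w k)
      then have "w = v" using assms(5) b by (simp add: ei_category_simps)
      then show ?thesis
        unfolding a b c using a(2,3) b(3) c(3) v G.m_closed
        by (simp add: ei_comp_PathElt_Elt right_act_closed right_act_mult del: ei_comp.simps(2,3,4))
    next
      case c: (PathElt q ys)
      then have v': "v = head Q (hd q)" using assms(5) b by (simp add: ei_category_simps)
      then show ?thesis
        unfolding a b c using a(2,3) b(3) c(2,3) v path_class_ract_lact[OF a(2) c(2) _ a(3) c(3), of h]
        by (simp add: ei_comp_PathElt_Elt ei_comp_Elt_PathElt ei_comp_PathElt_PathElt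
            right_act_closed left_act_closed del: ei_comp.simps(2,3,4))
    qed
  qed
next
  case b: (PathElt p xs)
  have p: "p \<noteq> []" using b(2) nontrivial_paths_not_Nil by blast
  show ?thesis
    using assms(1)
  proof (cases a rule: Mor_cases)
    case a: (Elt u g)
    then have g: "g \<in> carrier (grp E (head Q (hd p)))" using assms(4) b by (simp add: ei_category_simps)
    from assms(3) show ?thesis
    proof (cases c rule: Mor_cases)
      case c: (Elt w k)
      then have k: "k \<in> carrier (grp E (tail Q (last p)))" using assms(5) b by (simp add: ei_category_simps)
      show ?thesis
        unfolding a b c using b(2,3) g k
        by (simp add: ei_comp_PathElt_Elt ei_comp_Elt_PathElt right_act_closed left_act_closed
            left_right_act del: ei_comp.simps(2,3,4))
    next
      case c: (PathElt q ys)
      then have "p @ q \<in> nontrivial_paths Q"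
        using assms(5) b p nontrivial_paths_not_Nil by (subst nontrivial_paths_append) (auto simp: ei_category_simps)
      then show ?thesis
        unfolding a b c using b(2,3) c(2,3) g p left_act_append[OF p b(3)]
        by (simp add: ei_comp_Elt_PathElt ei_comp_PathElt_PathElt left_act_closed path_tuples_append
            del: ei_comp.simps(2,3,4))
    qed
  next
    case a: (PathElt r zs)
    from assms(3) show ?thesis
    proof (cases c rule: Mor_cases)
      case c: (Elt w k)
      then have k: "k \<in> carrier (grp E (tail Q (last p)))" using assms(5) b by (simp add: ei_category_simps)
      have "r @ p \<in> nontrivial_paths Q"
        using assms(4) a b p nontrivial_paths_not_Nil by (subst nontrivial_paths_append) (auto simp: ei_category_simps)
      then show ?thesis
        unfolding a b c using a(2,3) b(2,3) k p right_act_append[OF p b(3)]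
        by (simp add: ei_comp_PathElt_Elt ei_comp_PathElt_PathElt right_act_closed path_tuples_append
            del: ei_comp.simps(2,3,4))
    next
      case c: (PathElt q ys)
      show ?thesis
        unfolding a b c using a(2,3) b(2,3) c(2,3)
        by (simp add: ei_comp_PathElt_PathElt path_tuples_append del: ei_comp.simps(2,3,4))
    qed
  qed
qed

lemma finite_category_ei_category: "finite_category \<E>"
  by (rule finite_category.intro; unfold ei_category_simps(1,2,3))
    (use Comp_Mor Comp_unit Comp_assoc in \<open>simp_all add: ei_category_simps Mor_Elt grp_monoid\<close>)

sublocale ei: finite_category \<E>
  by (rule finite_category_ei_category)

section \<open>Homomorphisms out of the category algebra of an EI quiver\<close>

lemma arrow_elt_eq: "x \<in> pts (bis E a) \<Longrightarrow> arrow_elt a x = PathElt [a] (path_class E [a] [x])"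
  by (simp add: arrow_elt_def path_class_single)

lemma Mor_arrow_elt: "a \<in> arcs Q \<Longrightarrow> x \<in> pts (bis E a) \<Longrightarrow> arrow_elt a x \<in> Mor \<E>"
  by (auto simp: arrow_elt_eq Mor_PathElt nontrivial_paths_single intro!: bexI[of _ "[x]"])

lemma Dom_arrow_elt [simp]: "Dom \<E> (arrow_elt a x) = tail Q a"
  and Cod_arrow_elt [simp]: "Cod \<E> (arrow_elt a x) = head Q a"
  by (simp_all add: arrow_elt_def ei_category_simps)

lemma ei_comp_Elt_arrow_elt:
  assumes "a \<in> arcs Q" "x \<in> pts (bis E a)" "g \<in> carrier (grp E (head Q a))"
  shows "ei_comp E (Elt v g) (arrow_elt a x) = arrow_elt a (lact (bis E a) g x)"
  using ei_comp_Elt_PathElt[of "[a]" "[x]" g v] assms biset_laws(3)[OF assms]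
  by (simp add: arrow_elt_eq nontrivial_paths_single left_act_def del: ei_comp.simps)

lemma ei_comp_arrow_elt_Elt:
  assumes "a \<in> arcs Q" "x \<in> pts (bis E a)" "g \<in> carrier (grp E (tail Q a))"
  shows "ei_comp E (arrow_elt a x) (Elt v g) = arrow_elt a (ract (bis E a) x g)"
  using ei_comp_PathElt_Elt[of "[a]" "[x]" g v] assms biset_laws(4)[OF assms]
  by (simp add: arrow_elt_eq nontrivial_paths_single right_act_def del: ei_comp.simps)

text \<open>The class of a tuple is the product of its entries taken as arrow elements, so group
  elements and arrow elements generate.\<close>

lemma ei_hom_eqI:
  assumes B: "unital_algebra B" and f: "f \<in> alg_hom (category_algebra \<E>) B" and g: "g \<in> alg_hom (category_algebra \<E>) B"
    and Elt: "\<And>v k. v \<in> verts Q \<Longrightarrow> k \<in> carrier (grp E v) \<Longrightarrow> f (basis (Elt v k)) = g (basis (Elt v k))"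
    and arr: "\<And>a y. a \<in> arcs Q \<Longrightarrow> y \<in> pts (bis E a) \<Longrightarrow> f (basis (arrow_elt a y)) = g (basis (arrow_elt a y))"
    and x: "x \<in> carrier (category_algebra \<E>)"
  shows "f x = g x"
proof (rule ei.alg_hom_eqI[OF B f g _ x])
  fix m assume "m \<in> Mor \<E>"
  then show "f (basis m) = g (basis m)"
  proof (cases m rule: Mor_cases)
    case (PathElt p xs)
    have "f (basis (PathElt p (path_class E p xs))) = g (basis (PathElt p (path_class E p xs)))"
      using PathElt(2,3)
    proof (induction p arbitrary: xs rule: nontrivial_paths_induct)
      case (single a)
      then show ?case using arr by (auto elim!: path_tuples_ConsE simp: arrow_elt_eq[symmetric])
    next
      case (Cons a p)
      obtain y ys where xs: "xs = y # ys" "y \<in> pts (bis E a)" "ys \<in> path_tuples E p"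
        using Cons.prems by (rule path_tuples_ConsE)
      have "ei_comp E (arrow_elt a y) (PathElt p (path_class E p ys)) = PathElt (a # p) (path_class E (a # p) xs)"
        using ei_comp_PathElt_PathElt[of "[y]" "[a]" ys p] xs by (simp add: arrow_elt_eq del: ei_comp.simps)
      then have eq: "basis (PathElt (a # p) (path_class E (a # p) xs)) =
          basis (arrow_elt a y) \<otimes>\<^bsub>category_algebra \<E>\<^esub> basis (PathElt p (path_class E p ys))"
        using Cons by (simp add: category_algebra_single ei_category_simps del: ei_comp.simps)
      have cl: "basis (arrow_elt a y) \<in> carrier (category_algebra \<E>)"
        "basis (PathElt p (path_class E p ys)) \<in> carrier (category_algebra \<E>)"
        using Cons xs by (auto intro!: ei.basis_closed Mor_arrow_elt simp: Mor_PathElt)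
      show ?case
        unfolding eq alg_homD(2)[OF f cl] alg_homD(2)[OF g cl]
        using arr[OF Cons(1) xs(2)] Cons.IH[OF xs(3)] by simp
    qed
    then show ?thesis using PathElt(1) by simp
  qed (use Elt in simp)
qed

text \<open>The data are a representation of each vertex group in the corner of its idempotent and a
  biequivariant map on each biset. Equivariance is what makes the product along a tuple depend only
  on its class.\<close>

lemma ei_category_hom:
  fixes B :: "('k::field, 'm) module"
  assumes e: "complete_idempotents B (verts Q) e"
    and h_closed: "\<And>v g. v \<in> verts Q \<Longrightarrow> g \<in> carrier (grp E v) \<Longrightarrow> h v g \<in> carrier B"
    and h_mult: "\<And>v g g'. v \<in> verts Q \<Longrightarrow> g \<in> carrier (grp E v) \<Longrightarrow> g' \<in> carrier (grp E v) \<Longrightarrow>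
      h v (g \<otimes>\<^bsub>grp E v\<^esub> g') = h v g \<otimes>\<^bsub>B\<^esub> h v g'"
    and h_one: "\<And>v. v \<in> verts Q \<Longrightarrow> h v \<one>\<^bsub>grp E v\<^esub> = e v"
    and x_closed: "\<And>a y. a \<in> arcs Q \<Longrightarrow> y \<in> pts (bis E a) \<Longrightarrow> x a y \<in> carrier B"
    and x_left: "\<And>a y g. a \<in> arcs Q \<Longrightarrow> y \<in> pts (bis E a) \<Longrightarrow> g \<in> carrier (grp E (head Q a)) \<Longrightarrow>
      x a (lact (bis E a) g y) = h (head Q a) g \<otimes>\<^bsub>B\<^esub> x a y"
    and x_right: "\<And>a y g. a \<in> arcs Q \<Longrightarrow> y \<in> pts (bis E a) \<Longrightarrow> g \<in> carrier (grp E (tail Q a)) \<Longrightarrow>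
      x a (ract (bis E a) y g) = x a y \<otimes>\<^bsub>B\<^esub> h (tail Q a) g"
  obtains f where "f \<in> alg_hom (category_algebra \<E>) B"
    "\<And>v g. v \<in> verts Q \<Longrightarrow> g \<in> carrier (grp E v) \<Longrightarrow> f (basis (Elt v g)) = h v g"
    "\<And>a y. a \<in> arcs Q \<Longrightarrow> y \<in> pts (bis E a) \<Longrightarrow> f (basis (arrow_elt a y)) = x a y"
proof -
  interpret B: complete_idempotents B "verts Q" e by (rule e)
  define V where "V p xs = list_prod B (map2 x p xs)" for p xs
  have V_set: "set (map2 x p xs) \<subseteq> carrier B" if "set p \<subseteq> arcs Q" "xs \<in> path_tuples E p" for p xs
    using that by (auto simp: path_tuples_def list_all2_conv_all_nth set_zip intro!: x_closed)
  have V_closed: "V p xs \<in> carrier B" if "set p \<subseteq> arcs Q" "xs \<in> path_tuples E p" for p xs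
    unfolding V_def using V_set[OF that] by (rule B.list_prod_closed)
  have V_append: "V (p @ q) (xs @ ys) = V p xs \<otimes>\<^bsub>B\<^esub> V q ys"
    if "set p \<subseteq> arcs Q" "set q \<subseteq> arcs Q" "xs \<in> path_tuples E p" "ys \<in> path_tuples E q" for p q xs ys
    unfolding V_def using that V_set[of p xs] V_set[of q ys]
    by (simp add: zip_append1 path_tuples_length B.list_prod_append)
  have V_Cons: "V (a # p) (y # xs) = x a y \<otimes>\<^bsub>B\<^esub> V p xs" for a p y xs
    by (simp add: V_def)
  have V_left: "V p (left_act E p g xs) = h (head Q (hd p)) g \<otimes>\<^bsub>B\<^esub> V p xs"
    if p: "p \<in> nontrivial_paths Q" and xs: "xs \<in> path_tuples E p" and g: "g \<in> carrier (grp E (head Q (hd p)))"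
    for p xs g
  proof (cases p)
    case (Cons a q)
    obtain y ys where ys: "xs = y # ys" "y \<in> pts (bis E a)" "ys \<in> path_tuples E q"
      using xs unfolding Cons by (rule path_tuples_ConsE)
    have aq: "a \<in> arcs Q" "set q \<subseteq> arcs Q" using nontrivial_paths_arcs[OF p] Cons by auto
    show ?thesis
      using ys aq g h_closed[of "head Q a" g] V_closed[OF aq(2) ys(3)] x_closed[OF aq(1) ys(2)]
      by (simp add: Cons left_act_def V_Cons x_left B.m_assoc)
  qed (use p nontrivial_paths_not_Nil in blast)
  have V_right: "V p (right_act E p xs g) = V p xs \<otimes>\<^bsub>B\<^esub> h (tail Q (last p)) g"
    if p: "p \<in> nontrivial_paths Q" and xs: "xs \<in> path_tuples E p" and g: "g \<in> carrier (grp E (tail Q (last p)))" for p xs g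
  proof (cases p rule: rev_cases)
    case (snoc q a)
    obtain y ys where ys: "xs = ys @ [y]" "y \<in> pts (bis E a)" "ys \<in> path_tuples E q"
      using xs unfolding snoc by (rule path_tuples_snocE)
    have aq: "a \<in> arcs Q" "set q \<subseteq> arcs Q" using nontrivial_paths_arcs[OF p] snoc by auto
    have V1: "V [a] [z] = x a z" if "z \<in> pts (bis E a)" for z
      using x_closed[OF aq(1) that] by (simp add: V_def)
    show ?thesis
      using ys aq g h_closed[of "tail Q a" g] V_closed[OF aq(2) ys(3)] x_closed[OF aq(1) ys(2)]
        V_append[of q "[a]" ys "[y]"] V_append[of q "[a]" ys "[ract (bis E a) y g]"]
        biset_laws(4)[OF aq(1) ys(2)]
      by (simp add: snoc right_act_def V1 x_right B.m_assoc)
  qed (use p nontrivial_paths_not_Nil in blast)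
  \<comment> \<open>A move shifts a group element across the junction of two adjacent factors; both
    tuples give the middle product x(y) h(g) x(z).\<close>
  have V_step: "V p us = V p vs" if p: "p \<in> nontrivial_paths Q" and step: "path_step E p us vs" for p us vs
  proof -
    from step obtain q a b r xs y z ys g where *: "p = q @ a # b # r"
      "us = xs @ ract (bis E a) y g # z # ys" "vs = xs @ y # lact (bis E b) g z # ys"
      "xs \<in> path_tuples E q" "y \<in> pts (bis E a)" "z \<in> pts (bis E b)" "ys \<in> path_tuples E r"
      "g \<in> carrier (grp E (tail (quiver E) a))"
      unfolding path_step_iff by blast
    have arcs: "set q \<subseteq> arcs Q" "a \<in> arcs Q" "b \<in> arcs Q" "set r \<subseteq> arcs Q"
      using nontrivial_paths_arcs[OF p] *(1) by auto
    have ab: "tail Q a = head Q b"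
      using p nontrivial_paths_append[of "q @ [a]" "b # r"] *(1) by simp
    have cl: "ract (bis E a) y g \<in> pts (bis E a)" "lact (bis E b) g z \<in> pts (bis E b)"
      using biset_laws(4)[OF arcs(2) *(5)] biset_laws(3)[OF arcs(3) *(6)] *(8) ab by auto
    have "x a y \<otimes>\<^bsub>B\<^esub> h (tail Q a) g \<otimes>\<^bsub>B\<^esub> (x b z \<otimes>\<^bsub>B\<^esub> V r ys) =
        x a y \<otimes>\<^bsub>B\<^esub> (h (head Q b) g \<otimes>\<^bsub>B\<^esub> x b z \<otimes>\<^bsub>B\<^esub> V r ys)"
      using x_closed[OF arcs(2) *(5)] x_closed[OF arcs(3) *(6)] V_closed[OF arcs(4) *(7)]
        h_closed[of "tail Q a" g] *(8) ab arcs
      by (simp add: B.m_assoc)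
    then have "V (a # b # r) (ract (bis E a) y g # z # ys) = V (a # b # r) (y # lact (bis E b) g z # ys)"
      using x_left[OF arcs(3) *(6), of g] x_right[OF arcs(2) *(5,8)] *(8) ab by (simp add: V_Cons)
    then show ?thesis
      unfolding *(1-3) using V_append[of q "a # b # r"] arcs * cl by simp
  qed
  have V_class: "V p ys = V p xs" if p: "p \<in> nontrivial_paths Q" and ys: "ys \<in> path_class E p xs" for p xs ys
    using path_class_memD[OF ys] generated_equiv_invariant[of xs ys "path_tuples E p" "path_step E p" "V p"] V_step[OF p]
    by (simp add: path_rel_eq)
  \<comment> \<open>Any representative serves here because \<open>V\<close> is constant on
    classes.\<close>
  define F where "F m = (case m of Elt v g \<Rightarrow> h v g | PathElt p \<xi> \<Rightarrow> V p (SOME xs. xs \<in> \<xi>))" for m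
  have F_Elt: "F (Elt v g) = h v g" for v g by (simp add: F_def)
  have F_path: "F (PathElt p (path_class E p xs)) = V p xs"
    if p: "p \<in> nontrivial_paths Q" and xs: "xs \<in> path_tuples E p" for p xs
    using V_class[OF p someI[of "\<lambda>ys. ys \<in> path_class E p xs", OF path_class_self[OF xs]]]
    by (simp add: F_def)
  have F_closed: "F m \<in> carrier B" if "m \<in> Mor \<E>" for m
    using that by (cases m rule: Mor_cases) (auto simp: F_Elt F_path h_closed V_closed nontrivial_paths_arcs)
  have he: "e v \<otimes>\<^bsub>B\<^esub> h v g = h v g" "h v g \<otimes>\<^bsub>B\<^esub> e v = h v g" if "v \<in> verts Q" "g \<in> carrier (grp E v)" for v g
  proof -
    interpret group "grp E v" using that(1) by (rule group_grp)
    show "e v \<otimes>\<^bsub>B\<^esub> h v g = h v g" "h v g \<otimes>\<^bsub>B\<^esub> e v = h v g"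
      using h_mult[OF that(1) one_closed that(2)] h_mult[OF that one_closed] that h_one[OF that(1)] by simp_all
  qed
  have left: "e (Cod \<E> m) \<otimes>\<^bsub>B\<^esub> F m = F m" and right: "F m \<otimes>\<^bsub>B\<^esub> e (Dom \<E> m) = F m" if "m \<in> Mor \<E>" for m
  proof (atomize(full), use that in \<open>cases m rule: Mor_cases\<close>)
    case (PathElt p xs)
    have v: "head Q (hd p) \<in> verts Q" "tail Q (last p) \<in> verts Q"
      using nontrivial_paths_ends[OF PathElt(2)] by auto
    interpret G: group "grp E (head Q (hd p))" using v(1) by (rule group_grp)
    interpret H: group "grp E (tail Q (last p))" using v(2) by (rule group_grp)
    show "e (Cod \<E> m) \<otimes>\<^bsub>B\<^esub> F m = F m \<and> F m \<otimes>\<^bsub>B\<^esub> e (Dom \<E> m) = F m"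
      using V_left[OF PathElt(2,3) G.one_closed] V_right[OF PathElt(2,3) H.one_closed]
        left_act_one[OF PathElt(2,3)] right_act_one[OF PathElt(2,3)]
      by (simp add: PathElt(1) F_path[OF PathElt(2,3)] ei_category_simps h_one[OF v(1)] h_one[OF v(2)])
  qed (simp add: F_Elt ei_category_simps he)
  have mult: "F a \<otimes>\<^bsub>B\<^esub> F b = (if Dom \<E> a = Cod \<E> b then F (Comp \<E> a b) else \<zero>\<^bsub>B\<^esub>)"
    if ab: "a \<in> Mor \<E>" "b \<in> Mor \<E>" for a b
  proof (cases "Dom \<E> a = Cod \<E> b")
    case False
    show ?thesis
      using B.mult_mismatch[OF F_closed[OF ab(1)] F_closed[OF ab(2)] Comp_unit(3)[OF ab(1)] Comp_unit(4)[OF ab(2)]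
          False right[OF ab(1)] left[OF ab(2)]] False by simp
  next
    case True
    have "F a \<otimes>\<^bsub>B\<^esub> F b = F (ei_comp E a b)"
      using ab(1)
    proof (cases a rule: Mor_cases)
      case a: (Elt v g)
      from ab(2) show ?thesis
      proof (cases b rule: Mor_cases)
        case b: (Elt w k)
        then show ?thesis using True a by (simp add: ei_category_simps F_Elt h_mult)
      next
        case b: (PathElt q ys)
        have g: "g \<in> carrier (grp E (head Q (hd q)))" "v = head Q (hd q)" using True a b by (simp_all add: ei_category_simps)
        show ?thesis
          unfolding a b ei_comp_Elt_PathElt[OF b(2,3) g(1)]
          using V_left[OF b(2,3) g(1)] left_act_closed[OF b(2,3) g(1)] b(2,3) g(2)
          by (simp add: F_Elt F_path)
      qed
    next
      case a: (PathElt p xs)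
      from ab(2) show ?thesis
      proof (cases b rule: Mor_cases)
        case b: (Elt w k)
        have k: "k \<in> carrier (grp E (tail Q (last p)))" "w = tail Q (last p)" using True a b by (simp_all add: ei_category_simps)
        show ?thesis
          unfolding a b ei_comp_PathElt_Elt[OF a(2,3) k(1)]
          using V_right[OF a(2,3) k(1)] right_act_closed[OF a(2,3) k(1)] a(2,3) k(2)
          by (simp add: F_Elt F_path)
      next
        case b: (PathElt q ys)
        have ne: "p \<noteq> []" "q \<noteq> []" using a(2) b(2) nontrivial_paths_not_Nil by blast+
        have "p @ q \<in> nontrivial_paths Q"
          using True a b ne by (simp add: nontrivial_paths_append ei_category_simps)
        then show ?thesis
          unfolding a b ei_comp_PathElt_PathElt[OF a(3) b(3)]
          using a(2,3) b(2,3)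
          by (simp add: F_path path_tuples_append V_append nontrivial_paths_arcs)
      qed
    qed
    then show ?thesis using True by (simp add: ei_category_simps)
  qed
  have "(\<Oplus>\<^bsub>B\<^esub>v\<in>Obj \<E>. F (Ident \<E> v)) = (\<Oplus>\<^bsub>B\<^esub>v\<in>verts Q. e v)"
    unfolding ei_category_simps by (intro B.finsum_cong') (auto simp: F_Elt h_one)
  then have one: "(\<Oplus>\<^bsub>B\<^esub>v\<in>Obj \<E>. F (Ident \<E> v)) = \<one>\<^bsub>B\<^esub>"
    by (simp add: B.e_sum)
  obtain f where f: "f \<in> alg_hom (category_algebra \<E>) B" "\<And>m. m \<in> Mor \<E> \<Longrightarrow> f (basis m) = F m"
    using ei.linear_extension[OF B.unital_algebra_axioms F_closed mult one] by blast
  show thesis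
  proof (rule that[OF f(1)])
    show "f (basis (Elt v g)) = h v g" if "v \<in> verts Q" "g \<in> carrier (grp E v)" for v g
      using that f(2)[of "Elt v g"] by (simp add: Mor_Elt F_Elt)
    show "f (basis (arrow_elt a y)) = x a y" if "a \<in> arcs Q" "y \<in> pts (bis E a)" for a y
      using f(2)[OF Mor_arrow_elt[OF that]] F_path[of "[a]" "[y]"] that x_closed[OF that]
      by (simp add: arrow_elt_eq nontrivial_paths_single V_def)
  qed
qed

end

section \<open>A binomial identity in characteristic p\<close>

text \<open>From k (p^m choose k) = p^m (p^m - 1 choose k - 1): if p did not divide the binomial
  coefficient, p^m would divide the smaller positive number k.\<close>

lemma prime_power_dvd_choose:
  assumes "prime p" "0 < k" "k < p ^ m"
  shows "p dvd (p ^ m choose k)"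
proof (rule ccontr)
  assume "\<not> p dvd (p ^ m choose k)"
  with assms(1) have "coprime p (p ^ m choose k)" by (rule prime_imp_coprime)
  then have "coprime (p ^ m) (p ^ m choose k)" by simp
  moreover have "p ^ m dvd k * (p ^ m choose k)"
    using times_binomial_minus1_eq[OF assms(2), of "p ^ m"] by simp
  ultimately have "p ^ m dvd k" by (simp add: coprime_dvd_mult_left_iff)
  then show False using assms(2,3) by (auto dest: dvd_imp_le)
qed

section \<open>Noncommutative binomial and Frobenius identities\<close>

context unital_algebra
begin

text \<open>This is the coefficient of t in (x + t M)^n, the derivative of the n-th power at x in
  the direction M when x and M need not commute.\<close>

definition split_sum :: "nat \<Rightarrow> 'm \<Rightarrow> 'm \<Rightarrow> 'm" where
  "split_sum n x M = (\<Oplus>a\<in>{..<n}. x [^] a \<otimes> M \<otimes> x [^] (n - 1 - a))"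

lemma split_sum_closed [simp, intro]: "x \<in> carrier A \<Longrightarrow> M \<in> carrier A \<Longrightarrow> split_sum n x M \<in> carrier A"
  unfolding split_sum_def by (intro finsum_closed) auto

lemma split_sum_0 [simp]: "split_sum 0 x M = \<zero>"
  by (simp add: split_sum_def)

text \<open>The product rule for the derivative of x^n x in the direction M.\<close>

lemma split_sum_Suc:
  assumes "x \<in> carrier A" "M \<in> carrier A"
  shows "split_sum (Suc n) x M = split_sum n x M \<otimes> x \<oplus> x [^] n \<otimes> M"
proof -
  have "split_sum (Suc n) x M = (\<Oplus>a\<in>{..<n}. x [^] a \<otimes> M \<otimes> x [^] (n - a)) \<oplus> x [^] n \<otimes> M"
    using assms unfolding split_sum_def lessThan_Suc
    by (subst finsum_insert) (auto simp: a_comm)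
  also have "(\<Oplus>a\<in>{..<n}. x [^] a \<otimes> M \<otimes> x [^] (n - a)) =
      (\<Oplus>a\<in>{..<n}. x [^] a \<otimes> M \<otimes> x [^] (n - 1 - a) \<otimes> x)"
  proof (intro finsum_cong')
    fix a assume "a \<in> {..<n}"
    then have "n - a = Suc (n - 1 - a)" by auto
    then show "x [^] a \<otimes> M \<otimes> x [^] (n - a) = x [^] a \<otimes> M \<otimes> x [^] (n - 1 - a) \<otimes> x"
      using assms by (simp add: m_assoc)
  qed (use assms in auto)
  also have "\<dots> = split_sum n x M \<otimes> x"
    unfolding split_sum_def using assms by (intro finsum_ldistr[symmetric]) auto
  finally show ?thesis .
qed

text \<open>Pascal's rule summed against an arbitrary family T, so that it drives the induction both
  for powers and for \<open>split_sum\<close>.\<close>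

lemma pascal_finsum:
  assumes T: "\<And>k. T k \<in> carrier A"
  shows "(\<Oplus>k\<in>{..Suc n}. of_nat (Suc n choose k) \<odot> T k) =
    (\<Oplus>k\<in>{..n}. of_nat (n choose k) \<odot> T k) \<oplus> (\<Oplus>k\<in>{..n}. of_nat (n choose k) \<odot> T (Suc k))"
proof -
  have "(\<Oplus>k\<in>{..Suc n}. of_nat (Suc n choose k) \<odot> T k) =
      (\<Oplus>k\<in>{..n}. of_nat (Suc n choose Suc k) \<odot> T (Suc k)) \<oplus> T 0"
    using T by (subst finsum_Suc2) auto
  also have "(\<Oplus>k\<in>{..n}. of_nat (Suc n choose Suc k) \<odot> T (Suc k)) =
      (\<Oplus>k\<in>{..n}. of_nat (n choose Suc k) \<odot> T (Suc k) \<oplus> of_nat (n choose k) \<odot> T (Suc k))"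
    using T by (intro finsum_cong') (auto simp: smult_l_distr[symmetric] add.commute)
  also have "\<dots> = (\<Oplus>k\<in>{..n}. of_nat (n choose Suc k) \<odot> T (Suc k)) \<oplus>
      (\<Oplus>k\<in>{..n}. of_nat (n choose k) \<odot> T (Suc k))"
    using T by (intro finsum_addf) auto
  also have "\<dots> \<oplus> T 0 = ((\<Oplus>k\<in>{..n}. of_nat (n choose Suc k) \<odot> T (Suc k)) \<oplus> T 0) \<oplus>
      (\<Oplus>k\<in>{..n}. of_nat (n choose k) \<odot> T (Suc k))"
    using T by (simp add: a_ac finsum_closed Pi_def)
  also have "(\<Oplus>k\<in>{..n}. of_nat (n choose Suc k) \<odot> T (Suc k)) \<oplus> T 0 =
      (\<Oplus>k\<in>{..Suc n}. of_nat (n choose k) \<odot> T k)"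
    using T by (subst finsum_Suc2) auto
  \<comment> \<open>The top coefficient n choose Suc n vanishes.\<close>
  also have "\<dots> = (\<Oplus>k\<in>{..n}. of_nat (n choose k) \<odot> T k)"
    using T by (subst finsum_Suc) (auto simp: finsum_closed Pi_def binomial_eq_0)
  finally show ?thesis .
qed

text \<open>The second identity is the derivative of the first in the direction M. Its recursion
  contains (1 + x)^n M, so the two are proved by one induction.\<close>

lemma binomial_split_sum:
  assumes x: "x \<in> carrier A" and M: "M \<in> carrier A"
  shows "(\<one> \<oplus> x) [^] n = (\<Oplus>k\<in>{..n}. of_nat (n choose k) \<odot> x [^] k)"
    and "split_sum n (\<one> \<oplus> x) M = (\<Oplus>k\<in>{..n}. of_nat (n choose k) \<odot> split_sum k x M)"
proof (induction n)
  case 0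
  {
    case 1
    then show ?case using x by (simp add: finsum_singleton)
  next
    case 2
    then show ?case using x M by simp
  }
next
  case (Suc n)
  have distr: "(\<Oplus>k\<in>{..n}. of_nat (n choose k) \<odot> T k) \<otimes> y = (\<Oplus>k\<in>{..n}. of_nat (n choose k) \<odot> (T k \<otimes> y))"
    if "\<And>k. T k \<in> carrier A" "y \<in> carrier A" for T y
    using that by (subst finsum_ldistr) (auto simp: smult_mult_left)
  {
    case 1
    have "(\<one> \<oplus> x) [^] Suc n = (\<one> \<oplus> x) [^] n \<oplus> (\<one> \<oplus> x) [^] n \<otimes> x"
      using x by (simp add: r_distr)
    then show ?case
      using x unfolding Suc(1) by (subst pascal_finsum) (simp_all add: distr)
  next
    case 2
    let ?S = "\<Oplus>k\<in>{..n}. of_nat (n choose k) \<odot> split_sum k x M"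
    have S: "?S \<in> carrier A" using x M by (intro finsum_closed) auto
    have "(\<Oplus>k\<in>{..n}. of_nat (n choose k) \<odot> split_sum (Suc k) x M) =
        (\<Oplus>k\<in>{..n}. of_nat (n choose k) \<odot> (split_sum k x M \<otimes> x) \<oplus> of_nat (n choose k) \<odot> (x [^] k \<otimes> M))"
      using x M by (simp add: split_sum_Suc smult_r_distr)
    also have "\<dots> = (\<Oplus>k\<in>{..n}. of_nat (n choose k) \<odot> (split_sum k x M \<otimes> x)) \<oplus>
        (\<Oplus>k\<in>{..n}. of_nat (n choose k) \<odot> (x [^] k \<otimes> M))"
      using x M by (intro finsum_addf) auto
    also have "\<dots> = ?S \<otimes> x \<oplus> (\<one> \<oplus> x) [^] n \<otimes> M"
      unfolding Suc(1) using x M by (simp add: distr)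
    finally have "(\<Oplus>k\<in>{..n}. of_nat (n choose k) \<odot> split_sum (Suc k) x M) =
      ?S \<otimes> x \<oplus> (\<one> \<oplus> x) [^] n \<otimes> M" .
    moreover have "split_sum (Suc n) (\<one> \<oplus> x) M = ?S \<otimes> (\<one> \<oplus> x) \<oplus> (\<one> \<oplus> x) [^] n \<otimes> M"
      using x M by (simp add: split_sum_Suc Suc(2))
    ultimately show ?case
      using x M S by (subst pascal_finsum) (simp_all add: r_distr a_assoc)
  }
qed

text \<open>The inner binomial coefficients of a power of p are divisible by p and vanish as
  scalars, so only the two end terms survive.\<close>

lemma frobenius_finsum:
  assumes "prime p" "CHAR('k) = p" "n = p ^ m" and T: "\<And>k. T k \<in> carrier A"
  shows "(\<Oplus>k\<in>{..n}. of_nat (n choose k) \<odot> T k) = T 0 \<oplus> T n"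
proof -
  have n: "n > 0" using assms(1,3) by (simp add: prime_gt_0_nat)
  have "(\<Oplus>k\<in>{..n}. of_nat (n choose k) \<odot> T k) = (\<Oplus>k\<in>{0, n}. of_nat (n choose k) \<odot> T k)"
  proof (rule add.finprod_mono_neutral_cong_right)
    fix k assume k: "k \<in> {..n} - {0, n}"
    then have "p dvd (n choose k)"
      unfolding assms(3) using prime_power_dvd_choose[OF assms(1), of k m] assms(3) by auto
    then have "(of_nat (n choose k) :: 'k) = 0"
      using assms(2) by (simp add: of_nat_eq_0_iff_char_dvd)
    then show "of_nat (n choose k) \<odot> T k = \<zero>" using T by simp
  qed (use T in auto)
  also have "\<dots> = T 0 \<oplus> T n"
    using n T by (subst finsum_insert) (auto simp: finsum_singleton)
  finally show ?thesis .
qed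

lemma frobenius_pow:
  assumes "prime p" "CHAR('k) = p" "n = p ^ m" "x \<in> carrier A"
  shows "(\<one> \<oplus> x) [^] n = \<one> \<oplus> x [^] n"
  using binomial_split_sum(1)[OF assms(4) zero_closed] frobenius_finsum[OF assms(1-3), of "\<lambda>k. x [^] k"] assms(4)
  by simp

text \<open>The derivative of (1 + x)^n = 1 + x^n in the direction M: of the two surviving terms the
  one at 0 is \<open>split_sum 0\<close>, which is zero.\<close>

lemma frobenius_split_sum:
  assumes "prime p" "CHAR('k) = p" "n = p ^ m" "x \<in> carrier A" "M \<in> carrier A"
  shows "split_sum n (\<one> \<oplus> x) M = split_sum n x M"
  using binomial_split_sum(2)[OF assms(4,5)] frobenius_finsum[OF assms(1-3), of "\<lambda>k. split_sum k x M"] assms(4,5)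
  by simp

end

section \<open>Two presentations of the preprojective relations\<close>

text \<open>
  Elements \<open>(i, j, g)\<close> of \<open>N\<close> are the arrows of \<open>Q\<^sup>\<circ>\<close>. In \<open>gp_rep\<close>, \<open>\<epsilon> i\<close>, \<open>y (i, j, g)\<close> and \<open>z (i, j, g)\<close> stand for
  the images of \<open>\<epsilon>\<^sub>i\<close>, \<open>\<alpha>\<^sub>i\<^sub>j\<close> and \<open>\<alpha>\<^sub>j\<^sub>i\<close>; in \<open>ei_rep\<close>, \<open>h i t\<close>, \<open>x (i, j, g)\<close> and \<open>x' (i, j, g)\<close> stand for the images of
  \<open>\<eta>\<^sub>i\<^sup>t\<close>, of the class of \<open>(1, 1)\<close> in \<open>X(\<alpha>\<^sub>i\<^sub>j)\<close>, and of its dual.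
\<close>

locale cartan_algebra = complete_idempotents B "UNIV :: 'n::finite set" e
  for B :: "('k::field, 'm) module" (structure) and e :: "'n::finite \<Rightarrow> 'm" +
  fixes c :: "'n::finite \<Rightarrow> nat" and N :: "('n::finite \<times> 'n \<times> nat) set" and p :: nat
  assumes finite_N: "finite N" and prime_p: "prime p" and char_p: "CHAR('k) = p"
    and c_power: "\<exists>m. c i = p ^ m"
begin

text \<open>The exponent f_ji of the Cartan triple, with its indices in the opposite order (see
  \<open>cartan_f_eq\<close>), written through the group orders alone.\<close>

definition F :: "'n \<Rightarrow> 'n \<Rightarrow> nat" where "F i j = c i div gcd (c i) (c j)"

lemma c_pos: "c i > 0"
  using c_power[of i] prime_p by (auto simp: prime_gt_0_nat)

lemma F_power: obtains m where "F i j = p ^ m"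
proof -
  obtain k where "c i = p ^ k" using c_power by blast
  moreover have "F i j dvd c i"
    unfolding F_def by (metis dvd_div_mult_self dvd_triv_left gcd_dvd1)
  ultimately show thesis using that prime_p by (auto simp: divides_primepow_nat)
qed

definition gp_rep :: "('n \<Rightarrow> 'm) \<Rightarrow> ('n \<times> 'n \<times> nat \<Rightarrow> 'm) \<Rightarrow> ('n \<times> 'n \<times> nat \<Rightarrow> 'm) \<Rightarrow> bool" where
  "gp_rep \<epsilon> y z \<longleftrightarrow>
    (\<forall>i. \<epsilon> i \<in> carrier B \<and> e i \<otimes> \<epsilon> i = \<epsilon> i \<and> \<epsilon> i \<otimes> e i = \<epsilon> i \<and> \<epsilon> i [^] c i = \<zero>) \<and>
    (\<forall>i j g. (i, j, g) \<in> N \<longrightarrow> y (i, j, g) \<in> carrier B \<and> e i \<otimes> y (i, j, g) = y (i, j, g) \<and>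
      y (i, j, g) \<otimes> e j = y (i, j, g) \<and> \<epsilon> i [^] F i j \<otimes> y (i, j, g) = y (i, j, g) \<otimes> \<epsilon> j [^] F j i) \<and>
    (\<forall>i j g. (i, j, g) \<in> N \<longrightarrow> z (i, j, g) \<in> carrier B \<and> e j \<otimes> z (i, j, g) = z (i, j, g) \<and>
      z (i, j, g) \<otimes> e i = z (i, j, g) \<and> \<epsilon> j [^] F j i \<otimes> z (i, j, g) = z (i, j, g) \<otimes> \<epsilon> i [^] F i j)"

text \<open>A mesh relation as a sum over all arrows of the oriented quiver. An arrow counts
  positively at its head and negatively at its tail, which encodes the sign sgn.\<close>

definition gp_mesh ::
    "('n \<Rightarrow> 'm) \<Rightarrow> ('n \<times> 'n \<times> nat \<Rightarrow> 'm) \<Rightarrow> ('n \<times> 'n \<times> nat \<Rightarrow> 'm) \<Rightarrow> 'n \<Rightarrow> 'm" where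
  "gp_mesh \<epsilon> y z k = (\<Oplus>a\<in>N. case a of (i, j, g) \<Rightarrow>
    (if i = k then split_sum (F i j) (\<epsilon> i) (y (i, j, g) \<otimes> z (i, j, g)) else \<zero>) \<ominus>
    (if j = k then split_sum (F j i) (\<epsilon> j) (z (i, j, g) \<otimes> y (i, j, g)) else \<zero>))"

definition ei_rep :: "('n \<Rightarrow> int \<Rightarrow> 'm) \<Rightarrow> ('n \<times> 'n \<times> nat \<Rightarrow> 'm) \<Rightarrow> ('n \<times> 'n \<times> nat \<Rightarrow> 'm) \<Rightarrow> bool" where
  "ei_rep h x x' \<longleftrightarrow>
    (\<forall>i s. h i s \<in> carrier B) \<and> (\<forall>i s t. h i (s + t) = h i s \<otimes> h i t) \<and>
    (\<forall>i. h i 0 = e i) \<and> (\<forall>i. h i (int (c i)) = e i) \<and>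
    (\<forall>i j g. (i, j, g) \<in> N \<longrightarrow> x (i, j, g) \<in> carrier B \<and> e i \<otimes> x (i, j, g) = x (i, j, g) \<and>
      x (i, j, g) \<otimes> e j = x (i, j, g) \<and> h i (int (F i j)) \<otimes> x (i, j, g) = x (i, j, g) \<otimes> h j (int (F j i))) \<and>
    (\<forall>i j g. (i, j, g) \<in> N \<longrightarrow> x' (i, j, g) \<in> carrier B \<and> e j \<otimes> x' (i, j, g) = x' (i, j, g) \<and>
      x' (i, j, g) \<otimes> e i = x' (i, j, g) \<and> h j (int (F j i)) \<otimes> x' (i, j, g) = x' (i, j, g) \<otimes> h i (int (F i j)))"

text \<open>The contribution to rho of one end of an arrow: orbit representatives become conjugates
  of M by the first n powers of the group generator.\<close>

definition conj_sum :: "nat \<Rightarrow> (int \<Rightarrow> 'm) \<Rightarrow> 'm \<Rightarrow> 'm" where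
  "conj_sum n h M = (\<Oplus>s\<in>{..<n}. h (int s) \<otimes> M \<otimes> h (- int s))"

definition ei_mesh ::
    "('n \<Rightarrow> int \<Rightarrow> 'm) \<Rightarrow> ('n \<times> 'n \<times> nat \<Rightarrow> 'm) \<Rightarrow> ('n \<times> 'n \<times> nat \<Rightarrow> 'm) \<Rightarrow> 'm" where
  "ei_mesh h x x' = (\<Oplus>a\<in>N. case a of (i, j, g) \<Rightarrow> conj_sum (F i j) (h i) (x (i, j, g) \<otimes> x' (i, j, g)) \<ominus>
    conj_sum (F j i) (h j) (x' (i, j, g) \<otimes> x (i, j, g)))"

text \<open>The unit subtracted is that of the corner at i, so the result stays in this
  corner.\<close>

definition nilp :: "('n \<Rightarrow> int \<Rightarrow> 'm) \<Rightarrow> 'n \<Rightarrow> 'm" where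
  "nilp h i = h i 1 \<ominus> e i"

text \<open>Reducing the exponent lets every integer, also a negative one, name a power of the
  generator. The factor \<open>e i\<close> cuts 1 + eps, which is 1 at the other vertices, down to
  the corner at i.\<close>

definition unip :: "('n \<Rightarrow> 'm) \<Rightarrow> 'n \<Rightarrow> int \<Rightarrow> 'm" where
  "unip \<epsilon> i s = (\<one> \<oplus> \<epsilon> i) [^] nat (s mod int (c i)) \<otimes> e i"

text \<open>The sign -1 leads from the dual generator to the image of the reversed arrow, and the
  sign 1 leads back.\<close>

definition twist ::
    "('n \<Rightarrow> int \<Rightarrow> 'm) \<Rightarrow> int \<Rightarrow> ('n \<times> 'n \<times> nat \<Rightarrow> 'm) \<Rightarrow> 'n \<times> 'n \<times> nat \<Rightarrow> 'm" where
  "twist h \<sigma> z = (\<lambda>(i, j, g). z (i, j, g) \<otimes> h i (\<sigma> * int (F i j)))"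

context
  fixes \<epsilon> and i
  assumes eps: "\<epsilon> i \<in> carrier B" "e i \<otimes> \<epsilon> i = \<epsilon> i" "\<epsilon> i \<otimes> e i = \<epsilon> i"
begin

lemma one_plus_commute: "(\<one> \<oplus> \<epsilon> i) [^] (n::nat) \<otimes> e i = e i \<otimes> (\<one> \<oplus> \<epsilon> i) [^] n"
proof (induction n)
  case (Suc n)
  have "(\<one> \<oplus> \<epsilon> i) [^] Suc n \<otimes> e i = (\<one> \<oplus> \<epsilon> i) [^] n \<otimes> (e i \<otimes> (\<one> \<oplus> \<epsilon> i))"
    using eps by (simp add: m_assoc l_distr r_distr)
  also have "\<dots> = e i \<otimes> (\<one> \<oplus> \<epsilon> i) [^] Suc n"
    using eps Suc by (simp add: m_assoc[symmetric])
  finally show ?case .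
qed (use eps in simp)

text \<open>Since \<open>c i\<close> is a power of p, (1 + eps)^(c i) = 1 + eps^(c i) = 1, so
  exponents matter only modulo \<open>c i\<close>.\<close>

lemma one_plus_period:
  assumes "\<epsilon> i [^] c i = \<zero>"
  shows "(\<one> \<oplus> \<epsilon> i) [^] (nat (s mod int (c i)) + nat (t mod int (c i))) = (\<one> \<oplus> \<epsilon> i) [^] nat ((s + t) mod int (c i))"
    and "(\<one> \<oplus> \<epsilon> i) [^] (n mod c i) = (\<one> \<oplus> \<epsilon> i) [^] n"
proof -
  obtain m where m: "c i = p ^ m" using c_power by blast
  have one: "(\<one> \<oplus> \<epsilon> i) [^] c i = \<one>"
    using frobenius_pow[OF prime_p char_p m eps(1)] assms by simp
  have mod: "(\<one> \<oplus> \<epsilon> i) [^] (n mod c i) = (\<one> \<oplus> \<epsilon> i) [^] n" for n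
  proof -
    have "(\<one> \<oplus> \<epsilon> i) [^] n = (\<one> \<oplus> \<epsilon> i) [^] (c i * (n div c i) + n mod c i)" by simp
    also have "\<dots> = (\<one> \<oplus> \<epsilon> i) [^] (c i * (n div c i)) \<otimes> (\<one> \<oplus> \<epsilon> i) [^] (n mod c i)"
      using eps by (simp only: nat_pow_mult[symmetric] a_closed one_closed)
    also have "(\<one> \<oplus> \<epsilon> i) [^] (c i * (n div c i)) = \<one>"
      using eps one by (simp add: nat_pow_pow[symmetric])
    finally show ?thesis using eps by simp
  qed
  then show "(\<one> \<oplus> \<epsilon> i) [^] (n mod c i) = (\<one> \<oplus> \<epsilon> i) [^] n" .
  have "(nat (s mod int (c i)) + nat (t mod int (c i))) mod c i = nat ((s + t) mod int (c i)) mod c i"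
  proof -
    have "int ((nat (s mod int (c i)) + nat (t mod int (c i))) mod c i) = (s + t) mod int (c i)"
      using c_pos[of i] by (simp add: zmod_int mod_add_eq)
    moreover have "int (nat ((s + t) mod int (c i)) mod c i) = (s + t) mod int (c i)"
      using c_pos[of i] by (simp add: zmod_int)
    ultimately show ?thesis by linarith
  qed
  then show "(\<one> \<oplus> \<epsilon> i) [^] (nat (s mod int (c i)) + nat (t mod int (c i))) = (\<one> \<oplus> \<epsilon> i) [^] nat ((s + t) mod int (c i))"
    using mod by metis
qed

end

text \<open>The commutation relations carry over because the F-th power of 1 + eps is 1 + eps^F, F
  being a power of p. Twisting z by a power of eta_i preserves its relation since powers of eta_i
  commute.\<close>

lemma ei_rep_unip:
  assumes gp: "gp_rep \<epsilon> y z"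
  shows "ei_rep (unip \<epsilon>) y (twist (unip \<epsilon>) 1 z)"
    and "nilp (unip \<epsilon>) i = \<epsilon> i"
    and "(i, j, g) \<in> N \<Longrightarrow> twist (unip \<epsilon>) (- 1) (twist (unip \<epsilon>) 1 z) (i, j, g) = z (i, j, g)"
proof -
  have eps: "\<epsilon> i \<in> carrier B" "e i \<otimes> \<epsilon> i = \<epsilon> i" "\<epsilon> i \<otimes> e i = \<epsilon> i" "\<epsilon> i [^] c i = \<zero>" for i
    using gp unfolding gp_rep_def by blast+
  have y: "y (i, j, g) \<in> carrier B" "e i \<otimes> y (i, j, g) = y (i, j, g)" "y (i, j, g) \<otimes> e j = y (i, j, g)"
    "\<epsilon> i [^] F i j \<otimes> y (i, j, g) = y (i, j, g) \<otimes> \<epsilon> j [^] F j i" if "(i, j, g) \<in> N" for i j g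
    using gp that unfolding gp_rep_def by blast+
  have z: "z (i, j, g) \<in> carrier B" "e j \<otimes> z (i, j, g) = z (i, j, g)" "z (i, j, g) \<otimes> e i = z (i, j, g)"
    "\<epsilon> j [^] F j i \<otimes> z (i, j, g) = z (i, j, g) \<otimes> \<epsilon> i [^] F i j" if "(i, j, g) \<in> N" for i j g
    using gp that unfolding gp_rep_def by blast+
  let ?h = "unip \<epsilon>"
  have h_closed: "?h i s \<in> carrier B" for i s using eps by (simp add: unip_def)
  have h_nat: "?h i (int n) = (\<one> \<oplus> \<epsilon> i) [^] n \<otimes> e i" for i n
    using one_plus_period(2)[of \<epsilon> i, OF eps] by (simp add: unip_def nat_mod_distrib)
  have h_mult: "?h i (s + t) = ?h i s \<otimes> ?h i t" for i s t
  proof -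
    have "?h i s \<otimes> ?h i t = (\<one> \<oplus> \<epsilon> i) [^] nat (s mod int (c i)) \<otimes> (e i \<otimes> (\<one> \<oplus> \<epsilon> i) [^] nat (t mod int (c i))) \<otimes> e i"
      using eps by (simp add: unip_def m_assoc)
    also have "\<dots> = (\<one> \<oplus> \<epsilon> i) [^] nat (s mod int (c i)) \<otimes> (\<one> \<oplus> \<epsilon> i) [^] nat (t mod int (c i)) \<otimes> e i"
      using eps by (simp add: one_plus_commute[of \<epsilon> i, OF eps(1-3), symmetric] m_assoc e_mult)
    also have "\<dots> = (\<one> \<oplus> \<epsilon> i) [^] (nat (s mod int (c i)) + nat (t mod int (c i))) \<otimes> e i"
      using eps by (simp add: nat_pow_mult)
    finally show ?thesis
      by (simp add: unip_def one_plus_period(1)[of \<epsilon> i, OF eps])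
  qed
  have h0: "?h i 0 = e i" "?h i (int (c i)) = e i" for i
    by (simp_all add: unip_def)
  have hF: "?h i (int (F i j)) = e i \<oplus> \<epsilon> i [^] F i j" for i j
  proof -
    obtain m where m: "F i j = p ^ m" using F_power by blast
    \<comment> \<open>Positivity matters: the power eps^0 is the unit of the whole algebra and is
      not absorbed by \<open>e i\<close>.\<close>
    have "F i j \<noteq> 0" using prime_gt_0_nat[OF prime_p] by (simp add: m)
    then have "\<epsilon> i [^] F i j \<otimes> e i = \<epsilon> i [^] F i j"
      using eps by (cases "F i j") (auto simp: m_assoc)
    then show ?thesis
      unfolding h_nat using eps by (simp add: frobenius_pow[OF prime_p char_p m] l_distr)
  qed
  have yF: "?h i (int (F i j)) \<otimes> y (i, j, g) = y (i, j, g) \<otimes> ?h j (int (F j i))" if "(i, j, g) \<in> N" for i j g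
    using y[OF that] eps by (simp add: hF l_distr r_distr)
  have zF: "?h j (int (F j i)) \<otimes> z (i, j, g) = z (i, j, g) \<otimes> ?h i (int (F i j))" if "(i, j, g) \<in> N" for i j g
    using z[OF that] eps by (simp add: hF l_distr r_distr)
  have tz: "twist ?h 1 z (i, j, g) = z (i, j, g) \<otimes> ?h i (int (F i j))" for i j g
    by (simp add: twist_def)
  have he: "?h i s \<otimes> e i = ?h i s" for i s
    using h_mult[of i s 0] by (simp add: h0)
  have tz_laws: "z (i, j, g) \<otimes> ?h i (int (F i j)) \<in> carrier B"
    "e j \<otimes> (z (i, j, g) \<otimes> ?h i (int (F i j))) = z (i, j, g) \<otimes> ?h i (int (F i j))"
    "z (i, j, g) \<otimes> ?h i (int (F i j)) \<otimes> e i = z (i, j, g) \<otimes> ?h i (int (F i j))"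
    "?h j (int (F j i)) \<otimes> (z (i, j, g) \<otimes> ?h i (int (F i j))) = z (i, j, g) \<otimes> ?h i (int (F i j)) \<otimes> ?h i (int (F i j))"
    if "(i, j, g) \<in> N" for i j g
  proof -
    show "z (i, j, g) \<otimes> ?h i (int (F i j)) \<otimes> e i = z (i, j, g) \<otimes> ?h i (int (F i j))"
      using z(1)[OF that] h_closed by (simp add: m_assoc he)
    show "e j \<otimes> (z (i, j, g) \<otimes> ?h i (int (F i j))) = z (i, j, g) \<otimes> ?h i (int (F i j))"
      using z(1,2)[OF that] h_closed by (simp add: m_assoc[symmetric])
    show "?h j (int (F j i)) \<otimes> (z (i, j, g) \<otimes> ?h i (int (F i j))) = z (i, j, g) \<otimes> ?h i (int (F i j)) \<otimes> ?h i (int (F i j))"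
      using z(1)[OF that] zF[OF that] h_closed by (simp add: m_assoc[symmetric])
  qed (use z(1)[OF that] h_closed in simp)
  show "ei_rep ?h y (twist ?h 1 z)"
    unfolding ei_rep_def tz
    by (intro conjI allI impI) (rule h_closed h_mult h0 y(1,2,3) yF tz_laws; assumption)+
  show "nilp ?h i = \<epsilon> i"
    using h_nat[of i 1] eps by (simp add: nilp_def l_distr minus_eq a_ac r_neg)
  show "twist ?h (- 1) (twist ?h 1 z) (i, j, g) = z (i, j, g)" if "(i, j, g) \<in> N"
    using z[OF that] h_closed h_mult[of i "int (F i j)" "- int (F i j)"]
    by (simp add: twist_def m_assoc h0)
qed

end

section \<open>From group generators to nilpotents, and from rho to the mesh relations\<close>

locale ei_representation = cartan_algebra B e c N p
  for B :: "('k::field, 'm) module" (structure) and e :: "'n::finite \<Rightarrow> 'm"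
    and c :: "'n::finite \<Rightarrow> nat" and N :: "('n::finite \<times> 'n \<times> nat) set" and p :: nat +
  fixes h x x'
  assumes ei_rep: "ei_rep h x x'"
begin

lemma h_closed [simp, intro]: "h i s \<in> carrier B"
  and h_add: "h i (s + t) = h i s \<otimes> h i t"
  and h_0: "h i 0 = e i"
  and h_c: "h i (int (c i)) = e i"
  using ei_rep unfolding ei_rep_def by blast+

lemma h_mult: "h i s \<otimes> h i t = h i (s + t)"
  by (simp add: h_add)

lemma e_h: "e i \<otimes> h i s = h i s" "h i s \<otimes> e i = h i s"
  using h_add[of i 0 s] h_add[of i s 0] by (simp_all add: h_0)

lemma x_laws:
  assumes "(i, j, g) \<in> N"
  shows "x (i, j, g) \<in> carrier B" "e i \<otimes> x (i, j, g) = x (i, j, g)" "x (i, j, g) \<otimes> e j = x (i, j, g)"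
    "h i (int (F i j)) \<otimes> x (i, j, g) = x (i, j, g) \<otimes> h j (int (F j i))"
    "x' (i, j, g) \<in> carrier B" "e j \<otimes> x' (i, j, g) = x' (i, j, g)" "x' (i, j, g) \<otimes> e i = x' (i, j, g)"
    "h j (int (F j i)) \<otimes> x' (i, j, g) = x' (i, j, g) \<otimes> h i (int (F i j))"
  using ei_rep assms unfolding ei_rep_def by blast+

lemma h_period: "h i (int (c i) * k) = e i"
proof (induction k rule: int_induct[where k = 0])
  case (step1 k)
  then show ?case by (simp add: distrib_left h_add h_c e_mult)
next
  case (step2 k)
  have "h i (int (c i) * k) = h i (int (c i) * (k - 1)) \<otimes> h i (int (c i))"
    by (simp add: h_mult algebra_simps)
  then show ?case using step2 by (simp add: h_c e_h)
qed (simp add: h_0)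

lemma h_mod: "h i (s mod int (c i)) = h i s"
proof -
  have "h i s = h i (int (c i) * (s div int (c i)) + s mod int (c i))" by simp
  also have "\<dots> = h i (s mod int (c i))" by (simp only: h_add h_period e_h)
  finally show ?thesis by simp
qed

lemma nilp_laws: "nilp h i \<in> carrier B" "e i \<otimes> nilp h i = nilp h i" "nilp h i \<otimes> e i = nilp h i"
  by (simp_all add: nilp_def minus_eq r_distr l_distr r_minus l_minus e_h e_mult)

text \<open>In the corner at i, 1 + nilp is the group generator itself, since e i (1 + nilp) = h i
  1.\<close>

lemma unipotent_pow: "(\<one> \<oplus> nilp h i) [^] n \<otimes> e i = h i (int n)"
proof (induction n)
  case (Suc n)
  have "(\<one> \<oplus> nilp h i) [^] Suc n \<otimes> e i = (\<one> \<oplus> nilp h i) [^] n \<otimes> (e i \<otimes> (\<one> \<oplus> nilp h i))"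
    using nilp_laws[of i] by (simp add: m_assoc l_distr r_distr)
  also have "\<dots> = h i (int n) \<otimes> (\<one> \<oplus> nilp h i)"
    using nilp_laws(1)[of i] by (simp add: m_assoc[symmetric] Suc)
  also have "\<dots> = h i (int n) \<oplus> (h i (int n + 1) \<ominus> h i (int n))"
    by (simp add: nilp_def minus_eq r_distr r_minus h_mult e_h)
  also have "\<dots> = h i (int (Suc n))"
    by (simp add: minus_eq a_ac r_neg2 add.commute)
  finally show ?case .
qed (simp add: h_0)

text \<open>One of the two round trips between group generator and nilpotent; the other is the
  second part of \<open>ei_rep_unip\<close>.\<close>

lemma unip_nilp: "unip (nilp h) i s = h i s"
  unfolding unip_def unipotent_pow using c_pos[of i] by (simp add: h_mod)

lemma nilp_pow:
  assumes "n = p ^ m" shows "nilp h i [^] n = h i (int n) \<ominus> e i"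
proof -
  have n: "n \<noteq> 0" using prime_gt_0_nat[OF prime_p] by (simp add: assms)
  have 1: "nilp h i [^] n \<otimes> e i = nilp h i [^] n"
    using nilp_laws[of i] n by (cases n) (auto simp: m_assoc)
  have "h i (int n) = e i \<oplus> nilp h i [^] n"
    using nilp_laws[of i] frobenius_pow[OF prime_p char_p assms nilp_laws(1)[of i]] 1
    by (simp add: unipotent_pow[symmetric] l_distr)
  then show ?thesis using nilp_laws(1)[of i] by (simp add: minus_eq a_ac r_neg2)
qed

lemma nilp_pow_F: "nilp h i [^] F i j = h i (int (F i j)) \<ominus> e i"
  using F_power[of i j] nilp_pow by metis

text \<open>The relation for inverse powers, obtained by multiplying with them on both sides. It
  moves the twisting factor from the left of x to its right.\<close>

lemma x_neg:
  assumes "(i, j, g) \<in> N"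
  shows "h i (- int (F i j)) \<otimes> x (i, j, g) = x (i, j, g) \<otimes> h j (- int (F j i))"
proof -
  note x = x_laws[OF assms]
  have "h i (- int (F i j)) \<otimes> x (i, j, g) = h i (- int (F i j)) \<otimes> x (i, j, g) \<otimes> (h j (int (F j i)) \<otimes> h j (- int (F j i)))"
    using x by (simp add: h_mult h_0 m_assoc)
  also have "\<dots> = h i (- int (F i j)) \<otimes> (x (i, j, g) \<otimes> h j (int (F j i))) \<otimes> h j (- int (F j i))"
    using x by (simp add: m_assoc)
  also have "\<dots> = (h i (- int (F i j)) \<otimes> h i (int (F i j))) \<otimes> x (i, j, g) \<otimes> h j (- int (F j i))"
    unfolding x(4)[symmetric] using x(1) by (simp add: m_assoc)
  also have "\<dots> = x (i, j, g) \<otimes> h j (- int (F j i))"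
    using x(1,2) by (simp add: h_mult h_0)
  finally show ?thesis .
qed

text \<open>The F-th power of nilp is eta^F - e, so its commutation with x is the difference of the
  relation for eta^F and of e i x = x e j.\<close>

lemma gp_rep_nilp: "gp_rep (nilp h) x (twist h (- 1) x')"
proof -
  have "nilp h i [^] c i = \<zero>" for i
    using c_power[of i] nilp_pow[of "c i" _ i] h_c[of i] by (auto simp: minus_eq r_neg)
  moreover have "nilp h i [^] F i j \<otimes> x (i, j, g) = x (i, j, g) \<otimes> nilp h j [^] F j i"
    if "(i, j, g) \<in> N" for i j g
    using x_laws[OF that] by (simp add: nilp_pow_F minus_eq l_distr r_distr l_minus r_minus)
  moreover have "nilp h j [^] F j i \<otimes> twist h (- 1) x' (i, j, g) = twist h (- 1) x' (i, j, g) \<otimes> nilp h i [^] F i j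
      \<and> twist h (- 1) x' (i, j, g) \<in> carrier B \<and> e j \<otimes> twist h (- 1) x' (i, j, g) = twist h (- 1) x' (i, j, g)
      \<and> twist h (- 1) x' (i, j, g) \<otimes> e i = twist h (- 1) x' (i, j, g)"
    if "(i, j, g) \<in> N" for i j g
  proof -
    note x = x_laws[OF that]
    \<comment> \<open>Passing the power of eta_j through x' produces the power of eta_i that cancels
      the twist.\<close>
    have "h j (int (F j i)) \<otimes> (x' (i, j, g) \<otimes> h i (- int (F i j))) = x' (i, j, g) \<otimes> (h i (int (F i j)) \<otimes> h i (- int (F i j)))"
      using x(5,8) by (simp add: m_assoc[symmetric])
    then have 1: "h j (int (F j i)) \<otimes> (x' (i, j, g) \<otimes> h i (- int (F i j))) = x' (i, j, g)"
      using x by (simp add: h_mult h_0)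
    have 2: "e j \<otimes> (x' (i, j, g) \<otimes> h i (- int (F i j))) = x' (i, j, g) \<otimes> h i (- int (F i j))"
      using x by (simp add: m_assoc[symmetric])
    show ?thesis
      using x 1 2 by (simp add: twist_def nilp_pow_F minus_eq l_distr r_distr l_minus r_minus m_assoc h_mult h_0 e_h)
  qed
  ultimately show ?thesis
    unfolding gp_rep_def using nilp_laws x_laws(1,2,3) by blast
qed

lemma twist_twist: "(i, j, g) \<in> N \<Longrightarrow> twist h 1 (twist h (- 1) x') (i, j, g) = x' (i, j, g)"
  using x_laws[of i j g] by (simp add: twist_def m_assoc h_mult h_0)

lemma conj_sum_closed: "M \<in> carrier B \<Longrightarrow> conj_sum n (h i) M \<in> carrier B"
  unfolding conj_sum_def by (intro finsum_closed) auto

text \<open>Multiplied by eta^(-1), the conjugates are the terms of \<open>split_sum\<close> at 1 +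
  nilp in the direction M eta^(-n), and \<open>frobenius_split_sum\<close> replaces 1 + nilp by
  nilp. For i different from k the idempotents annihilate the product.\<close>

lemma conj_sum_nilp:
  assumes M: "M \<in> carrier B" "e i \<otimes> M = M" and n: "n = p ^ m"
  shows "conj_sum n (h i) M \<otimes> h k (- 1) =
    (if i = k then split_sum n (nilp h i) (M \<otimes> h i (- int n)) else \<zero>)"
proof (cases "i = k")
  case True
  let ?u = "\<one> \<oplus> nilp h i"
  have u: "?u \<in> carrier B" using nilp_laws by simp
  have comm: "e i \<otimes> ?u [^] t = h i (int t)" for t :: nat
    using one_plus_commute[of "nilp h" i t] nilp_laws[of i] unipotent_pow[of i t] by simp
  have "conj_sum n (h i) M \<otimes> h k (- 1) = (\<Oplus>s\<in>{..<n}. h i (int s) \<otimes> M \<otimes> h i (- int s) \<otimes> h k (- 1))"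
    unfolding conj_sum_def using M by (intro finsum_ldistr) auto
  also have "\<dots> = split_sum n ?u (M \<otimes> h i (- int n))"
    unfolding split_sum_def
  proof (intro finsum_cong')
    fix s assume "s \<in> {..<n}"
    then have s: "int (n - 1 - s) = int n - 1 - int s" by auto
    \<comment> \<open>1 + nilp agrees with the generator only in the corner at i, so
      \<open>e i\<close> is inserted on both sides before powers of one are traded for powers of the
      other.\<close>
    have "?u [^] s \<otimes> (M \<otimes> h i (- int n)) \<otimes> ?u [^] (n - 1 - s) =
        ?u [^] s \<otimes> (e i \<otimes> M \<otimes> (h i (- int n) \<otimes> e i)) \<otimes> ?u [^] (n - 1 - s)"
      using M by (simp add: e_h)
    also have "\<dots> = (?u [^] s \<otimes> e i) \<otimes> M \<otimes> (h i (- int n) \<otimes> (e i \<otimes> ?u [^] (n - 1 - s)))"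
      using M(1) u by (simp only: m_assoc m_closed nat_pow_closed h_closed e_closed UNIV_I)
    also have "\<dots> = h i (int s) \<otimes> M \<otimes> h i (- 1 - int s)"
      unfolding unipotent_pow comm h_mult s by simp
    also have "\<dots> = h i (int s) \<otimes> M \<otimes> (h i (- int s) \<otimes> h k (- 1))"
      using True h_mult[of i "- int s" "- 1"] by (simp add: add.commute)
    finally show "h i (int s) \<otimes> M \<otimes> h i (- int s) \<otimes> h k (- 1) =
        ?u [^] s \<otimes> (M \<otimes> h i (- int n)) \<otimes> ?u [^] (n - 1 - s)"
      using M(1) by (simp add: m_assoc)
  qed (use M u in auto)
  also have "\<dots> = split_sum n (nilp h i) (M \<otimes> h i (- int n))"
    using M nilp_laws by (intro frobenius_split_sum[OF prime_p char_p n]) auto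
  finally show ?thesis using True by simp
next
  case False
  \<comment> \<open>The sum ends in \<open>e i\<close>, which is orthogonal to the idempotent
    \<open>e k\<close> at the left end of \<open>h k (- 1)\<close>.\<close>
  have "conj_sum n (h i) M \<otimes> e i = (\<Oplus>s\<in>{..<n}. h i (int s) \<otimes> M \<otimes> h i (- int s) \<otimes> e i)"
    unfolding conj_sum_def using M by (intro finsum_ldistr) auto
  also have "\<dots> = conj_sum n (h i) M"
    unfolding conj_sum_def using M by (intro finsum_cong') (auto simp: m_assoc e_h)
  finally show ?thesis
    using mult_mismatch[of "conj_sum n (h i) M" "h k (- 1)" i k] False M conj_sum_closed e_h by simp
qed

lemma gp_mesh_nilp: "gp_mesh (nilp h) x (twist h (- 1) x') k = ei_mesh h x x' \<otimes> h k (- 1)"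
proof -
  have "ei_mesh h x x' \<otimes> h k (- 1) = (\<Oplus>a\<in>N. (case a of (i, j, g) \<Rightarrow>
      conj_sum (F i j) (h i) (x (i, j, g) \<otimes> x' (i, j, g)) \<ominus>
      conj_sum (F j i) (h j) (x' (i, j, g) \<otimes> x (i, j, g))) \<otimes> h k (- 1))"
    unfolding ei_mesh_def using x_laws finite_N
    by (intro finsum_ldistr) (auto intro!: conj_sum_closed minus_closed)
  also have "\<dots> = gp_mesh (nilp h) x (twist h (- 1) x') k"
    unfolding gp_mesh_def
  proof (intro finsum_cong')
    show "(\<lambda>a. case a of (i, j, g) \<Rightarrow>
        (if i = k then split_sum (F i j) (nilp h i) (x (i, j, g) \<otimes> twist h (- 1) x' (i, j, g)) else \<zero>) \<ominus>
        (if j = k then split_sum (F j i) (nilp h j) (twist h (- 1) x' (i, j, g) \<otimes> x (i, j, g)) else \<zero>)) \<in> N \<rightarrow> carrier B"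
      using x_laws nilp_laws by (auto simp: twist_def intro!: minus_closed split_sum_closed m_closed)
    fix a assume "a \<in> N"
    then obtain i j g where a: "a = (i, j, g)" "(i, j, g) \<in> N" by (cases a) auto
    note x = x_laws[OF a(2)]
    obtain m m' where m: "F i j = p ^ m" "F j i = p ^ m'" using F_power by metis
    have 1: "x (i, j, g) \<otimes> twist h (- 1) x' (i, j, g) = x (i, j, g) \<otimes> x' (i, j, g) \<otimes> h i (- int (F i j))"
      using x by (simp add: twist_def m_assoc)
    \<comment> \<open>At the tail the twist stands between x' and x; moved through x it becomes the
      power of eta_j that \<open>conj_sum_nilp\<close> asks for at j.\<close>
    have 2: "twist h (- 1) x' (i, j, g) \<otimes> x (i, j, g) = x' (i, j, g) \<otimes> x (i, j, g) \<otimes> h j (- int (F j i))"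
      using x x_neg[OF a(2)] by (simp add: twist_def m_assoc)
    have cl: "conj_sum (F i j) (h i) (x (i, j, g) \<otimes> x' (i, j, g)) \<in> carrier B"
      "conj_sum (F j i) (h j) (x' (i, j, g) \<otimes> x (i, j, g)) \<in> carrier B"
      using x by (auto intro!: conj_sum_closed)
    have 3: "conj_sum (F i j) (h i) (x (i, j, g) \<otimes> x' (i, j, g)) \<otimes> h k (- 1) =
        (if i = k then split_sum (F i j) (nilp h i) (x (i, j, g) \<otimes> twist h (- 1) x' (i, j, g)) else \<zero>)"
      unfolding 1 using x by (intro conj_sum_nilp[OF _ _ m(1)]) (auto simp: m_assoc[symmetric])
    have 4: "conj_sum (F j i) (h j) (x' (i, j, g) \<otimes> x (i, j, g)) \<otimes> h k (- 1) =
        (if j = k then split_sum (F j i) (nilp h j) (twist h (- 1) x' (i, j, g) \<otimes> x (i, j, g)) else \<zero>)"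
      unfolding 2 using x by (intro conj_sum_nilp[OF _ _ m(2)]) (auto simp: m_assoc[symmetric])
    show "(case a of (i, j, g) \<Rightarrow>
      conj_sum (F i j) (h i) (x (i, j, g) \<otimes> x' (i, j, g)) \<ominus>
      conj_sum (F j i) (h j) (x' (i, j, g) \<otimes> x (i, j, g))) \<otimes> h k (- 1) =
      (case a of (i, j, g) \<Rightarrow>
        (if i = k then split_sum (F i j) (nilp h i) (x (i, j, g) \<otimes> twist h (- 1) x' (i, j, g)) else \<zero>) \<ominus>
        (if j = k then split_sum (F j i) (nilp h j) (twist h (- 1) x' (i, j, g) \<otimes> x (i, j, g)) else \<zero>))"
      unfolding a(1) prod.case 3[symmetric] 4[symmetric]
      using cl by (simp add: minus_eq l_distr l_minus)
  qed simp
  finally show ?thesis by simp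
qed

lemma ei_mesh_closed: "ei_mesh h x x' \<in> carrier B"
  unfolding ei_mesh_def using x_laws
  by (intro finsum_closed) (auto intro!: conj_sum_closed minus_closed)

text \<open>\<open>h k (- 1)\<close> is invertible in the corner at k, so the mesh relation at k
  says that the component of rho ending in \<open>e k\<close> vanishes. These components add up to
  rho because the idempotents sum to one.\<close>

lemma ei_mesh_eq_zero_iff:
  "ei_mesh h x x' = \<zero> \<longleftrightarrow> (\<forall>k. gp_mesh (nilp h) x (twist h (- 1) x') k = \<zero>)"
proof
  assume 0: "\<forall>k. gp_mesh (nilp h) x (twist h (- 1) x') k = \<zero>"
  have "ei_mesh h x x' \<otimes> e k = \<zero>" for k
  proof -
    have "ei_mesh h x x' \<otimes> e k = ei_mesh h x x' \<otimes> h k (- 1) \<otimes> h k 1"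
      using ei_mesh_closed by (simp add: m_assoc h_mult h_0)
    then show ?thesis using 0 by (simp add: gp_mesh_nilp)
  qed
  then have "ei_mesh h x x' \<otimes> (\<Oplus>k\<in>UNIV. e k) = \<zero>"
    using ei_mesh_closed by (subst finsum_rdistr) auto
  then show "ei_mesh h x x' = \<zero>"
    using ei_mesh_closed by (simp add: e_sum)
qed (simp add: gp_mesh_nilp)

end

section \<open>The bisets of a Cartan triple\<close>

lemma is_biset_dual:
  assumes G: "group G" and H: "group H" and Y: "is_biset G H Y"
  shows "is_biset H G (dual_biset G H Y)"
proof -
  interpret G: group G by (rule G)
  interpret H: group H by (rule H)
  show ?thesis
    using Y by (simp add: is_biset_def dual_biset_def G.inv_mult_group H.inv_mult_group)
qed

lemma ex1_mem_unique: "\<exists>!l. l \<in> R \<and> l \<in> S \<Longrightarrow> x \<in> R \<Longrightarrow> x \<in> S \<Longrightarrow> y \<in> R \<Longrightarrow> y \<in> S \<Longrightarrow> x = y"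
  by blast

section \<open>The biset of an arrow, described by integer exponents\<close>

definition cyc_biset :: "nat \<Rightarrow> nat \<Rightarrow> (int, int, (int \<times> int) set) biset" where
  "cyc_biset a b = biset_prod
    (restrict_right (integer_mod_group a) (cyclic_embedding (gcd a b) a))
    (integer_mod_group (gcd a b))
    (restrict_left (cyclic_embedding (gcd a b) b) (integer_mod_group b))"

definition cyc_step :: "nat \<Rightarrow> nat \<Rightarrow> int \<times> int \<Rightarrow> int \<times> int \<Rightarrow> bool" where
  "cyc_step a b u v \<longleftrightarrow> (\<exists>y\<in>{0..<int a}. \<exists>z\<in>{0..<int b}. \<exists>h\<in>{0..<int (gcd a b)}.
    u = ((y + (h * int (a div gcd a b)) mod int a) mod int a, z) \<and>
    v = (y, ((h * int (b div gcd a b)) mod int b + z) mod int b))"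

text \<open>The class of (eta^s, eta^t) for arbitrary integers s and t. The reduction inside the
  definition turns the two actions into plain additions.\<close>

definition cyc_elt :: "nat \<Rightarrow> nat \<Rightarrow> int \<Rightarrow> int \<Rightarrow> (int \<times> int) set" where
  "cyc_elt a b s t =
    generated_equiv ({0..<int a} \<times> {0..<int b}) (cyc_step a b) `` {(s mod int a, t mod int b)}"

context
  fixes a b :: nat
  assumes pos: "a > 0" "b > 0"
begin

lemma biset_prod_rel_cyc:
  "biset_prod_rel (restrict_right (integer_mod_group a) (cyclic_embedding (gcd a b) a))
    (integer_mod_group (gcd a b)) (restrict_left (cyclic_embedding (gcd a b) b) (integer_mod_group b)) =
    generated_equiv ({0..<int a} \<times> {0..<int b}) (cyc_step a b)"
  using pos
  by (simp add: biset_prod_rel_def restrict_right_def restrict_left_def carrier_integer_mod_group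
      cyclic_embedding_def cyc_step_def[abs_def])

lemma cyc_elt_mod: "cyc_elt a b (s mod int a) t = cyc_elt a b s t" "cyc_elt a b s (t mod int b) = cyc_elt a b s t"
  by (simp_all add: cyc_elt_def)

lemma cyc_elt_self: "(s mod int a, t mod int b) \<in> cyc_elt a b s t"
  unfolding cyc_elt_def using pos by (intro equiv_class_self[OF equiv_generated_equiv]) auto

lemma cyc_elt_eqI:
  "((s mod int a, t mod int b), (s' mod int a, t' mod int b)) \<in>
    generated_equiv ({0..<int a} \<times> {0..<int b}) (cyc_step a b) \<Longrightarrow> cyc_elt a b s t = cyc_elt a b s' t'"
  unfolding cyc_elt_def by (rule equiv_class_eq[OF equiv_generated_equiv])

text \<open>The generator of the common subgroup has exponent a div gcd in the left group and b div
  gcd in the right group, and it may cross the product.\<close>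

lemma cyc_elt_shift:
  "cyc_elt a b (s + n * int (a div gcd a b)) t = cyc_elt a b s (t + n * int (b div gcd a b))"
proof (rule cyc_elt_eqI)
  let ?k = "int (gcd a b)"
  \<comment> \<open>\<open>cyc_step\<close> allows only exponents below the order of the subgroup.
    Reducing n changes the two shifts by multiples of a and of b.\<close>
  let ?h = "n mod ?k"
  have k: "?k > 0" using pos by simp
  have a: "int a = ?k * int (a div gcd a b)" and b: "int b = ?k * int (b div gcd a b)"
    by (simp_all flip: of_nat_mult)
  have ha: "(?h * int (a div gcd a b)) mod int a = (n * int (a div gcd a b)) mod int a"
    by (subst (1 2) a) (simp only: mod_mult_mult2 mod_mod_trivial)
  have hb: "(?h * int (b div gcd a b)) mod int b = (n * int (b div gcd a b)) mod int b"
    by (subst (1 2) b) (simp only: mod_mult_mult2 mod_mod_trivial)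
  have "cyc_step a b ((s + n * int (a div gcd a b)) mod int a, t mod int b)
      (s mod int a, (t + n * int (b div gcd a b)) mod int b)"
    unfolding cyc_step_def
    by (rule bexI[of _ "s mod int a"], rule bexI[of _ "t mod int b"], rule bexI[of _ ?h])
      (use pos k in \<open>simp_all add: ha hb mod_add_eq add.commute\<close>)
  then show "(((s + n * int (a div gcd a b)) mod int a, t mod int b),
      (s mod int a, (t + n * int (b div gcd a b)) mod int b)) \<in>
      generated_equiv ({0..<int a} \<times> {0..<int b}) (cyc_step a b)"
    using pos by (auto simp: generated_equiv_def)
qed

text \<open>The criterion for maps out of the biset: a period for each group and one shift condition
  for the common subgroup. It serves both for the invariants that separate orbits and for the values
  of a homomorphism.\<close>

lemma cyc_elt_invariant:
  assumes eq: "cyc_elt a b s t = cyc_elt a b s' t'"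
    and v1: "\<And>s t. v (s mod int a) t = v s t" and v2: "\<And>s t. v s (t mod int b) = v s t"
    and shift: "\<And>s t. v (s + int (a div gcd a b)) t = v s (t + int (b div gcd a b))"
  shows "v s t = v s' t'"
proof -
  \<comment> \<open>Natural multiples cover every move, because the exponents in
    \<open>cyc_step\<close> are nonnegative residues.\<close>
  have shift': "v (s + int n * int (a div gcd a b)) t = v s (t + int n * int (b div gcd a b))" for n s t
  proof (induction n arbitrary: t)
    case (Suc n)
    have "v (s + int (Suc n) * int (a div gcd a b)) t = v (s + int n * int (a div gcd a b) + int (a div gcd a b)) t"
      by (simp add: algebra_simps)
    then show ?case unfolding shift Suc by (simp add: algebra_simps)
  qed simp
  have "((s mod int a, t mod int b), (s' mod int a, t' mod int b)) \<in>
      generated_equiv ({0..<int a} \<times> {0..<int b}) (cyc_step a b)"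
    using eq pos unfolding cyc_elt_def by (intro eq_equiv_class[OF _ equiv_generated_equiv]) auto
  then have "(case (s mod int a, t mod int b) of (s, t) \<Rightarrow> v s t) = (case (s' mod int a, t' mod int b) of (s, t) \<Rightarrow> v s t)"
  proof (rule generated_equiv_invariant)
    fix x y assume "cyc_step a b x y"
    then obtain y' z h where h: "h \<ge> 0" "x = ((y' + (h * int (a div gcd a b)) mod int a) mod int a, z)"
      "y = (y', ((h * int (b div gcd a b)) mod int b + z) mod int b)"
      unfolding cyc_step_def by auto
    have "v ((y' + (h * int (a div gcd a b)) mod int a) mod int a) z = v (y' + h * int (a div gcd a b)) z"
      using v1[of "y' + h * int (a div gcd a b)"] by (simp add: mod_simps)
    also have "\<dots> = v y' (z + h * int (b div gcd a b))"
      using shift'[of y' "nat h" z] h(1) by simp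
    also have "\<dots> = v y' (((h * int (b div gcd a b)) mod int b + z) mod int b)"
      using v2[of y' "z + h * int (b div gcd a b)"] by (simp add: mod_simps add.commute)
    finally show "(case x of (s, t) \<Rightarrow> v s t) = (case y of (s, t) \<Rightarrow> v s t)"
      using h by simp
  qed
  then show ?thesis by (simp add: v1 v2)
qed

text \<open>Both residues are unchanged by shifts. The first labels the right orbits and the second
  the left orbits.\<close>

lemma cyc_elt_eqD:
  assumes "cyc_elt a b s t = cyc_elt a b s' t'"
  shows "s mod int (a div gcd a b) = s' mod int (a div gcd a b)"
    and "t mod int (b div gcd a b) = t' mod int (b div gcd a b)"
proof -
  have "int (a div gcd a b) dvd int a" "int (b div gcd a b) dvd int b"
    by (metis dvd_div_mult_self dvd_triv_left gcd_dvd1 gcd_dvd2 of_nat_dvd_iff)+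
  then show "s mod int (a div gcd a b) = s' mod int (a div gcd a b)"
    "t mod int (b div gcd a b) = t' mod int (b div gcd a b)"
    using cyc_elt_invariant[OF assms, of "\<lambda>s t. s mod int (a div gcd a b)"]
      cyc_elt_invariant[OF assms, of "\<lambda>s t. t mod int (b div gcd a b)"]
    by (simp_all add: mod_mod_cancel)
qed

lemma pts_cyc_biset: "pts (cyc_biset a b) = {cyc_elt a b s t |s t. True}"
proof -
  let ?A = "{0..<int a} \<times> {0..<int b}"
  have pts: "pts (cyc_biset a b) = ?A // generated_equiv ?A (cyc_step a b)"
    using pos unfolding cyc_biset_def biset_prod_def biset_prod_rel_cyc
    by (simp add: restrict_right_def restrict_left_def carrier_integer_mod_group)
  show ?thesis
  proof (intro equalityI subsetI)
    fix \<xi> assume "\<xi> \<in> pts (cyc_biset a b)"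
    then obtain y z where "(y, z) \<in> ?A" "\<xi> = generated_equiv ?A (cyc_step a b) `` {(y, z)}"
      unfolding pts by (metis quotientE surj_pair)
    then have "\<xi> = cyc_elt a b y z" by (simp add: cyc_elt_def)
    then show "\<xi> \<in> {cyc_elt a b s t |s t. True}" by blast
  next
    fix \<xi> assume "\<xi> \<in> {cyc_elt a b s t |s t. True}"
    then obtain s t where "\<xi> = cyc_elt a b s t" by blast
    then show "\<xi> \<in> pts (cyc_biset a b)"
      unfolding pts cyc_elt_def using pos by (simp only:, intro quotientI) auto
  qed
qed

text \<open>The action on the product is a union over representatives; adding g to the left exponent
  respects \<open>cyc_step\<close>, so the union collapses to one class.\<close>

lemma lact_cyc_biset: "lact (cyc_biset a b) g (cyc_elt a b s t) = cyc_elt a b (g + s) t"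
proof -
  let ?R = "generated_equiv ({0..<int a} \<times> {0..<int b}) (cyc_step a b)"
  let ?f = "\<lambda>(y, z). ((g + y) mod int a, z)"
  have step: "cyc_step a b (?f u) (?f v)" if "cyc_step a b u v" for u v
  proof -
    from that obtain y z h where h: "y \<in> {0..<int a}" "z \<in> {0..<int b}" "h \<in> {0..<int (gcd a b)}"
      "u = ((y + (h * int (a div gcd a b)) mod int a) mod int a, z)"
      "v = (y, ((h * int (b div gcd a b)) mod int b + z) mod int b)"
      unfolding cyc_step_def by auto
    show ?thesis unfolding cyc_step_def
      by (rule bexI[of _ "(g + y) mod int a"], rule bexI[of _ z], rule bexI[of _ h])
        (use h pos in \<open>simp_all add: mod_simps add.assoc\<close>)
  qed
  have eq: "?R `` {?f u} = cyc_elt a b (g + s) t" if "u \<in> cyc_elt a b s t" for u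
  proof -
    have u: "((s mod int a, t mod int b), u) \<in> ?R" using that by (simp add: cyc_elt_def)
    then have "u \<in> {0..<int a} \<times> {0..<int b}" by (simp add: generated_equiv_def)
    then have "(?f (s mod int a, t mod int b), ?f u) \<in> ?R"
    proof (intro generated_equiv_map[OF u, where f = ?f])
      fix x y assume "cyc_step a b x y"
      then show "equivclp (cyc_step a b) (?f x) (?f y)" by (intro r_into_equivclp step)
    qed (use pos in auto)
    then have "?R `` {?f (s mod int a, t mod int b)} = ?R `` {?f u}"
      by (rule equiv_class_eq[OF equiv_generated_equiv])
    then show ?thesis by (simp add: cyc_elt_def mod_simps)
  qed
  have "lact (cyc_biset a b) g (cyc_elt a b s t) = (\<Union>u\<in>cyc_elt a b s t. ?R `` {?f u})"
    unfolding cyc_biset_def biset_prod_def biset_prod_rel_cyc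
    by (auto simp: restrict_right_def case_prod_unfold)
  also have "\<dots> = cyc_elt a b (g + s) t"
  proof (rule SUP_eq_const)
    show "cyc_elt a b s t \<noteq> {}"
      using cyc_elt_self by blast
  qed (rule eq)
  finally show ?thesis .
qed

lemma ract_cyc_biset: "ract (cyc_biset a b) (cyc_elt a b s t) g = cyc_elt a b s (t + g)"
proof -
  let ?R = "generated_equiv ({0..<int a} \<times> {0..<int b}) (cyc_step a b)"
  let ?f = "\<lambda>(y, z). (y, (z + g) mod int b)"
  have step: "cyc_step a b (?f u) (?f v)" if "cyc_step a b u v" for u v
  proof -
    from that obtain y z h where h: "y \<in> {0..<int a}" "z \<in> {0..<int b}" "h \<in> {0..<int (gcd a b)}"
      "u = ((y + (h * int (a div gcd a b)) mod int a) mod int a, z)"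
      "v = (y, ((h * int (b div gcd a b)) mod int b + z) mod int b)"
      unfolding cyc_step_def by auto
    show ?thesis unfolding cyc_step_def
      by (rule bexI[of _ y], rule bexI[of _ "(z + g) mod int b"], rule bexI[of _ h])
        (use h pos in \<open>simp_all add: mod_simps add.assoc\<close>)
  qed
  have eq: "?R `` {?f u} = cyc_elt a b s (t + g)" if "u \<in> cyc_elt a b s t" for u
  proof -
    have u: "((s mod int a, t mod int b), u) \<in> ?R" using that by (simp add: cyc_elt_def)
    then have "u \<in> {0..<int a} \<times> {0..<int b}" by (simp add: generated_equiv_def)
    then have "(?f (s mod int a, t mod int b), ?f u) \<in> ?R"
    proof (intro generated_equiv_map[OF u, where f = ?f])
      fix x y assume "cyc_step a b x y"
      then show "equivclp (cyc_step a b) (?f x) (?f y)" by (intro r_into_equivclp step)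
    qed (use pos in auto)
    then have "?R `` {?f (s mod int a, t mod int b)} = ?R `` {?f u}"
      by (rule equiv_class_eq[OF equiv_generated_equiv])
    then show ?thesis by (simp add: cyc_elt_def mod_simps)
  qed
  have "ract (cyc_biset a b) (cyc_elt a b s t) g = (\<Union>u\<in>cyc_elt a b s t. ?R `` {?f u})"
    unfolding cyc_biset_def biset_prod_def biset_prod_rel_cyc
    by (auto simp: restrict_left_def case_prod_unfold)
  also have "\<dots> = cyc_elt a b s (t + g)"
  proof (rule SUP_eq_const)
    show "cyc_elt a b s t \<noteq> {}"
      using cyc_elt_self by blast
  qed (rule eq)
  finally show ?thesis .
qed

lemma is_biset_cyc_biset: "is_biset (integer_mod_group a) (integer_mod_group b) (cyc_biset a b)"
proof -
  have 1: "cyc_elt a b ((g + g') mod int a + s) t = cyc_elt a b (g + (g' + s)) t" for g g' s t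
    using cyc_elt_mod(1)[of "(g + g') mod int a + s"] cyc_elt_mod(1)[of "g + (g' + s)"]
    by (simp add: mod_simps add.assoc)
  have 2: "cyc_elt a b s (t + (g + g') mod int b) = cyc_elt a b s (t + g + g')" for g g' s t
    using cyc_elt_mod(2)[of s "t + (g + g') mod int b"] cyc_elt_mod(2)[of s "t + g + g'"]
    by (simp add: mod_simps add.assoc)
  show ?thesis
    unfolding is_biset_def pts_cyc_biset
    by (auto simp: lact_cyc_biset ract_cyc_biset 1 2) blast+
qed

lemma finite_cyc_biset: "finite (pts (cyc_biset a b))" "pts (cyc_biset a b) \<noteq> {}"
proof -
  have "pts (cyc_biset a b) \<subseteq> (\<lambda>(s, t). cyc_elt a b s t) ` ({0..<int a} \<times> {0..<int b})"
  proof
    fix \<xi> assume "\<xi> \<in> pts (cyc_biset a b)"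
    then obtain s t where "\<xi> = cyc_elt a b (s mod int a) (t mod int b)"
      by (auto simp: pts_cyc_biset cyc_elt_mod)
    then show "\<xi> \<in> (\<lambda>(s, t). cyc_elt a b s t) ` ({0..<int a} \<times> {0..<int b})"
      using pos by (intro image_eqI[of _ _ "(s mod int a, t mod int b)"]) auto
  qed
  then show "finite (pts (cyc_biset a b))" by (rule finite_subset) auto
  show "pts (cyc_biset a b) \<noteq> {}" by (auto simp: pts_cyc_biset)
qed

text \<open>The right action changes t at will, while s survives modulo a div gcd. Any system of
  representatives therefore has one element for each such residue, with t uncontrolled; this t will
  cancel in b b*.\<close>

lemma right_reps_bij:
  assumes "right_orbit_reps (integer_mod_group b) (cyc_biset a b) R"
  obtains r where "bij_betw r {..<a div gcd a b} R" "\<And>s. s < a div gcd a b \<Longrightarrow> \<exists>t. r s = cyc_elt a b (int s) t"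
proof -
  let ?F = "a div gcd a b"
  let ?orb = "\<lambda>y. {ract (cyc_biset a b) y h |h. h \<in> carrier (integer_mod_group b)}"
  have orb: "?orb (cyc_elt a b s t) = {cyc_elt a b s t' |t'. True}" for s t
  proof -
    have "cyc_elt a b s t' \<in> ?orb (cyc_elt a b s t)" for t'
    proof -
      have "cyc_elt a b s t' = cyc_elt a b s (t + (t' - t) mod int b)"
        using cyc_elt_mod(2)[of s "t + (t' - t) mod int b"] cyc_elt_mod(2)[of s t'] by (simp add: mod_simps)
      moreover have "(t' - t) mod int b \<in> carrier (integer_mod_group b)"
        using pos by (simp add: carrier_integer_mod_group)
      ultimately show ?thesis unfolding ract_cyc_biset by blast
    qed
    then show ?thesis unfolding ract_cyc_biset by blast
  qed
  have F: "?F > 0" using pos by (simp add: div_greater_zero_iff gcd_le1_nat)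
  have ex: "\<exists>!l. l \<in> R \<and> l \<in> {cyc_elt a b s t' |t'. True}" for s
  proof -
    have "cyc_elt a b s 0 \<in> pts (cyc_biset a b)" unfolding pts_cyc_biset by blast
    then have "\<exists>!l. l \<in> R \<and> l \<in> ?orb (cyc_elt a b s 0)"
      using assms unfolding right_orbit_reps_def by blast
    then show ?thesis unfolding orb .
  qed
  define r where "r s = (THE l. l \<in> R \<and> l \<in> {cyc_elt a b (int s) t' |t'. True})" for s :: nat
  have r: "r s \<in> R" "\<exists>t. r s = cyc_elt a b (int s) t" for s
  proof -
    have "r s \<in> R \<and> r s \<in> {cyc_elt a b (int s) t' |t'. True}"
      unfolding r_def by (rule theI'[OF ex])
    then show "r s \<in> R" "\<exists>t. r s = cyc_elt a b (int s) t" by blast+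
  qed
  have uniq: "r s = l" if "l \<in> R" "l = cyc_elt a b (int s) t" for s l t
  proof -
    have "l \<in> {cyc_elt a b (int s) t' |t'. True}" "r s \<in> {cyc_elt a b (int s) t' |t'. True}"
      using r(2)[of s] that(2) by blast+
    then show ?thesis using ex1_mem_unique[OF ex[of "int s"]] r(1)[of s] that(1) by blast
  qed
  have "bij_betw r {..<?F} R"
  proof (rule bij_betw_imageI)
    show "inj_on r {..<?F}"
    proof (rule inj_onI)
      fix s s' assume s: "s \<in> {..<?F}" "s' \<in> {..<?F}" "r s = r s'"
      obtain t t' where "r s = cyc_elt a b (int s) t" "r s' = cyc_elt a b (int s') t'" using r(2) by blast
      then have "int s mod int ?F = int s' mod int ?F" using cyc_elt_eqD(1)[of "int s" t "int s'" t'] s(3) by simp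
      then show "s = s'" using s(1,2) by simp
    qed
    show "r ` {..<?F} = R"
    proof (intro equalityI subsetI)
      fix l assume l: "l \<in> R"
      then have "l \<in> pts (cyc_biset a b)" using assms by (auto simp: right_orbit_reps_def)
      then obtain s t where st: "l = cyc_elt a b s t" by (auto simp: pts_cyc_biset)
      let ?s = "nat (s mod int ?F)"
      \<comment> \<open>The multiple of the index contained in s is carried over to the right
        coordinate, leaving the residue as label.\<close>
      have "cyc_elt a b (s mod int ?F + s div int ?F * int ?F) t = cyc_elt a b (s mod int ?F) (t + s div int ?F * int (b div gcd a b))"
        by (rule cyc_elt_shift)
      then have "l = cyc_elt a b (int ?s) (t + s div int ?F * int (b div gcd a b))"
        using st F by simp
      then have "r ?s = l" using uniq[OF l] by blast
      moreover have "?s < ?F" using F by (simp add: nat_less_iff)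
      ultimately show "l \<in> r ` {..<?F}" by blast
    qed (use r in blast)
  qed
  then show thesis using that r(2) by blast
qed

text \<open>The labels are -t rather than t, so that c* c becomes a conjugate by the t-th power in
  the form used by \<open>conj_sum\<close>.\<close>

lemma left_reps_bij:
  assumes "left_orbit_reps (integer_mod_group a) (cyc_biset a b) R"
  obtains r where "bij_betw r {..<b div gcd a b} R" "\<And>t. t < b div gcd a b \<Longrightarrow> \<exists>s. r t = cyc_elt a b s (- int t)"
proof -
  let ?F = "b div gcd a b"
  let ?orb = "\<lambda>y. {lact (cyc_biset a b) h y |h. h \<in> carrier (integer_mod_group a)}"
  have orb: "?orb (cyc_elt a b s t) = {cyc_elt a b s' t |s'. True}" for s t
  proof -
    have "cyc_elt a b s' t \<in> ?orb (cyc_elt a b s t)" for s'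
    proof -
      have "cyc_elt a b s' t = cyc_elt a b ((s' - s) mod int a + s) t"
        using cyc_elt_mod(1)[of "(s' - s) mod int a + s" t] cyc_elt_mod(1)[of s' t] by (simp add: mod_simps)
      moreover have "(s' - s) mod int a \<in> carrier (integer_mod_group a)"
        using pos by (simp add: carrier_integer_mod_group)
      ultimately show ?thesis unfolding lact_cyc_biset by blast
    qed
    then show ?thesis unfolding lact_cyc_biset by blast
  qed
  have F: "?F > 0" using pos by (simp add: div_greater_zero_iff gcd_le2_nat)
  have ex: "\<exists>!l. l \<in> R \<and> l \<in> {cyc_elt a b s' t |s'. True}" for t
  proof -
    have "cyc_elt a b 0 t \<in> pts (cyc_biset a b)" unfolding pts_cyc_biset by blast
    then have "\<exists>!l. l \<in> R \<and> l \<in> ?orb (cyc_elt a b 0 t)"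
      using assms unfolding left_orbit_reps_def by blast
    then show ?thesis unfolding orb .
  qed
  define r where "r t = (THE l. l \<in> R \<and> l \<in> {cyc_elt a b s' (- int t) |s'. True})" for t :: nat
  have r: "r t \<in> R" "\<exists>s. r t = cyc_elt a b s (- int t)" for t
  proof -
    have "r t \<in> R \<and> r t \<in> {cyc_elt a b s' (- int t) |s'. True}"
      unfolding r_def by (rule theI'[OF ex])
    then show "r t \<in> R" "\<exists>s. r t = cyc_elt a b s (- int t)" by blast+
  qed
  have uniq: "r t = l" if "l \<in> R" "l = cyc_elt a b s (- int t)" for s l t
  proof -
    have "l \<in> {cyc_elt a b s' (- int t) |s'. True}" "r t \<in> {cyc_elt a b s' (- int t) |s'. True}"
      using r(2)[of t] that(2) by blast+
    then show ?thesis using ex1_mem_unique[OF ex[of "- int t"]] r(1)[of t] that(1) by blast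
  qed
  have "bij_betw r {..<?F} R"
  proof (rule bij_betw_imageI)
    show "inj_on r {..<?F}"
    proof (rule inj_onI)
      fix t t' assume t: "t \<in> {..<?F}" "t' \<in> {..<?F}" "r t = r t'"
      obtain s s' where "r t = cyc_elt a b s (- int t)" "r t' = cyc_elt a b s' (- int t')" using r(2) by blast
      then have "(- int t) mod int ?F = (- int t') mod int ?F"
        using cyc_elt_eqD(2)[of s "- int t" s' "- int t'"] t(3) by simp
      then have "int t mod int ?F = int t' mod int ?F" by (metis add.inverse_inverse mod_minus_eq)
      then show "t = t'" using t(1,2) by simp
    qed
    show "r ` {..<?F} = R"
    proof (intro equalityI subsetI)
      fix l assume l: "l \<in> R"
      then have "l \<in> pts (cyc_biset a b)" using assms by (auto simp: left_orbit_reps_def)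
      then obtain s t where st: "l = cyc_elt a b s t" by (auto simp: pts_cyc_biset)
      let ?t = "nat ((- t) mod int ?F)"
      \<comment> \<open>Chosen so that t plus q times the index is the negative of the residue of
        -t.\<close>
      define q where "q = (- t) div int ?F"
      have "cyc_elt a b s t = cyc_elt a b (s - q * int (a div gcd a b)) (t + q * int ?F)"
        using cyc_elt_shift[of "s - q * int (a div gcd a b)" q t] by simp
      moreover have "t + q * int ?F = - int ?t"
      proof -
        have "int ?t = (- t) mod int ?F" using F by simp
        then show ?thesis using div_mult_mod_eq[of "- t" "int ?F"] unfolding q_def by linarith
      qed
      ultimately have "l = cyc_elt a b (s - q * int (a div gcd a b)) (- int ?t)"
        using st by simp
      then have "r ?t = l" using uniq[OF l] by blast
      moreover have "?t < ?F" using F by (simp add: nat_less_iff)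
      ultimately show "l \<in> r ` {..<?F}" by blast
    qed (use r in blast)
  qed
  then show thesis using that r(2) by blast
qed

end

section \<open>The two algebras of a Cartan triple\<close>

text \<open>Both sides are the numerator in lowest terms of the fraction a / b = v / u.\<close>

lemma coprime_cross_eq:
  fixes a b u v :: nat
  assumes "a > 0" "b > 0" "u > 0" "v > 0" and eq: "a * u = b * v"
  shows "v div gcd u v = a div gcd a b"
proof -
  obtain a' b' where ab: "a = a' * gcd a b" "b = b' * gcd a b" "coprime a' b'"
    using assms(1) gcd_coprime_exists[of a b] by auto
  obtain u' v' where uv: "u = u' * gcd u v" "v = v' * gcd u v" "coprime u' v'"
    using assms(3) gcd_coprime_exists[of u v] by auto
  have pos: "gcd a b > 0" "gcd u v > 0" using assms by auto
  have "a' * u' * (gcd a b * gcd u v) = b' * v' * (gcd a b * gcd u v)"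
    using eq ab(1,2) uv(1,2) by (metis (no_types, opaque_lifting) mult.assoc mult.commute)
  then have "a' * u' = b' * v'" using assms(1,3) by simp
  then have "a' dvd v'" "v' dvd a'"
    using ab(3) uv(3) by (metis coprime_dvd_mult_right_iff dvd_triv_left,
        metis coprime_commute coprime_dvd_mult_left_iff dvd_triv_right)
  then have "v' = a'" by (auto intro: dvd_antisym)
  moreover have "v div gcd u v = v'" "a div gcd a b = a'"
    using pos ab(1) uv(2) by (metis nonzero_mult_div_cancel_right less_numeral_extra(3))+
  ultimately show ?thesis by simp
qed

section \<open>Arithmetic of the Cartan triple\<close>

locale cartan_setup =
  fixes C D :: "int^'n^'n" and \<Omega> :: "('n \<times> 'n) set" and p :: nat
  assumes triple: "cartan_triple C D \<Omega>" and prime_p: "prime p"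
    and powers: "\<exists>m. diag_entry D i = p ^ m"
begin

definition N :: "('n \<times> 'n \<times> nat) set" where
  "N = {(i, j, g). (i, j) \<in> \<Omega> \<and> g \<in> {1..cartan_g C i j}}"

abbreviation "c \<equiv> diag_entry D"

lemma c_pos: "c i > 0"
  using powers[of i] prime_p by (auto simp: prime_gt_0_nat)

lemma Omega_neg: "(i, j) \<in> \<Omega> \<Longrightarrow> C $ i $ j < 0" "(i, j) \<in> \<Omega> \<Longrightarrow> C $ j $ i < 0"
proof -
  have "C $ i $ j < 0 \<longleftrightarrow> {(i, j), (j, i)} \<inter> \<Omega> \<noteq> {}" for i j
    using triple unfolding cartan_triple_def orientation_def by blast
  then show "(i, j) \<in> \<Omega> \<Longrightarrow> C $ i $ j < 0" "(i, j) \<in> \<Omega> \<Longrightarrow> C $ j $ i < 0" by blast+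
qed

text \<open>Two opposite arrows would form an oriented cycle. Hence every arrow of the double quiver
  has one well-determined sign.\<close>

lemma Omega_asym: assumes "(i, j) \<in> \<Omega>" shows "(j, i) \<notin> \<Omega>"
proof
  assume ji: "(j, i) \<in> \<Omega>"
  \<comment> \<open>The closed sequence i, j, i, with positions counted from 1 as in the definition
    of an orientation.\<close>
  define s where "s k = (if k = Suc 0 \<or> k = Suc (Suc (Suc 0)) then i else j)" for k :: nat
  have "\<forall>k\<in>{1..2}. (s k, s (k + 1)) \<in> \<Omega>"
  proof
    fix k :: nat assume "k \<in> {1..2}"
    then consider "k = 1" | "k = 2" by force
    then show "(s k, s (k + 1)) \<in> \<Omega>" by cases (use assms ji in \<open>simp_all add: s_def\<close>)
  qed
  moreover have "orientation C \<Omega>" using triple by (simp add: cartan_triple_def)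
  ultimately have "s 1 \<noteq> s (2 + 1)"
    unfolding orientation_def by (metis one_le_numeral)
  then show False by (simp add: s_def)
qed

lemma cartan_g_sym: "cartan_g C i j = cartan_g C j i"
  by (simp add: cartan_g_def gcd.commute)

lemma symm: "D $ i $ i * C $ i $ j = D $ j $ j * C $ j $ i"
proof -
  have sym: "symmetrizer C D" using triple by (simp add: cartan_triple_def)
  have mult: "(D ** C) $ i $ j = D $ i $ i * C $ i $ j" for i j
  proof -
    have "(D ** C) $ i $ j = (\<Sum>k\<in>UNIV. D $ i $ k * C $ k $ j)"
      by (simp add: matrix_matrix_mult_def)
    also have "\<dots> = (\<Sum>k\<in>UNIV. if k = i then D $ i $ i * C $ i $ j else 0)"
      using sym by (intro sum.cong) (auto simp: symmetrizer_def)
    finally show ?thesis by simp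
  qed
  have "transpose (D ** C) $ j $ i = (D ** C) $ j $ i"
    using sym unfolding symmetrizer_def by (elim conjE) (simp only:)
  then have "(D ** C) $ i $ j = (D ** C) $ j $ i"
    by (simp add: transpose_def)
  then show ?thesis by (simp add: mult)
qed

text \<open>Symmetry of DC reads c_i |c_ij| = c_j |c_ji|, so the fractions formed by the Cartan
  entries and by the symmetrizer agree in lowest terms. This identifies f_ji with the index of G_ij
  in X(i).\<close>

lemma cartan_f_eq:
  assumes "(i, j) \<in> double_orientation \<Omega>"
  shows "cartan_f C j i = c i div gcd (c i) (c j)"
proof -
  have neg: "C $ i $ j < 0" "C $ j $ i < 0"
    using assms Omega_neg by (auto simp: double_orientation_def)
  have D: "D $ i $ i \<ge> 1" for i
    using triple by (simp add: cartan_triple_def symmetrizer_def)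
  have "int (c i * nat \<bar>C $ i $ j\<bar>) = int (c j * nat \<bar>C $ j $ i\<bar>)"
    using symm[of i j] neg D[of i] D[of j] by (simp add: diag_entry_def)
  then have eq: "c i * nat \<bar>C $ i $ j\<bar> = c j * nat \<bar>C $ j $ i\<bar>" by (simp only: of_nat_eq_iff)
  have g: "cartan_g C j i = gcd (nat \<bar>C $ i $ j\<bar>) (nat \<bar>C $ j $ i\<bar>)"
    unfolding cartan_g_def gcd_int_def by (simp add: gcd.commute)
  show ?thesis
    unfolding cartan_f_def g
    by (rule coprime_cross_eq[OF c_pos c_pos _ _ eq]) (use neg in auto)
qed

lemma finite_N: "finite N"
proof -
  have "N \<subseteq> (\<Union>i. \<Union>j. (\<lambda>g. (i, j, g)) ` {1..cartan_g C i j})"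
    by (auto simp: N_def image_iff)
  then show ?thesis by (rule finite_subset) auto
qed

subsection \<open>The EI quiver\<close>

abbreviation "E0 \<equiv> cartan_ei_quiver C D \<Omega>"
abbreviation "ED \<equiv> double_ei E0"

definition elt :: "'n \<times> 'n \<times> nat \<Rightarrow> int \<Rightarrow> int \<Rightarrow> (int \<times> int) set" where
  "elt a s t = (case a of (i, j, g) \<Rightarrow> cyc_elt (c i) (c j) s t)"

lemma E0_simps:
  "arcs (quiver E0) = N" "verts (quiver E0) = UNIV"
  "tail (quiver E0) (i, j, g) = j" "head (quiver E0) (i, j, g) = i"
  "grp E0 i = integer_mod_group (c i)" "bis E0 (i, j, g) = cyc_biset (c i) (c j)"
  by (simp_all add: cartan_ei_quiver_def cartan_quiver_def N_def cyc_biset_def Let_def)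

lemma ED_simps:
  "arcs (quiver ED) = N <+> N" "verts (quiver ED) = UNIV"
  "tail (quiver ED) (Inl (i, j, g)) = j" "head (quiver ED) (Inl (i, j, g)) = i"
  "tail (quiver ED) (Inr (i, j, g)) = i" "head (quiver ED) (Inr (i, j, g)) = j"
  "grp ED i = integer_mod_group (c i)" "bis ED (Inl (i, j, g)) = cyc_biset (c i) (c j)"
  "bis ED (Inr (i, j, g)) =
    dual_biset (integer_mod_group (c i)) (integer_mod_group (c j)) (cyc_biset (c i) (c j))"
  by (simp_all add: double_ei_def double_quiver_def E0_simps)

lemma finite_ei_quiver_ED: "finite_ei_quiver ED"
proof -
  have "fin_digraph (quiver ED)"
    by unfold_locales (auto simp: ED_simps finite_N)
  moreover have "is_biset (grp ED (head (quiver ED) a)) (grp ED (tail (quiver ED) a)) (bis ED a)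
      \<and> finite (pts (bis ED a)) \<and> pts (bis ED a) \<noteq> {}" if "a \<in> arcs (quiver ED)" for a
  proof -
    obtain i j g where "a = Inl (i, j, g) \<or> a = Inr (i, j, g)" by (metis prod_cases3 sum.exhaust)
    moreover have "pts (dual_biset G H Y) = pts Y" for G H and Y :: "(int, int, (int \<times> int) set) biset"
      by (simp add: dual_biset_def)
    ultimately show ?thesis
      using is_biset_cyc_biset[of "c i" "c j"] finite_cyc_biset[of "c i" "c j"] c_pos
      by (auto simp: ED_simps intro!: is_biset_dual)
  qed
  ultimately show ?thesis
    using c_pos by (simp add: finite_ei_quiver_def ED_simps carrier_integer_mod_group)
qed

sublocale ED: ei_quiver_data ED
  by unfold_locales (rule finite_ei_quiver_ED)

abbreviation EI :: "('k::field, ('n, 'n \<times> 'n \<times> nat + 'n \<times> 'n \<times> nat, int, (int \<times> int) set) ei_mor \<Rightarrow>\<^sub>0 'k) module" where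
  "EI \<equiv> category_algebra (ei_category ED)"

lemma pts_ED: "pts (bis ED (Inl a)) = {elt a s t |s t. True}" "pts (bis ED (Inr a)) = {elt a s t |s t. True}"
  using c_pos by (cases a; auto simp: ED_simps elt_def pts_cyc_biset dual_biset_def)+

lemma elt_in_pts: "elt a s t \<in> pts (bis ED (Inl a))" "elt a s t \<in> pts (bis ED (Inr a))"
  by (auto simp: pts_ED)

text \<open>The dual biset acts through inverses, hence the subtractions. The carrier conditions are
  those under which inverses in \<open>integer_mod_group\<close> are evaluated.\<close>

lemma act_ED:
  "lact (bis ED (Inl (i, j, g))) k (elt (i, j, g) s t) = elt (i, j, g) (k + s) t"
  "ract (bis ED (Inl (i, j, g))) (elt (i, j, g) s t) k = elt (i, j, g) s (t + k)"
  "k \<in> carrier (grp ED j) \<Longrightarrow> lact (bis ED (Inr (i, j, g))) k (elt (i, j, g) s t) = elt (i, j, g) s (t - k)"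
  "k \<in> carrier (grp ED i) \<Longrightarrow> ract (bis ED (Inr (i, j, g))) (elt (i, j, g) s t) k = elt (i, j, g) (s - k) t"
proof -
  show "lact (bis ED (Inl (i, j, g))) k (elt (i, j, g) s t) = elt (i, j, g) (k + s) t"
    "ract (bis ED (Inl (i, j, g))) (elt (i, j, g) s t) k = elt (i, j, g) s (t + k)"
    using c_pos by (simp_all add: ED_simps elt_def lact_cyc_biset ract_cyc_biset)
  show "lact (bis ED (Inr (i, j, g))) k (elt (i, j, g) s t) = elt (i, j, g) s (t - k)" if "k \<in> carrier (grp ED j)"
  proof -
    have "cyc_elt (c i) (c j) s (t + (- k) mod int (c j)) = cyc_elt (c i) (c j) s (t - k)"
      using cyc_elt_mod(2)[OF c_pos c_pos, of i j s "t + (- k) mod int (c j)"]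
        cyc_elt_mod(2)[OF c_pos c_pos, of i j s "t - k"] by (simp add: mod_simps)
    then show ?thesis using that c_pos by (simp add: ED_simps elt_def ract_cyc_biset dual_biset_def)
  qed
  show "ract (bis ED (Inr (i, j, g))) (elt (i, j, g) s t) k = elt (i, j, g) (s - k) t" if "k \<in> carrier (grp ED i)"
  proof -
    have "cyc_elt (c i) (c j) ((- k) mod int (c i) + s) t = cyc_elt (c i) (c j) (s - k) t"
      using cyc_elt_mod(1)[OF c_pos c_pos, of i j "(- k) mod int (c i) + s" t]
        cyc_elt_mod(1)[OF c_pos c_pos, of i j "s - k" t] by (simp add: mod_simps)
    then show ?thesis using that c_pos by (simp add: ED_simps elt_def lact_cyc_biset dual_biset_def)
  qed
qed

text \<open>Together with \<open>ei_x\<close> and \<open>ei_x'\<close> this reads a homomorphism as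
  the data of \<open>ei_rep\<close>. One element per arrow is enough because the class of (1, 1)
  generates the biset under both actions.\<close>

definition ei_h :: "(_ \<Rightarrow> 'b) \<Rightarrow> 'n \<Rightarrow> int \<Rightarrow> 'b" where
  "ei_h f i s = f (basis (Elt i (s mod int (c i))))"

definition ei_x :: "(_ \<Rightarrow> 'b) \<Rightarrow> 'n \<times> 'n \<times> nat \<Rightarrow> 'b" where
  "ei_x f a = f (basis (arrow_elt (Inl a) (elt a 0 0)))"

definition ei_x' :: "(_ \<Rightarrow> 'b) \<Rightarrow> 'n \<times> 'n \<times> nat \<Rightarrow> 'b" where
  "ei_x' f a = f (basis (arrow_elt (Inr a) (elt a 0 0)))"

lemma Elt_in_carrier: "basis (Elt i (s mod int (c i))) \<in> carrier EI"
  using c_pos[of i] by (intro ED.ei.basis_closed) (simp add: ED.Mor_Elt ED_simps carrier_integer_mod_group)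

lemma mod_in_carrier: "s mod int (c i) \<in> carrier (grp ED i)"
  using c_pos[of i] by (simp add: ED_simps carrier_integer_mod_group)

lemma elt_mod: "elt (i, j, g) (s mod int (c i)) t = elt (i, j, g) s t" "elt (i, j, g) s (t mod int (c j)) = elt (i, j, g) s t"
  using c_pos by (simp_all add: elt_def cyc_elt_mod)

lemma elt_mod': "elt (i, j, g) (s mod int (c i) + r) t = elt (i, j, g) (s + r) t"
  "elt (i, j, g) (r - s mod int (c i)) t = elt (i, j, g) (r - s) t"
  "elt (i, j, g) s (r + t mod int (c j)) = elt (i, j, g) s (r + t)"
  "elt (i, j, g) s (r - t mod int (c j)) = elt (i, j, g) s (r - t)"
  by (metis elt_mod mod_add_left_eq, metis elt_mod mod_diff_right_eq, metis elt_mod mod_add_right_eq,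
      metis elt_mod mod_diff_right_eq)

context
  fixes B :: "('k::field, 'b) module" and f
  assumes B: "unital_algebra B" and f: "f \<in> alg_hom EI B" and char_p: "CHAR('k) = p"
begin

interpretation B: unital_algebra B by (rule B)

lemma arr_closed: "a \<in> N \<Longrightarrow> basis (arrow_elt (Inl a) (elt a s t)) \<in> carrier EI"
    "a \<in> N \<Longrightarrow> basis (arrow_elt (Inr a) (elt a s t)) \<in> carrier EI"
  by (intro ED.ei.basis_closed ED.Mor_arrow_elt elt_in_pts; simp add: ED_simps InlI InrI)+

lemma h_mult: "ei_h f i s \<otimes>\<^bsub>B\<^esub> ei_h f j t = (if i = j then ei_h f i (s + t) else \<zero>\<^bsub>B\<^esub>)"
proof -
  interpret f: unital_algebra_hom EI B f by unfold_locales (rule f)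
  have f0: "f 0 = \<zero>\<^bsub>B\<^esub>" using f.hom_zero by (simp add: category_algebra_simps)
  have "ei_h f i s \<otimes>\<^bsub>B\<^esub> ei_h f j t = f (basis (Elt i (s mod int (c i))) \<otimes>\<^bsub>EI\<^esub> basis (Elt j (t mod int (c j))))"
    unfolding ei_h_def by (rule f.hom_mult[symmetric]) (rule Elt_in_carrier)+
  also have "\<dots> = (if i = j then ei_h f i (s + t) else \<zero>\<^bsub>B\<^esub>)"
    by (simp add: category_algebra_single ED.ei_category_simps ED_simps f0 ei_h_def mod_simps)
  finally show ?thesis .
qed

lemma h_x: assumes "(i, j, g) \<in> N"
  shows "ei_h f k r \<otimes>\<^bsub>B\<^esub> f (basis (arrow_elt (Inl (i, j, g)) (elt (i, j, g) s t))) =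
      (if k = i then f (basis (arrow_elt (Inl (i, j, g)) (elt (i, j, g) (r + s) t))) else \<zero>\<^bsub>B\<^esub>)"
    and "f (basis (arrow_elt (Inl (i, j, g)) (elt (i, j, g) s t))) \<otimes>\<^bsub>B\<^esub> ei_h f k r =
      (if k = j then f (basis (arrow_elt (Inl (i, j, g)) (elt (i, j, g) s (t + r)))) else \<zero>\<^bsub>B\<^esub>)"
    and "ei_h f k r \<otimes>\<^bsub>B\<^esub> f (basis (arrow_elt (Inr (i, j, g)) (elt (i, j, g) s t))) =
      (if k = j then f (basis (arrow_elt (Inr (i, j, g)) (elt (i, j, g) s (t - r)))) else \<zero>\<^bsub>B\<^esub>)"
    and "f (basis (arrow_elt (Inr (i, j, g)) (elt (i, j, g) s t))) \<otimes>\<^bsub>B\<^esub> ei_h f k r =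
      (if k = i then f (basis (arrow_elt (Inr (i, j, g)) (elt (i, j, g) (s - r) t))) else \<zero>\<^bsub>B\<^esub>)"
proof -
  interpret f: unital_algebra_hom EI B f by unfold_locales (rule f)
  have f0: "f 0 = \<zero>\<^bsub>B\<^esub>" using f.hom_zero by (simp add: category_algebra_simps)
  have arcs: "Inl (i, j, g) \<in> arcs (quiver ED)" "Inr (i, j, g) \<in> arcs (quiver ED)"
    using assms by (auto simp: ED_simps)
  show "ei_h f k r \<otimes>\<^bsub>B\<^esub> f (basis (arrow_elt (Inl (i, j, g)) (elt (i, j, g) s t))) =
      (if k = i then f (basis (arrow_elt (Inl (i, j, g)) (elt (i, j, g) (r + s) t))) else \<zero>\<^bsub>B\<^esub>)"
    using f.hom_mult[OF Elt_in_carrier[of k r] arr_closed(1)[OF assms, of s t], symmetric]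
      ED.ei_comp_Elt_arrow_elt[OF arcs(1) elt_in_pts(1)[of "(i, j, g)" s t], where g = "r mod int (c i)" and v = i] mod_in_carrier[of r i]
    by (auto simp: category_algebra_single ED.ei_category_simps ED_simps(3-6) f0 ei_h_def act_ED elt_mod'
        simp del: ei_comp.simps)
  show "f (basis (arrow_elt (Inl (i, j, g)) (elt (i, j, g) s t))) \<otimes>\<^bsub>B\<^esub> ei_h f k r =
      (if k = j then f (basis (arrow_elt (Inl (i, j, g)) (elt (i, j, g) s (t + r)))) else \<zero>\<^bsub>B\<^esub>)"
    using f.hom_mult[OF arr_closed(1)[OF assms, of s t] Elt_in_carrier[of k r], symmetric]
      ED.ei_comp_arrow_elt_Elt[OF arcs(1) elt_in_pts(1)[of "(i, j, g)" s t], where g = "r mod int (c j)" and v = j] mod_in_carrier[of r j]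
    by (auto simp: category_algebra_single ED.ei_category_simps ED_simps(3-6) f0 ei_h_def act_ED elt_mod'
        simp del: ei_comp.simps)
  show "ei_h f k r \<otimes>\<^bsub>B\<^esub> f (basis (arrow_elt (Inr (i, j, g)) (elt (i, j, g) s t))) =
      (if k = j then f (basis (arrow_elt (Inr (i, j, g)) (elt (i, j, g) s (t - r)))) else \<zero>\<^bsub>B\<^esub>)"
    using f.hom_mult[OF Elt_in_carrier[of k r] arr_closed(2)[OF assms, of s t], symmetric]
      ED.ei_comp_Elt_arrow_elt[OF arcs(2) elt_in_pts(2)[of "(i, j, g)" s t], where g = "r mod int (c j)" and v = j] mod_in_carrier[of r j]
    by (auto simp: category_algebra_single ED.ei_category_simps ED_simps(3-6) f0 ei_h_def act_ED elt_mod'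
        simp del: ei_comp.simps)
  show "f (basis (arrow_elt (Inr (i, j, g)) (elt (i, j, g) s t))) \<otimes>\<^bsub>B\<^esub> ei_h f k r =
      (if k = i then f (basis (arrow_elt (Inr (i, j, g)) (elt (i, j, g) (s - r) t))) else \<zero>\<^bsub>B\<^esub>)"
    using f.hom_mult[OF arr_closed(2)[OF assms, of s t] Elt_in_carrier[of k r], symmetric]
      ED.ei_comp_arrow_elt_Elt[OF arcs(2) elt_in_pts(2)[of "(i, j, g)" s t], where g = "r mod int (c i)" and v = i] mod_in_carrier[of r i]
    by (auto simp: category_algebra_single ED.ei_category_simps ED_simps(3-6) f0 ei_h_def act_ED elt_mod'
        simp del: ei_comp.simps)
qed

lemma ei_cartan_algebra: "cartan_algebra B (\<lambda>i. ei_h f i 0) c N p"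
proof -
  interpret f: unital_algebra_hom EI B f by unfold_locales (rule f)
  have "\<one>\<^bsub>B\<^esub> = f (\<Sum>i\<in>UNIV. basis (Elt i 0))"
    using f.hom_one by (simp add: category_algebra_simps(2) ED.ei_category_simps ED_simps)
  also have "\<dots> = (\<Oplus>\<^bsub>B\<^esub>i\<in>UNIV. ei_h f i 0)"
    using Elt_in_carrier[of _ 0] by (subst ED.ei.hom_sum[OF B f]) (simp_all add: ei_h_def)
  finally have "(\<Oplus>\<^bsub>B\<^esub>i\<in>UNIV. ei_h f i 0) = \<one>\<^bsub>B\<^esub>" ..
  moreover have "ei_h f i 0 \<in> carrier B" for i
    using alg_homD(1)[OF f Elt_in_carrier[of i 0]] by (simp add: ei_h_def)
  ultimately show ?thesis
    by unfold_locales (auto simp: h_mult finite_N prime_p char_p powers)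
qed

text \<open>The relation between the group elements and x is the crossing of the generator of the
  common subgroup, \<open>cyc_elt_shift\<close> with n = 1.\<close>

lemma ei_representation_of_hom: "ei_representation B (\<lambda>i. ei_h f i 0) c N p (ei_h f) (ei_x f) (ei_x' f)"
proof -
  interpret cartan_algebra B "\<lambda>i. ei_h f i 0" c N p by (rule ei_cartan_algebra)
  have shift: "elt (i, j, g) (s + int (F i j)) t = elt (i, j, g) s (t + int (F j i))" for i j g s t
    using cyc_elt_shift[OF c_pos c_pos, of i j s 1 t] by (simp add: elt_def F_def gcd.commute)
  have "ei_rep (ei_h f) (ei_x f) (ei_x' f)"
    unfolding ei_rep_def
  proof (intro conjI allI impI)
    fix i j g assume a: "(i, j, g) \<in> N"
    show "ei_x f (i, j, g) \<in> carrier B" "ei_x' f (i, j, g) \<in> carrier B"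
      unfolding ei_x_def ei_x'_def
      using alg_homD(1)[OF f arr_closed(1)[OF a, of 0 0]] alg_homD(1)[OF f arr_closed(2)[OF a, of 0 0]] by simp_all
    show "ei_h f i 0 \<otimes>\<^bsub>B\<^esub> ei_x f (i, j, g) = ei_x f (i, j, g)"
      "ei_x f (i, j, g) \<otimes>\<^bsub>B\<^esub> ei_h f j 0 = ei_x f (i, j, g)"
      "ei_h f j 0 \<otimes>\<^bsub>B\<^esub> ei_x' f (i, j, g) = ei_x' f (i, j, g)"
      "ei_x' f (i, j, g) \<otimes>\<^bsub>B\<^esub> ei_h f i 0 = ei_x' f (i, j, g)"
      unfolding ei_x_def ei_x'_def h_x[OF a] by simp_all
    show "ei_h f i (int (F i j)) \<otimes>\<^bsub>B\<^esub> ei_x f (i, j, g) = ei_x f (i, j, g) \<otimes>\<^bsub>B\<^esub> ei_h f j (int (F j i))"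
      unfolding ei_x_def h_x[OF a] using shift[of i j g 0 0] by simp
    \<comment> \<open>On the dual the exponents are subtracted, so the shift is taken at the point
      with both exponents negated.\<close>
    show "ei_h f j (int (F j i)) \<otimes>\<^bsub>B\<^esub> ei_x' f (i, j, g) = ei_x' f (i, j, g) \<otimes>\<^bsub>B\<^esub> ei_h f i (int (F i j))"
      unfolding ei_x'_def h_x[OF a] using shift[of i j g "- int (F i j)" "- int (F j i)"] by simp
  next
    fix i s t
    show "ei_h f i s \<in> carrier B" unfolding ei_h_def by (rule alg_homD(1)[OF f Elt_in_carrier])
    show "ei_h f i (s + t) = ei_h f i s \<otimes>\<^bsub>B\<^esub> ei_h f i t" by (simp add: h_mult)
    show "ei_h f i (int (c i)) = ei_h f i 0" by (simp add: ei_h_def)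
  qed simp
  then show ?thesis by unfold_locales
qed

text \<open>Every class is a two-sided translate of the class of (1, 1); on the dual the two
  translations change sides and signs.\<close>

lemma hom_arrow_elt:
  assumes "(i, j, g) \<in> N"
  shows "f (basis (arrow_elt (Inl (i, j, g)) (elt (i, j, g) s t))) =
      ei_h f i s \<otimes>\<^bsub>B\<^esub> ei_x f (i, j, g) \<otimes>\<^bsub>B\<^esub> ei_h f j t"
    and "f (basis (arrow_elt (Inr (i, j, g)) (elt (i, j, g) s t))) =
      ei_h f j (- t) \<otimes>\<^bsub>B\<^esub> ei_x' f (i, j, g) \<otimes>\<^bsub>B\<^esub> ei_h f i (- s)"
  by (simp_all add: ei_x_def ei_x'_def h_x[OF assms])

end

end

lemma bij_finsum:
  assumes "ring B" and "bij_betw r S T" "\<And>x. x \<in> T \<Longrightarrow> \<phi> x \<in> carrier B"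
  shows "(\<Oplus>\<^bsub>B\<^esub>x\<in>T. \<phi> x) = (\<Oplus>\<^bsub>B\<^esub>s\<in>S. \<phi> (r s))"
proof -
  interpret ring B by fact
  have "r ` S = T" "inj_on r S" using assms(2) by (auto simp: bij_betw_def)
  then show ?thesis
    using assms(3) finsum_reindex[of \<phi> r S] by auto
qed

section \<open>The image of rho under a homomorphism\<close>

locale ei_hom = cartan_setup C D \<Omega> p
  for C D :: "int^'n^'n" and \<Omega> :: "('n \<times> 'n) set" and p :: nat +
  fixes B :: "('k::field, 'b) module" and f
  assumes B: "unital_algebra B" and f: "f \<in> alg_hom EI B" and char_p: "CHAR('k) = p"
begin

sublocale rep: ei_representation B "\<lambda>i. ei_h f i 0" c N p "ei_h f" "ei_x f" "ei_x' f"
  by (rule ei_representation_of_hom[OF B f char_p])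

sublocale f: unital_algebra_hom EI B f
  by unfold_locales (rule f)

abbreviation "EIk \<equiv> (EI :: ('k, ('n, 'n \<times> 'n \<times> nat + 'n \<times> 'n \<times> nat, int, (int \<times> int) set) ei_mor \<Rightarrow>\<^sub>0 'k) module)"

text \<open>In b b* the powers of eta_j cancel, and in c* c those of eta_i. The values therefore do
  not see the coordinate left open by \<open>right_reps_bij\<close> and
  \<open>left_reps_bij\<close>.\<close>

lemma hom_bb:
  assumes "(i, j, g) \<in> N"
  shows "f (basis (arrow_elt (Inl (i, j, g)) (elt (i, j, g) s t)) \<otimes>\<^bsub>EIk\<^esub>
      basis (arrow_elt (Inr (i, j, g)) (elt (i, j, g) s t))) =
    ei_h f i s \<otimes>\<^bsub>B\<^esub> (ei_x f (i, j, g) \<otimes>\<^bsub>B\<^esub> ei_x' f (i, j, g)) \<otimes>\<^bsub>B\<^esub> ei_h f i (- s)"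
    and "f (basis (arrow_elt (Inr (i, j, g)) (elt (i, j, g) s t)) \<otimes>\<^bsub>EIk\<^esub>
      basis (arrow_elt (Inl (i, j, g)) (elt (i, j, g) s t))) =
    ei_h f j (- t) \<otimes>\<^bsub>B\<^esub> (ei_x' f (i, j, g) \<otimes>\<^bsub>B\<^esub> ei_x f (i, j, g)) \<otimes>\<^bsub>B\<^esub> ei_h f j t"
proof -
  note x = rep.x_laws[OF assms]
  note ha = hom_arrow_elt[OF B f char_p assms]
  have 1: "ei_x f (i, j, g) \<otimes>\<^bsub>B\<^esub> ei_h f j t \<otimes>\<^bsub>B\<^esub> (ei_h f j (- t) \<otimes>\<^bsub>B\<^esub> ei_x' f (i, j, g)) = ei_x f (i, j, g) \<otimes>\<^bsub>B\<^esub> ei_x' f (i, j, g)"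
  proof -
    have "ei_x f (i, j, g) \<otimes>\<^bsub>B\<^esub> ei_h f j t \<otimes>\<^bsub>B\<^esub> (ei_h f j (- t) \<otimes>\<^bsub>B\<^esub> ei_x' f (i, j, g)) =
        ei_x f (i, j, g) \<otimes>\<^bsub>B\<^esub> (ei_h f j t \<otimes>\<^bsub>B\<^esub> ei_h f j (- t)) \<otimes>\<^bsub>B\<^esub> ei_x' f (i, j, g)"
      using x by (simp only: rep.m_assoc rep.m_closed rep.h_closed)
    then show ?thesis using x by (simp only: rep.h_mult) simp
  qed
  have 2: "ei_x' f (i, j, g) \<otimes>\<^bsub>B\<^esub> ei_h f i (- s) \<otimes>\<^bsub>B\<^esub> (ei_h f i s \<otimes>\<^bsub>B\<^esub> ei_x f (i, j, g)) = ei_x' f (i, j, g) \<otimes>\<^bsub>B\<^esub> ei_x f (i, j, g)"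
  proof -
    have "ei_x' f (i, j, g) \<otimes>\<^bsub>B\<^esub> ei_h f i (- s) \<otimes>\<^bsub>B\<^esub> (ei_h f i s \<otimes>\<^bsub>B\<^esub> ei_x f (i, j, g)) =
        ei_x' f (i, j, g) \<otimes>\<^bsub>B\<^esub> (ei_h f i (- s) \<otimes>\<^bsub>B\<^esub> ei_h f i s) \<otimes>\<^bsub>B\<^esub> ei_x f (i, j, g)"
      using x by (simp only: rep.m_assoc rep.m_closed rep.h_closed)
    then show ?thesis using x by (simp only: rep.h_mult) simp
  qed
  have "ei_h f i s \<otimes>\<^bsub>B\<^esub> ei_x f (i, j, g) \<otimes>\<^bsub>B\<^esub> ei_h f j t \<otimes>\<^bsub>B\<^esub> (ei_h f j (- t) \<otimes>\<^bsub>B\<^esub> ei_x' f (i, j, g) \<otimes>\<^bsub>B\<^esub> ei_h f i (- s)) =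
      ei_h f i s \<otimes>\<^bsub>B\<^esub> (ei_x f (i, j, g) \<otimes>\<^bsub>B\<^esub> ei_h f j t \<otimes>\<^bsub>B\<^esub> (ei_h f j (- t) \<otimes>\<^bsub>B\<^esub> ei_x' f (i, j, g))) \<otimes>\<^bsub>B\<^esub> ei_h f i (- s)"
    using x(1,5) by (simp only: rep.m_assoc rep.m_closed rep.h_closed)
  then show "f (basis (arrow_elt (Inl (i, j, g)) (elt (i, j, g) s t)) \<otimes>\<^bsub>EIk\<^esub>
      basis (arrow_elt (Inr (i, j, g)) (elt (i, j, g) s t))) =
    ei_h f i s \<otimes>\<^bsub>B\<^esub> (ei_x f (i, j, g) \<otimes>\<^bsub>B\<^esub> ei_x' f (i, j, g)) \<otimes>\<^bsub>B\<^esub> ei_h f i (- s)"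
    unfolding f.hom_mult[OF arr_closed(1)[OF B f char_p assms] arr_closed(2)[OF B f char_p assms]] ha 1 .
  have "ei_h f j (- t) \<otimes>\<^bsub>B\<^esub> ei_x' f (i, j, g) \<otimes>\<^bsub>B\<^esub> ei_h f i (- s) \<otimes>\<^bsub>B\<^esub> (ei_h f i s \<otimes>\<^bsub>B\<^esub> ei_x f (i, j, g) \<otimes>\<^bsub>B\<^esub> ei_h f j t) =
      ei_h f j (- t) \<otimes>\<^bsub>B\<^esub> (ei_x' f (i, j, g) \<otimes>\<^bsub>B\<^esub> ei_h f i (- s) \<otimes>\<^bsub>B\<^esub> (ei_h f i s \<otimes>\<^bsub>B\<^esub> ei_x f (i, j, g))) \<otimes>\<^bsub>B\<^esub> ei_h f j t"
    using x(1,5) by (simp only: rep.m_assoc rep.m_closed rep.h_closed)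
  then show "f (basis (arrow_elt (Inr (i, j, g)) (elt (i, j, g) s t)) \<otimes>\<^bsub>EIk\<^esub>
      basis (arrow_elt (Inl (i, j, g)) (elt (i, j, g) s t))) =
    ei_h f j (- t) \<otimes>\<^bsub>B\<^esub> (ei_x' f (i, j, g) \<otimes>\<^bsub>B\<^esub> ei_x f (i, j, g)) \<otimes>\<^bsub>B\<^esub> ei_h f j t"
    unfolding f.hom_mult[OF arr_closed(2)[OF B f char_p assms] arr_closed(1)[OF B f char_p assms]] ha 2 .
qed

text \<open>Reindexed by the residues that label the orbits, the sums over R and L have terms that
  no longer depend on the chosen representatives.\<close>

lemma hom_ei_preproj_relation:
  assumes reps: "orbit_reps E0 L R"
  shows "ei_preproj_relation E0 L R \<in> carrier EIk"
    and "f (ei_preproj_relation E0 L R) = rep.ei_mesh (ei_h f) (ei_x f) (ei_x' f)"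
proof -
  let ?l = "\<lambda>a b. basis (arrow_elt (Inl a) b) \<otimes>\<^bsub>EIk\<^esub> basis (arrow_elt (Inr a) b)"
  let ?r = "\<lambda>a b. basis (arrow_elt (Inr a) b) \<otimes>\<^bsub>EIk\<^esub> basis (arrow_elt (Inl a) b)"
  have pts0: "pts (bis E0 a) = {elt a s t |s t. True}" for a
    using pts_ED(1)[of a] by (cases a) (simp add: E0_simps ED_simps)
  have sub: "L a \<subseteq> {elt a s t |s t. True}" "R a \<subseteq> {elt a s t |s t. True}" if "a \<in> N" for a
    using reps that unfolding orbit_reps_def left_orbit_reps_def right_orbit_reps_def E0_simps(1) pts0
    by blast+
  have cl: "?l a b \<in> carrier EIk" "?r a b \<in> carrier EIk" if "a \<in> N" "b \<in> {elt a s t |s t. True}" for a b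
    using that arr_closed[OF B f char_p that(1)] by (auto intro!: ED.ei.mult_closed)
  have rho: "ei_preproj_relation E0 L R = (\<Sum>a\<in>N. (\<Sum>b\<in>R a. ?l a b) - (\<Sum>b\<in>L a. ?r a b))"
    by (simp add: ei_preproj_relation_def Let_def E0_simps)
  have cl_sum: "(\<Sum>b\<in>R a. ?l a b) \<in> carrier EIk" "(\<Sum>b\<in>L a. ?r a b) \<in> carrier EIk" if "a \<in> N" for a
    by (rule ED.ei.sum_closed, rule cl(1)[OF that], erule subsetD[OF sub(2)[OF that]])
      (rule ED.ei.sum_closed, rule cl(2)[OF that], erule subsetD[OF sub(1)[OF that]])
  show "ei_preproj_relation E0 L R \<in> carrier EIk"
    unfolding rho by (rule ED.ei.sum_closed, rule ED.ei.diff_closed; erule cl_sum)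
  have "f (ei_preproj_relation E0 L R) = (\<Oplus>\<^bsub>B\<^esub>a\<in>N. f ((\<Sum>b\<in>R a. ?l a b) - (\<Sum>b\<in>L a. ?r a b)))"
    unfolding rho by (rule ED.ei.hom_sum[OF B f], rule ED.ei.diff_closed; erule cl_sum)
  also have "\<dots> = rep.ei_mesh (ei_h f) (ei_x f) (ei_x' f)"
    unfolding rep.ei_mesh_def
  proof (intro rep.finsum_cong')
    show "(\<lambda>a. case a of (i, j, g) \<Rightarrow> rep.conj_sum (rep.F i j) (ei_h f i) (ei_x f (i, j, g) \<otimes>\<^bsub>B\<^esub> ei_x' f (i, j, g)) \<ominus>\<^bsub>B\<^esub>
        rep.conj_sum (rep.F j i) (ei_h f j) (ei_x' f (i, j, g) \<otimes>\<^bsub>B\<^esub> ei_x f (i, j, g))) \<in> N \<rightarrow> carrier B"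
      using rep.x_laws by (auto intro!: rep.conj_sum_closed rep.minus_closed)
    fix a assume a: "a \<in> N"
    obtain i j g where ijg: "a = (i, j, g)" by (cases a) auto
    have N: "(i, j, g) \<in> N" using a ijg by simp
    have elt: "elt a s t = cyc_elt (c i) (c j) s t" for s t by (simp add: elt_def ijg)
    have repR: "right_orbit_reps (integer_mod_group (c j)) (cyc_biset (c i) (c j)) (R a)"
      and repL: "left_orbit_reps (integer_mod_group (c i)) (cyc_biset (c i) (c j)) (L a)"
      using reps a unfolding orbit_reps_def by (auto simp: E0_simps ijg)
    obtain r where r: "bij_betw r {..<c i div gcd (c i) (c j)} (R a)"
      "\<And>s. s < c i div gcd (c i) (c j) \<Longrightarrow> \<exists>t. r s = cyc_elt (c i) (c j) (int s) t"
      using right_reps_bij[OF c_pos c_pos repR] by blast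
    obtain l where l: "bij_betw l {..<c j div gcd (c i) (c j)} (L a)"
      "\<And>s. s < c j div gcd (c i) (c j) \<Longrightarrow> \<exists>t. l s = cyc_elt (c i) (c j) t (- int s)"
      using left_reps_bij[OF c_pos c_pos repL] by blast
    have F: "rep.F i j = c i div gcd (c i) (c j)" "rep.F j i = c j div gcd (c i) (c j)"
      by (simp_all add: rep.F_def gcd.commute)
    note cla = cl[OF a]
    have "f (\<Sum>b\<in>R a. ?l a b) = (\<Oplus>\<^bsub>B\<^esub>b\<in>R a. f (?l a b))"
      by (rule ED.ei.hom_sum[OF B f], rule cla(1), erule subsetD[OF sub(2)[OF a]])
    also have "\<dots> = (\<Oplus>\<^bsub>B\<^esub>s\<in>{..<rep.F i j}. f (?l a (r s)))"
      unfolding F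
      by (rule bij_finsum[OF rep.ring_axioms r(1)], rule f.hom_closed, rule cla(1), erule subsetD[OF sub(2)[OF a]])
    also have "\<dots> = rep.conj_sum (rep.F i j) (ei_h f i) (ei_x f (i, j, g) \<otimes>\<^bsub>B\<^esub> ei_x' f (i, j, g))"
      unfolding rep.conj_sum_def
    proof (intro rep.finsum_cong')
      fix s assume s: "s \<in> {..<rep.F i j}"
      then obtain t where "r s = elt (i, j, g) (int s) t"
        using r(2)[of s] unfolding F elt ijg[symmetric] by blast
      then show "f (?l a (r s)) = ei_h f i (int s) \<otimes>\<^bsub>B\<^esub> (ei_x f (i, j, g) \<otimes>\<^bsub>B\<^esub> ei_x' f (i, j, g)) \<otimes>\<^bsub>B\<^esub> ei_h f i (- int s)"
        using hom_bb(1)[OF N, of "int s" t] by (simp only: ijg)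
    qed (use rep.x_laws[OF N] in auto)
    finally have 1: "f (\<Sum>b\<in>R a. ?l a b) = rep.conj_sum (rep.F i j) (ei_h f i) (ei_x f (i, j, g) \<otimes>\<^bsub>B\<^esub> ei_x' f (i, j, g))" .
    have "f (\<Sum>b\<in>L a. ?r a b) = (\<Oplus>\<^bsub>B\<^esub>b\<in>L a. f (?r a b))"
      by (rule ED.ei.hom_sum[OF B f], rule cla(2), erule subsetD[OF sub(1)[OF a]])
    also have "\<dots> = (\<Oplus>\<^bsub>B\<^esub>s\<in>{..<rep.F j i}. f (?r a (l s)))"
      unfolding F
      by (rule bij_finsum[OF rep.ring_axioms l(1)], rule f.hom_closed, rule cla(2), erule subsetD[OF sub(1)[OF a]])
    also have "\<dots> = rep.conj_sum (rep.F j i) (ei_h f j) (ei_x' f (i, j, g) \<otimes>\<^bsub>B\<^esub> ei_x f (i, j, g))"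
      unfolding rep.conj_sum_def
    proof (intro rep.finsum_cong')
      fix s assume s: "s \<in> {..<rep.F j i}"
      then obtain t where "l s = elt (i, j, g) t (- int s)"
        using l(2)[of s] unfolding F elt ijg[symmetric] by blast
      then show "f (?r a (l s)) = ei_h f j (int s) \<otimes>\<^bsub>B\<^esub> (ei_x' f (i, j, g) \<otimes>\<^bsub>B\<^esub> ei_x f (i, j, g)) \<otimes>\<^bsub>B\<^esub> ei_h f j (- int s)"
        using hom_bb(2)[OF N, of t "- int s"] by (simp only: ijg minus_minus)
    qed (use rep.x_laws[OF N] in auto)
    finally have 2: "f (\<Sum>b\<in>L a. ?r a b) = rep.conj_sum (rep.F j i) (ei_h f j) (ei_x' f (i, j, g) \<otimes>\<^bsub>B\<^esub> ei_x f (i, j, g))" .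
    show "f ((\<Sum>b\<in>R a. ?l a b) - (\<Sum>b\<in>L a. ?r a b)) = (case a of (i, j, g) \<Rightarrow>
        rep.conj_sum (rep.F i j) (ei_h f i) (ei_x f (i, j, g) \<otimes>\<^bsub>B\<^esub> ei_x' f (i, j, g)) \<ominus>\<^bsub>B\<^esub>
        rep.conj_sum (rep.F j i) (ei_h f j) (ei_x' f (i, j, g) \<otimes>\<^bsub>B\<^esub> ei_x f (i, j, g)))"
      using cl_sum[OF a] 1 2
      by (simp only: ED.ei.minus_eq_diff[symmetric] f.hom_minus) (simp add: ijg)
  qed simp
  finally show "f (ei_preproj_relation E0 L R) = rep.ei_mesh (ei_h f) (ei_x f) (ei_x' f)" .
qed

end

section \<open>Homomorphisms out of the EI category algebra with prescribed generators\<close>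

context cartan_setup
begin

lemma ei_hom_exists:
  fixes B :: "('k::field, 'b) module"
  assumes rep: "ei_representation B e c N p h x x'"
  obtains f where "f \<in> alg_hom EI B" "\<And>i s. ei_h f i s = h i s"
    "\<And>a. a \<in> N \<Longrightarrow> ei_x f a = x a" "\<And>a. a \<in> N \<Longrightarrow> ei_x' f a = x' a"
proof -
  interpret ei_representation B e c N p h x x' by (rule rep)
  \<comment> \<open>A pair of exponents is chosen for each class; the periods of h and the shift
    relations below show that \<open>xl\<close> and \<open>xr\<close> do not depend on the
    choice.\<close>
  define st where "st a \<xi> = (SOME st. \<xi> = elt a (fst st) (snd st))" for a \<xi>
  define xl where "xl a \<xi> = (case a of (i, j, g) \<Rightarrow> h i (fst (st a \<xi>)) \<otimes>\<^bsub>B\<^esub> x a \<otimes>\<^bsub>B\<^esub> h j (snd (st a \<xi>)))" for a \<xi>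
  define xr where "xr a \<xi> = (case a of (i, j, g) \<Rightarrow> h j (- snd (st a \<xi>)) \<otimes>\<^bsub>B\<^esub> x' a \<otimes>\<^bsub>B\<^esub> h i (- fst (st a \<xi>)))" for a \<xi>
  have st: "elt a s t = elt a (fst (st a (elt a s t))) (snd (st a (elt a s t)))" for a s t
    unfolding st_def by (rule someI[of _ "(s, t)"]) simp
  have h_mod_minus: "h i (- (s mod int (c i))) = h i (- s)" for i s
    using h_mod[of i "- (s mod int (c i))"] h_mod[of i "- s"] by (simp add: mod_minus_eq)
  have xl: "xl (i, j, g) (elt (i, j, g) s t) = h i s \<otimes>\<^bsub>B\<^esub> x (i, j, g) \<otimes>\<^bsub>B\<^esub> h j t"
    and xr: "xr (i, j, g) (elt (i, j, g) s t) = h j (- t) \<otimes>\<^bsub>B\<^esub> x' (i, j, g) \<otimes>\<^bsub>B\<^esub> h i (- s)"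
    if N: "(i, j, g) \<in> N" for i j g s t
  proof -
    note x = x_laws[OF N]
    let ?s = "fst (st (i, j, g) (elt (i, j, g) s t))" and ?t = "snd (st (i, j, g) (elt (i, j, g) s t))"
    have eq: "cyc_elt (c i) (c j) s t = cyc_elt (c i) (c j) ?s ?t"
      using st[of "(i, j, g)" s t] by (simp add: elt_def)
    \<comment> \<open>The commutation of x with the powers F is exactly invariance under the common
      subgroup.\<close>
    have shift1: "h i (s + int (F i j)) \<otimes>\<^bsub>B\<^esub> x (i, j, g) \<otimes>\<^bsub>B\<^esub> h j t = h i s \<otimes>\<^bsub>B\<^esub> x (i, j, g) \<otimes>\<^bsub>B\<^esub> h j (t + int (F j i))" for s t
    proof -
      have "h i (s + int (F i j)) \<otimes>\<^bsub>B\<^esub> x (i, j, g) \<otimes>\<^bsub>B\<^esub> h j t = h i s \<otimes>\<^bsub>B\<^esub> (h i (int (F i j)) \<otimes>\<^bsub>B\<^esub> x (i, j, g)) \<otimes>\<^bsub>B\<^esub> h j t"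
        using x(1) by (simp only: h_add m_assoc m_closed h_closed)
      also have "\<dots> = h i s \<otimes>\<^bsub>B\<^esub> x (i, j, g) \<otimes>\<^bsub>B\<^esub> (h j (int (F j i)) \<otimes>\<^bsub>B\<^esub> h j t)"
        unfolding x(4) using x(1) by (simp only: m_assoc m_closed h_closed)
      finally show ?thesis by (simp only: h_mult add.commute)
    qed
    have shift2: "h j (- t) \<otimes>\<^bsub>B\<^esub> x' (i, j, g) \<otimes>\<^bsub>B\<^esub> h i (- (s + int (F i j))) = h j (- (t + int (F j i))) \<otimes>\<^bsub>B\<^esub> x' (i, j, g) \<otimes>\<^bsub>B\<^esub> h i (- s)" for s t
    proof -
      have "h j (- (t + int (F j i))) \<otimes>\<^bsub>B\<^esub> x' (i, j, g) \<otimes>\<^bsub>B\<^esub> h i (- s) =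
          h j (- (t + int (F j i))) \<otimes>\<^bsub>B\<^esub> x' (i, j, g) \<otimes>\<^bsub>B\<^esub> (h i (int (F i j)) \<otimes>\<^bsub>B\<^esub> h i (- (s + int (F i j))))"
        by (simp add: h_mult)
      also have "\<dots> = h j (- (t + int (F j i))) \<otimes>\<^bsub>B\<^esub> (x' (i, j, g) \<otimes>\<^bsub>B\<^esub> h i (int (F i j))) \<otimes>\<^bsub>B\<^esub> h i (- (s + int (F i j)))"
        using x(5) by (simp only: m_assoc m_closed h_closed)
      also have "\<dots> = h j (- (t + int (F j i))) \<otimes>\<^bsub>B\<^esub> h j (int (F j i)) \<otimes>\<^bsub>B\<^esub> x' (i, j, g) \<otimes>\<^bsub>B\<^esub> h i (- (s + int (F i j)))"
        unfolding x(8)[symmetric] using x(5) by (simp only: m_assoc m_closed h_closed)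
      also have "\<dots> = h j (- t) \<otimes>\<^bsub>B\<^esub> x' (i, j, g) \<otimes>\<^bsub>B\<^esub> h i (- (s + int (F i j)))"
        by (simp add: h_mult)
      finally show ?thesis by simp
    qed
    note s1 = shift1[unfolded F_def gcd.commute[of "c j" "c i"]]
      and s2 = shift2[unfolded F_def gcd.commute[of "c j" "c i"]]
    have "h i s \<otimes>\<^bsub>B\<^esub> x (i, j, g) \<otimes>\<^bsub>B\<^esub> h j t = h i ?s \<otimes>\<^bsub>B\<^esub> x (i, j, g) \<otimes>\<^bsub>B\<^esub> h j ?t"
      by (rule cyc_elt_invariant[OF c_pos c_pos eq, where v = "\<lambda>s t. h i s \<otimes>\<^bsub>B\<^esub> x (i, j, g) \<otimes>\<^bsub>B\<^esub> h j t"])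
        (simp_all only: h_mod s1)
    then show "xl (i, j, g) (elt (i, j, g) s t) = h i s \<otimes>\<^bsub>B\<^esub> x (i, j, g) \<otimes>\<^bsub>B\<^esub> h j t"
      by (simp add: xl_def)
    have "h j (- t) \<otimes>\<^bsub>B\<^esub> x' (i, j, g) \<otimes>\<^bsub>B\<^esub> h i (- s) = h j (- ?t) \<otimes>\<^bsub>B\<^esub> x' (i, j, g) \<otimes>\<^bsub>B\<^esub> h i (- ?s)"
      by (rule cyc_elt_invariant[OF c_pos c_pos eq, where v = "\<lambda>s t. h j (- t) \<otimes>\<^bsub>B\<^esub> x' (i, j, g) \<otimes>\<^bsub>B\<^esub> h i (- s)"])
        (simp_all only: h_mod_minus s2)
    then show "xr (i, j, g) (elt (i, j, g) s t) = h j (- t) \<otimes>\<^bsub>B\<^esub> x' (i, j, g) \<otimes>\<^bsub>B\<^esub> h i (- s)"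
      by (simp add: xr_def)
  qed
  obtain f where f: "f \<in> alg_hom EI B"
    "\<And>v g. v \<in> verts (quiver ED) \<Longrightarrow> g \<in> carrier (grp ED v) \<Longrightarrow> f (basis (Elt v g)) = h v g"
    "\<And>a y. a \<in> arcs (quiver ED) \<Longrightarrow> y \<in> pts (bis ED a) \<Longrightarrow> f (basis (arrow_elt a y)) = case_sum xl xr a y"
  proof (rule ED.ei_category_hom[of B e h "case_sum xl xr"])
    show "complete_idempotents B (verts (quiver ED)) e"
      using complete_idempotents_axioms by (simp add: ED_simps)
    show "h v (g \<otimes>\<^bsub>grp ED v\<^esub> g') = h v g \<otimes>\<^bsub>B\<^esub> h v g'" for v g g'
      by (simp add: ED_simps h_mod h_mult)
    show "h v \<one>\<^bsub>grp ED v\<^esub> = e v" for v by (simp add: ED_simps h_0)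
  next
    fix a y assume a: "a \<in> arcs (quiver ED)" "y \<in> pts (bis ED a)"
    then obtain i j g s t where y: "(i, j, g) \<in> N" "a = Inl (i, j, g) \<or> a = Inr (i, j, g)" "y = elt (i, j, g) s t"
      by (auto simp: ED_simps(1) pts_ED)
    note x = x_laws[OF y(1)]
    show "case_sum xl xr a y \<in> carrier B"
      using y x by (auto simp: xl xr)
    show "case_sum xl xr a (lact (bis ED a) k y) = h (head (quiver ED) a) k \<otimes>\<^bsub>B\<^esub> case_sum xl xr a y"
      if "k \<in> carrier (grp ED (head (quiver ED) a))" for k
      using y(2)
    proof
      assume "a = Inl (i, j, g)"
      then show ?thesis using x that y by (simp add: ED_simps(3-6) act_ED xl h_add m_assoc)
    next
      assume r: "a = Inr (i, j, g)"
      then have "h j (- (t - k)) = h j k \<otimes>\<^bsub>B\<^esub> h j (- t)" by (simp add: h_mult)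
      then show ?thesis using r x that y by (simp add: ED_simps(3-6) act_ED xr m_assoc del: minus_diff_eq)
    qed
    show "case_sum xl xr a (ract (bis ED a) y k) = case_sum xl xr a y \<otimes>\<^bsub>B\<^esub> h (tail (quiver ED) a) k"
      if "k \<in> carrier (grp ED (tail (quiver ED) a))" for k
      using y(2)
    proof
      assume "a = Inl (i, j, g)"
      then show ?thesis using x that y by (simp add: ED_simps(3-6) act_ED xl h_add m_assoc)
    next
      assume r: "a = Inr (i, j, g)"
      then have "h i (- (s - k)) = h i (- s) \<otimes>\<^bsub>B\<^esub> h i k" by (simp add: h_mult)
      then show ?thesis using r x that y by (simp add: ED_simps(3-6) act_ED xr m_assoc del: minus_diff_eq)
    qed
  qed (auto simp: h_closed)
  show thesis
  proof (rule that[OF f(1)])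
    show "ei_h f i s = h i s" for i s
      unfolding ei_h_def using f(2)[OF _ mod_in_carrier] by (simp add: ED_simps h_mod)
    show "ei_x f a = x a" if "a \<in> N" for a
      using that f(3)[OF _ elt_in_pts(1), of a 0 0] x_laws
      by (cases a) (simp add: ei_x_def ED_simps InlI xl h_0)
    show "ei_x' f a = x' a" if "a \<in> N" for a
      using that f(3)[OF _ elt_in_pts(2), of a 0 0] x_laws
      by (cases a) (simp add: ei_x'_def ED_simps InrI xr h_0)
  qed
qed

lemma ei_hom_unique:
  fixes B :: "('k::field, 'b) module"
  assumes B: "unital_algebra B" and char_p: "CHAR('k) = p" and f: "f \<in> alg_hom EI B" and f': "f' \<in> alg_hom EI B"
    and h: "\<And>i s. ei_h f i s = ei_h f' i s"
    and x: "\<And>a. a \<in> N \<Longrightarrow> ei_x f a = ei_x f' a" "\<And>a. a \<in> N \<Longrightarrow> ei_x' f a = ei_x' f' a"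
    and y: "y \<in> carrier EI"
  shows "f y = f' y"
proof (rule ED.ei_hom_eqI[OF B f f' _ _ y])
  fix v k assume "k \<in> carrier (grp ED v)"
  then have "k mod int (c v) = k" using c_pos[of v] by (simp add: ED_simps carrier_integer_mod_group)
  then show "f (basis (Elt v k)) = f' (basis (Elt v k))" using h[of v k] by (simp add: ei_h_def)
next
  fix a y assume a: "a \<in> arcs (quiver ED)" "y \<in> pts (bis ED a)"
  then obtain i j g s t where y: "(i, j, g) \<in> N" "a = Inl (i, j, g) \<or> a = Inr (i, j, g)" "y = elt (i, j, g) s t"
    by (auto simp: ED_simps(1) pts_ED)
  then show "f (basis (arrow_elt a y)) = f' (basis (arrow_elt a y))"
    using hom_arrow_elt[OF B f char_p y(1)] hom_arrow_elt[OF B f' char_p y(1)] h x by auto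
qed

end

subsection \<open>The generalized preprojective algebra\<close>

context cartan_setup
begin

abbreviation "GQ \<equiv> gp_quiver C \<Omega>"

lemma GQ_simps:
  "verts GQ = UNIV"
  "arcs GQ = {Arr i j g |i j g. (i, j) \<in> double_orientation \<Omega> \<and> g \<in> {1..cartan_g C i j}} \<union> range Loop"
  "tail GQ (Arr i j g) = j" "head GQ (Arr i j g) = i" "tail GQ (Loop i) = i" "head GQ (Loop i) = i"
  by (simp_all add: gp_quiver_def)

lemma fin_digraph_GQ: "fin_digraph GQ"
proof -
  have "{Arr i j g |i j g. (i, j) \<in> double_orientation \<Omega> \<and> g \<in> {1..cartan_g C i j}} \<subseteq>
      (\<Union>i. \<Union>j. (\<lambda>g. Arr i j g) ` {1..cartan_g C i j})"
    by (auto simp: image_iff)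
  then have "finite {Arr i j g |i j g. (i, j) \<in> double_orientation \<Omega> \<and> g \<in> {1..cartan_g C i j}}"
    by (rule finite_subset) auto
  then show ?thesis by unfold_locales (auto simp: GQ_simps)
qed

sublocale GQ: fin_digraph GQ
  by (rule fin_digraph_GQ)

abbreviation PA :: "('k::field, ('n, 'n gp_arrow) qpath \<Rightarrow>\<^sub>0 'k) module" where
  "PA \<equiv> category_algebra (path_category GQ)"

lemma double_N: "(i, j) \<in> double_orientation \<Omega> \<and> g \<in> {1..cartan_g C i j} \<longleftrightarrow> (i, j, g) \<in> N \<or> (j, i, g) \<in> N"
  using cartan_g_sym[of i j] by (auto simp: double_orientation_def N_def)

lemma PA_closed:
  "basis (Trivial i) \<in> carrier PA" "basis (Arrows [Loop i]) \<in> carrier PA"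
  "(i, j, g) \<in> N \<or> (j, i, g) \<in> N \<Longrightarrow> basis (Arrows [Arr i j g]) \<in> carrier PA"
  unfolding double_N[symmetric]
  by (auto simp: path_category_simps GQ.nontrivial_paths_single GQ_simps intro!: GQ.path.basis_closed)

text \<open>Mesh relations run over the neighbours of a vertex, whereas rho runs over arrows. This
  lemma and the next group the arrows by head and by tail.\<close>

lemma sum_N_head:
  fixes \<phi> :: "'n \<Rightarrow> nat \<Rightarrow> 'z::ab_group_add"
  shows "(\<Sum>a\<in>N. case a of (i, j, g) \<Rightarrow> if i = k then \<phi> j g else 0) = (\<Sum>j | (k, j) \<in> \<Omega>. \<Sum>g = 1..cartan_g C j k. \<phi> j g)"
proof -
  have "(\<Sum>a\<in>N. case a of (i, j, g) \<Rightarrow> if i = k then \<phi> j g else 0) = (\<Sum>(i, j, g)\<in>{(i, j, g)\<in>N. i = k}. \<phi> j g)"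
    using finite_N by (intro sum.mono_neutral_cong_right) (auto split: if_splits)
  also have "\<dots> = (\<Sum>(j, g)\<in>Sigma {j. (k, j) \<in> \<Omega>} (\<lambda>j. {1..cartan_g C j k}). \<phi> j g)"
    by (rule sum.reindex_bij_witness[where i = "\<lambda>(j, g). (k, j, g)" and j = "\<lambda>(i, j, g). (j, g)"])
      (auto simp: N_def cartan_g_sym[of k])
  also have "\<dots> = (\<Sum>j | (k, j) \<in> \<Omega>. \<Sum>g = 1..cartan_g C j k. \<phi> j g)"
    by (rule sum.Sigma[symmetric]) auto
  finally show ?thesis .
qed

lemma sum_N_tail:
  fixes \<phi> :: "'n \<Rightarrow> nat \<Rightarrow> 'z::ab_group_add"
  shows "(\<Sum>a\<in>N. case a of (i, j, g) \<Rightarrow> if j = k then \<phi> i g else 0) = (\<Sum>j | (j, k) \<in> \<Omega>. \<Sum>g = 1..cartan_g C j k. \<phi> j g)"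
proof -
  have "(\<Sum>a\<in>N. case a of (i, j, g) \<Rightarrow> if j = k then \<phi> i g else 0) = (\<Sum>(i, j, g)\<in>{(i, j, g)\<in>N. j = k}. \<phi> i g)"
    using finite_N by (intro sum.mono_neutral_cong_right) (auto split: if_splits)
  also have "\<dots> = (\<Sum>(j, g)\<in>Sigma {j. (j, k) \<in> \<Omega>} (\<lambda>j. {1..cartan_g C j k}). \<phi> j g)"
    by (rule sum.reindex_bij_witness[where i = "\<lambda>(j, g). (j, k, g)" and j = "\<lambda>(i, j, g). (i, g)"])
      (auto simp: N_def)
  also have "\<dots> = (\<Sum>j | (j, k) \<in> \<Omega>. \<Sum>g = 1..cartan_g C j k. \<phi> j g)"
    by (rule sum.Sigma[symmetric]) auto
  finally show ?thesis .
qed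

definition gp_term :: "'n \<Rightarrow> 'n \<Rightarrow> nat \<Rightarrow> ('n, 'n gp_arrow) qpath \<Rightarrow>\<^sub>0 'k::field" where
  "gp_term i j g = (\<Sum>f = 0..cartan_f C j i - 1.
    basis (Arrows [Loop i]) [^]\<^bsub>PA\<^esub> f \<otimes>\<^bsub>PA\<^esub> basis (Arrows [Arr i j g]) \<otimes>\<^bsub>PA\<^esub> basis (Arrows [Arr j i g]) \<otimes>\<^bsub>PA\<^esub>
      basis (Arrows [Loop i]) [^]\<^bsub>PA\<^esub> (cartan_f C j i - 1 - f))"

text \<open>The mesh relation brought into the shape of \<open>gp_mesh\<close>, so that a
  homomorphism maps one to the other term by term.\<close>

definition gp_rel_elt :: "'n \<Rightarrow> ('n, 'n gp_arrow) qpath \<Rightarrow>\<^sub>0 'k::field" where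
  "gp_rel_elt k = (\<Sum>a\<in>N. case a of (i, j, g) \<Rightarrow>
    (if i = k then gp_term i j g else 0) - (if j = k then gp_term j i g else 0))"

text \<open>The neighbours j split according to whether (i, j) or (j, i) lies in \<Omega>.
  \<open>Omega_asym\<close> makes the two parts disjoint and the sign constant on each.\<close>

lemma gp_mesh_relation:
  fixes i :: 'n
  defines "t \<equiv> (\<lambda>j g f. basis (Arrows [Loop i]) [^]\<^bsub>PA\<^esub> f \<otimes>\<^bsub>PA\<^esub> basis (Arrows [Arr i j g]) \<otimes>\<^bsub>PA\<^esub>
    basis (Arrows [Arr j i g]) \<otimes>\<^bsub>PA\<^esub>
    basis (Arrows [Loop i]) [^]\<^bsub>PA\<^esub> (cartan_f C j i - 1 - f) :: ('n, 'n gp_arrow) qpath \<Rightarrow>\<^sub>0 'k::field)"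
  shows "(\<Sum>j | (j, i) \<in> double_orientation \<Omega>. \<Sum>g = 1..cartan_g C j i. \<Sum>f = 0..cartan_f C j i - 1.
     orientation_sgn \<Omega> i j \<odot>\<^bsub>PA\<^esub> t j g f) = gp_rel_elt i"
proof -
  let ?J = "{j. (j, i) \<in> double_orientation \<Omega>}"
  let ?s = "\<lambda>j. orientation_sgn \<Omega> i j"
  have one: "1 \<odot>\<^bsub>PA\<^esub> x = x" and neg: "(- 1) \<odot>\<^bsub>PA\<^esub> x = - x" for x :: "('n, 'n gp_arrow) qpath \<Rightarrow>\<^sub>0 'k"
    by (intro poly_mapping_eqI, simp add: category_algebra_simps lookup_map_times)+
  have gp_term: "gp_term i j g = (\<Sum>f = 0..cartan_f C j i - 1. t j g f)" for j g
    unfolding gp_term_def t_def ..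
  have inner: "(\<Sum>f = 0..cartan_f C j i - 1. ?s j \<odot>\<^bsub>PA\<^esub> t j g f) = (if (i, j) \<in> \<Omega> then gp_term i j g else - gp_term i j g)" for j g
    unfolding gp_term orientation_sgn_def by (cases "(i, j) \<in> \<Omega>") (simp_all only: one neg sum_negf if_True if_False)
  have J: "?J = {j. (i, j) \<in> \<Omega>} \<union> {j. (j, i) \<in> \<Omega>}" by (auto simp: double_orientation_def)
  have "(\<Sum>j\<in>?J. \<Sum>g = 1..cartan_g C j i. \<Sum>f = 0..cartan_f C j i - 1. ?s j \<odot>\<^bsub>PA\<^esub> t j g f) =
      (\<Sum>j | (i, j) \<in> \<Omega>. \<Sum>g = 1..cartan_g C j i. if (i, j) \<in> \<Omega> then gp_term i j g else - gp_term i j g) +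
      (\<Sum>j | (j, i) \<in> \<Omega>. \<Sum>g = 1..cartan_g C j i. if (i, j) \<in> \<Omega> then gp_term i j g else - gp_term i j g)"
    unfolding inner J using Omega_asym by (intro sum.union_disjoint) auto
  also have "(\<Sum>j | (i, j) \<in> \<Omega>. \<Sum>g = 1..cartan_g C j i. if (i, j) \<in> \<Omega> then gp_term i j g else - gp_term i j g) =
      (\<Sum>j | (i, j) \<in> \<Omega>. \<Sum>g = 1..cartan_g C j i. gp_term i j g)"
    by (intro sum.cong) auto
  also have "(\<Sum>j | (j, i) \<in> \<Omega>. \<Sum>g = 1..cartan_g C j i. if (i, j) \<in> \<Omega> then gp_term i j g else - gp_term i j g) =
      - (\<Sum>j | (j, i) \<in> \<Omega>. \<Sum>g = 1..cartan_g C j i. gp_term i j g)"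
    unfolding sum_negf[symmetric] using Omega_asym by (intro sum.cong) auto
  also have "(\<Sum>j | (i, j) \<in> \<Omega>. \<Sum>g = 1..cartan_g C j i. gp_term i j g) +
      - (\<Sum>j | (j, i) \<in> \<Omega>. \<Sum>g = 1..cartan_g C j i. gp_term i j g) =
      (\<Sum>a\<in>N. case a of (i', j, g) \<Rightarrow> if i' = i then gp_term i j g else 0) -
      (\<Sum>a\<in>N. case a of (i', j, g) \<Rightarrow> if j = i then gp_term i i' g else 0)"
    unfolding sum_N_head sum_N_tail by simp
  also have "\<dots> = gp_rel_elt i"
    unfolding gp_rel_elt_def sum_subtractf[symmetric] by (intro sum.cong) auto
  finally show ?thesis .
qed

end

lemma (in unital_algebra) minus_eq_zero_iff:
  assumes "x \<in> carrier A" "y \<in> carrier A"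
  shows "x \<ominus> y = \<zero> \<longleftrightarrow> x = y"
proof
  assume "x \<ominus> y = \<zero>"
  then have "(x \<ominus> y) \<oplus> y = y" using assms by simp
  then show "x = y" using assms by (simp add: minus_eq a_assoc l_neg)
qed (use assms in \<open>simp add: minus_eq r_neg\<close>)

section \<open>Homomorphisms out of the path algebra and the relations they kill\<close>

locale gp_hom = cartan_setup C D \<Omega> p
  for C D :: "int^'n^'n" and \<Omega> :: "('n \<times> 'n) set" and p :: nat +
  fixes B :: "('k::field, 'b) module" and f
  assumes B: "unital_algebra B" and f: "f \<in> alg_hom PA B" and char_p: "CHAR('k) = p"
begin

sublocale B: unital_algebra B
  by (rule B)

sublocale f: unital_algebra_hom PA B f
  by unfold_locales (rule f)

abbreviation "PAk \<equiv> (PA :: ('k, ('n, 'n gp_arrow) qpath \<Rightarrow>\<^sub>0 'k) module)"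

lemma PA_cl:
  "basis (Trivial i) \<in> carrier PAk" "basis (Arrows [Loop i]) \<in> carrier PAk"
  "(i, j, g) \<in> N \<or> (j, i, g) \<in> N \<Longrightarrow> basis (Arrows [Arr i j g]) \<in> carrier PAk"
  by (rule PA_closed)+

definition "gp_e i = f (basis (Trivial i))"
definition "gp_eps i = f (basis (Arrows [Loop i]))"
definition "gp_y a = (case a of (i, j, g) \<Rightarrow> f (basis (Arrows [Arr i j g])))"
definition "gp_z a = (case a of (i, j, g) \<Rightarrow> f (basis (Arrows [Arr j i g])))"

lemma f_zero: "f 0 = \<zero>\<^bsub>B\<^esub>"
  using f.hom_zero by (simp add: category_algebra_simps)

sublocale rep: cartan_algebra B gp_e c N p
proof -
  have "gp_e u \<otimes>\<^bsub>B\<^esub> gp_e v = (if u = v then gp_e u else \<zero>\<^bsub>B\<^esub>)" for u v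
    unfolding gp_e_def f.hom_mult[OF PA_cl(1) PA_cl(1), symmetric]
    by (simp add: category_algebra_single path_category_simps f_zero)
  moreover have "\<one>\<^bsub>B\<^esub> = (\<Oplus>\<^bsub>B\<^esub>i\<in>UNIV. gp_e i)"
  proof -
    have "\<one>\<^bsub>B\<^esub> = f (\<Sum>i\<in>UNIV. basis (Trivial i))"
      using f.hom_one by (simp add: category_algebra_simps(2) path_category_simps GQ_simps)
    also have "\<dots> = (\<Oplus>\<^bsub>B\<^esub>i\<in>UNIV. gp_e i)"
      unfolding gp_e_def by (rule GQ.path.hom_sum[OF B f PA_cl(1)])
    finally show ?thesis .
  qed
  ultimately show "cartan_algebra B gp_e c N p"
    using f.hom_closed[OF PA_cl(1)]
    by unfold_locales (auto simp: gp_e_def finite_N prime_p char_p powers)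
qed

lemma F_eq:
  assumes "(i, j, g) \<in> N \<or> (j, i, g) \<in> N"
  shows "cartan_f C j i = rep.F i j" "cartan_f C j i - 1 - k = rep.F i j - 1 - k"
    "{0..cartan_f C j i - 1} = {..<rep.F i j}"
proof -
  have "(i, j) \<in> double_orientation \<Omega>" using assms double_N by blast
  then show eq: "cartan_f C j i = rep.F i j" by (simp add: cartan_f_eq rep.F_def)
  then show "cartan_f C j i - 1 - k = rep.F i j - 1 - k" by simp
  obtain m where "rep.F i j = p ^ m" using rep.F_power by blast
  \<comment> \<open>The truncated upper bound, one less than the exponent, gives the right range
    only for a positive exponent.\<close>
  then have "rep.F i j > 0" using prime_gt_0_nat[OF prime_p] by simp
  then show "{0..cartan_f C j i - 1} = {..<rep.F i j}" unfolding eq by auto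
qed

lemma gp_term_closed:
  assumes "(i, j, g) \<in> N \<or> (j, i, g) \<in> N"
  shows "gp_term i j g \<in> carrier PAk"
  unfolding gp_term_def using PA_cl(2)[of i] PA_cl(3)[OF assms] PA_cl(3)[of j i g] assms
  by (intro GQ.path.sum_closed GQ.path.m_closed GQ.path.nat_pow_closed) auto

lemma hom_gp_term:
  assumes "(i, j, g) \<in> N \<or> (j, i, g) \<in> N"
  shows "f (gp_term i j g) = B.split_sum (rep.F i j) (gp_eps i)
    (f (basis (Arrows [Arr i j g])) \<otimes>\<^bsub>B\<^esub> f (basis (Arrows [Arr j i g])))"
proof -
  note cl = PA_cl(2)[of i] PA_cl(3)[OF assms] PA_cl(3)[of j i g]
  have cl3: "basis (Arrows [Arr j i g]) \<in> carrier PAk" using cl(3) assms by blast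
  have "f (gp_term i j g) = (\<Oplus>\<^bsub>B\<^esub>s\<in>{0..cartan_f C j i - 1}.
      f (basis (Arrows [Loop i]) [^]\<^bsub>PAk\<^esub> s \<otimes>\<^bsub>PAk\<^esub> basis (Arrows [Arr i j g]) \<otimes>\<^bsub>PAk\<^esub> basis (Arrows [Arr j i g]) \<otimes>\<^bsub>PAk\<^esub>
        basis (Arrows [Loop i]) [^]\<^bsub>PAk\<^esub> (cartan_f C j i - 1 - s)))"
    unfolding gp_term_def using cl(1,2) cl3
    by (intro GQ.path.hom_sum[OF B f] GQ.path.m_closed GQ.path.nat_pow_closed)
  also have "\<dots> = B.split_sum (rep.F i j) (gp_eps i)
    (f (basis (Arrows [Arr i j g])) \<otimes>\<^bsub>B\<^esub> f (basis (Arrows [Arr j i g])))"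
    unfolding B.split_sum_def F_eq(2,3)[OF assms]
  proof (intro B.finsum_cong' refl)
    have B_cl: "f (basis (Arrows [Arr i j g])) \<in> carrier B" "f (basis (Arrows [Arr j i g])) \<in> carrier B"
      "gp_eps i \<in> carrier B"
      using f.hom_closed cl(1,2) cl3 by (auto simp: gp_eps_def)
    then show "(\<lambda>s. gp_eps i [^]\<^bsub>B\<^esub> s \<otimes>\<^bsub>B\<^esub> (f (basis (Arrows [Arr i j g])) \<otimes>\<^bsub>B\<^esub> f (basis (Arrows [Arr j i g]))) \<otimes>\<^bsub>B\<^esub>
        gp_eps i [^]\<^bsub>B\<^esub> (rep.F i j - 1 - s)) \<in> {..<rep.F i j} \<rightarrow> carrier B"
      by auto
    have pow: "f (basis (Arrows [Loop i]) [^]\<^bsub>PAk\<^esub> n) = gp_eps i [^]\<^bsub>B\<^esub> n" for n :: nat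
      using f.hom_nat_pow[OF cl(1)] by (simp add: gp_eps_def)
    fix s
    show "f (basis (Arrows [Loop i]) [^]\<^bsub>PAk\<^esub> s \<otimes>\<^bsub>PAk\<^esub> basis (Arrows [Arr i j g]) \<otimes>\<^bsub>PAk\<^esub> basis (Arrows [Arr j i g]) \<otimes>\<^bsub>PAk\<^esub>
        basis (Arrows [Loop i]) [^]\<^bsub>PAk\<^esub> (rep.F i j - 1 - s)) =
      gp_eps i [^]\<^bsub>B\<^esub> s \<otimes>\<^bsub>B\<^esub> (f (basis (Arrows [Arr i j g])) \<otimes>\<^bsub>B\<^esub> f (basis (Arrows [Arr j i g]))) \<otimes>\<^bsub>B\<^esub>
        gp_eps i [^]\<^bsub>B\<^esub> (rep.F i j - 1 - s)"
      by (simp only: f.hom_mult GQ.path.m_closed GQ.path.nat_pow_closed cl(1,2) cl3 pow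
          B.m_assoc B.m_closed B.nat_pow_closed B_cl)
  qed
  finally show ?thesis .
qed

lemma hom_mesh:
  "f (gp_rel_elt i) =
    rep.gp_mesh gp_eps gp_y gp_z i"
proof -
  have zero: "0 \<in> carrier PAk" by (simp add: category_algebra_simps)
  have cl: "(if i' = i then gp_term i' j g else 0) \<in> carrier PAk" "(if j = i then gp_term j i' g else 0) \<in> carrier PAk"
    if "(i', j, g) \<in> N" for i' j g
    using that gp_term_closed zero by auto
  have "f (gp_rel_elt i) =
      (\<Oplus>\<^bsub>B\<^esub>a\<in>N. f (case a of (i', j, g) \<Rightarrow> (if i' = i then gp_term i' j g else 0) - (if j = i then gp_term j i' g else 0)))"
    unfolding gp_rel_elt_def
    using cl by (intro GQ.path.hom_sum[OF B f]) (auto intro!: GQ.path.diff_closed split del: if_split)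
  also have "\<dots> = rep.gp_mesh gp_eps gp_y gp_z i"
    unfolding rep.gp_mesh_def
  proof (intro B.finsum_cong')
    have yz: "gp_y (i', j, g) \<in> carrier B" "gp_z (i', j, g) \<in> carrier B" "gp_eps k \<in> carrier B" if "(i', j, g) \<in> N" for i' j g k
      using f.hom_closed[OF PA_cl(2)] f.hom_closed[OF PA_cl(3)] that
      by (auto simp: gp_y_def gp_z_def gp_eps_def)
    show "(\<lambda>a. case a of (i', j, g) \<Rightarrow>
        (if i' = i then B.split_sum (rep.F i' j) (gp_eps i') (gp_y (i', j, g) \<otimes>\<^bsub>B\<^esub> gp_z (i', j, g)) else \<zero>\<^bsub>B\<^esub>) \<ominus>\<^bsub>B\<^esub>
        (if j = i then B.split_sum (rep.F j i') (gp_eps j) (gp_z (i', j, g) \<otimes>\<^bsub>B\<^esub> gp_y (i', j, g)) else \<zero>\<^bsub>B\<^esub>))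
        \<in> N \<rightarrow> carrier B"
      using yz by (auto intro!: B.minus_closed B.split_sum_closed B.m_closed)
    fix a assume "a \<in> N"
    then obtain i' j g where a: "a = (i', j, g)" "(i', j, g) \<in> N" by (cases a) auto
    have "f ((if i' = i then gp_term i' j g else 0) - (if j = i then gp_term j i' g else 0)) =
        f (if i' = i then gp_term i' j g else 0) \<ominus>\<^bsub>B\<^esub> f (if j = i then gp_term j i' g else 0)"
      unfolding GQ.path.minus_eq_diff[OF cl[OF a(2)], symmetric] using cl[OF a(2)] by (rule f.hom_minus)
    also have "f (if i' = i then gp_term i' j g else 0) =
        (if i' = i then B.split_sum (rep.F i' j) (gp_eps i') (gp_y (i', j, g) \<otimes>\<^bsub>B\<^esub> gp_z (i', j, g)) else \<zero>\<^bsub>B\<^esub>)"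
      using hom_gp_term[of i' j g] a(2) by (auto simp: f_zero gp_y_def gp_z_def)
    also have "f (if j = i then gp_term j i' g else 0) =
        (if j = i then B.split_sum (rep.F j i') (gp_eps j) (gp_z (i', j, g) \<otimes>\<^bsub>B\<^esub> gp_y (i', j, g)) else \<zero>\<^bsub>B\<^esub>)"
      using hom_gp_term[of j i' g] a(2) by (auto simp: f_zero gp_y_def gp_z_def)
    finally show "f (case a of (i', j, g) \<Rightarrow> (if i' = i then gp_term i' j g else 0) - (if j = i then gp_term j i' g else 0)) =
      (case a of (i', j, g) \<Rightarrow>
        (if i' = i then B.split_sum (rep.F i' j) (gp_eps i') (gp_y (i', j, g) \<otimes>\<^bsub>B\<^esub> gp_z (i', j, g)) else \<zero>\<^bsub>B\<^esub>) \<ominus>\<^bsub>B\<^esub>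
        (if j = i then B.split_sum (rep.F j i') (gp_eps j) (gp_z (i', j, g) \<otimes>\<^bsub>B\<^esub> gp_y (i', j, g)) else \<zero>\<^bsub>B\<^esub>))"
      by (simp add: a)
  qed simp
  finally show ?thesis .
qed

lemma gp_relations_eq:
  "(gp_relations C D \<Omega> :: (('n, 'n gp_arrow) qpath \<Rightarrow>\<^sub>0 'k) set) =
    {basis (Arrows [Loop k]) [^]\<^bsub>PAk\<^esub> c k |k. True} \<union>
    {basis (Arrows [Loop i]) [^]\<^bsub>PAk\<^esub> rep.F i j \<otimes>\<^bsub>PAk\<^esub> basis (Arrows [Arr i j g]) -
      basis (Arrows [Arr i j g]) \<otimes>\<^bsub>PAk\<^esub> basis (Arrows [Loop j]) [^]\<^bsub>PAk\<^esub> rep.F j i |i j g.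
        (i, j, g) \<in> N \<or> (j, i, g) \<in> N} \<union>
    {gp_rel_elt i |i. True}"
proof -
  have "{basis (Arrows [Loop i]) [^]\<^bsub>PAk\<^esub> cartan_f C j i \<otimes>\<^bsub>PAk\<^esub> basis (Arrows [Arr i j g]) -
      basis (Arrows [Arr i j g]) \<otimes>\<^bsub>PAk\<^esub> basis (Arrows [Loop j]) [^]\<^bsub>PAk\<^esub> cartan_f C i j |i j g.
        (i, j) \<in> double_orientation \<Omega> \<and> g \<in> {1..cartan_g C i j}} =
    {basis (Arrows [Loop i]) [^]\<^bsub>PAk\<^esub> rep.F i j \<otimes>\<^bsub>PAk\<^esub> basis (Arrows [Arr i j g]) -
      basis (Arrows [Arr i j g]) \<otimes>\<^bsub>PAk\<^esub> basis (Arrows [Loop j]) [^]\<^bsub>PAk\<^esub> rep.F j i |i j g.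
        (i, j, g) \<in> N \<or> (j, i, g) \<in> N}"
    unfolding double_N using F_eq(1) by (intro Collect_cong ex_cong) metis
  then show ?thesis
    unfolding gp_relations_def Let_def path_algebra_def gp_mesh_relation by (simp only:)
qed

lemma gp_relations_closed: "gp_relations C D \<Omega> \<subseteq> carrier PAk"
proof -
  have zero: "0 \<in> carrier PAk" by (simp add: category_algebra_simps)
  have 1: "(if i' = i then gp_term i' j g else 0) - (if j = i then gp_term j i' g else 0) \<in> carrier PAk"
    if "(i', j, g) \<in> N" for i' j g i
    using that gp_term_closed zero by (intro GQ.path.diff_closed) auto
  have "gp_rel_elt i \<in> carrier PAk" for i
    unfolding gp_rel_elt_def using 1 by (intro GQ.path.sum_closed) (auto split del: if_split)
  moreover have "basis (Arrows [Loop i]) [^]\<^bsub>PAk\<^esub> rep.F i j \<otimes>\<^bsub>PAk\<^esub> basis (Arrows [Arr i j g]) -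
      basis (Arrows [Arr i j g]) \<otimes>\<^bsub>PAk\<^esub> basis (Arrows [Loop j]) [^]\<^bsub>PAk\<^esub> rep.F j i \<in> carrier PAk"
    if "(i, j, g) \<in> N \<or> (j, i, g) \<in> N" for i j g
    using PA_cl(2) PA_cl(3)[OF that]
    by (intro GQ.path.diff_closed GQ.path.m_closed GQ.path.nat_pow_closed)
  ultimately show ?thesis
    unfolding gp_relations_eq using PA_cl(2) by (auto simp del: GQ.path.nat_pow_Suc)
qed

text \<open>Closedness and the position between idempotents hold for every homomorphism, so what
  remains of \<open>gp_rep\<close> is nilpotency and commutation, which match the first two families
  of relations as the meshes match the third.\<close>

lemma hom_kills_iff:
  "(\<forall>r\<in>gp_relations C D \<Omega>. f r = \<zero>\<^bsub>B\<^esub>) \<longleftrightarrow>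
    rep.gp_rep gp_eps gp_y gp_z \<and> (\<forall>i. rep.gp_mesh gp_eps gp_y gp_z i = \<zero>\<^bsub>B\<^esub>)"
proof -
  have pow: "f (basis (Arrows [Loop k]) [^]\<^bsub>PAk\<^esub> n) = gp_eps k [^]\<^bsub>B\<^esub> n" for k and n :: nat
    using f.hom_nat_pow[OF PA_cl(2)] by (simp add: gp_eps_def)
  have arr: "f (basis (Arrows [Arr i j g])) \<in> carrier B \<and> gp_e i \<otimes>\<^bsub>B\<^esub> f (basis (Arrows [Arr i j g])) = f (basis (Arrows [Arr i j g]))
      \<and> f (basis (Arrows [Arr i j g])) \<otimes>\<^bsub>B\<^esub> gp_e j = f (basis (Arrows [Arr i j g]))"
    if "(i, j, g) \<in> N \<or> (j, i, g) \<in> N" for i j g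
    unfolding gp_e_def f.hom_mult[OF PA_cl(1) PA_cl(3)[OF that], symmetric]
      f.hom_mult[OF PA_cl(3)[OF that] PA_cl(1), symmetric]
    using f.hom_closed[OF PA_cl(3)[OF that]]
    by (simp add: category_algebra_single path_category_simps GQ_simps)
  have loop: "gp_eps i \<in> carrier B" "gp_e i \<otimes>\<^bsub>B\<^esub> gp_eps i = gp_eps i" "gp_eps i \<otimes>\<^bsub>B\<^esub> gp_e i = gp_eps i" for i
    unfolding gp_e_def gp_eps_def f.hom_mult[OF PA_cl(1) PA_cl(2), symmetric]
      f.hom_mult[OF PA_cl(2) PA_cl(1), symmetric]
    using f.hom_closed[OF PA_cl(2)]
    by (simp_all add: category_algebra_single path_category_simps GQ_simps)
  have comm: "f (basis (Arrows [Loop i]) [^]\<^bsub>PAk\<^esub> rep.F i j \<otimes>\<^bsub>PAk\<^esub> basis (Arrows [Arr i j g]) -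
      basis (Arrows [Arr i j g]) \<otimes>\<^bsub>PAk\<^esub> basis (Arrows [Loop j]) [^]\<^bsub>PAk\<^esub> rep.F j i) = \<zero>\<^bsub>B\<^esub> \<longleftrightarrow>
      gp_eps i [^]\<^bsub>B\<^esub> rep.F i j \<otimes>\<^bsub>B\<^esub> f (basis (Arrows [Arr i j g])) =
      f (basis (Arrows [Arr i j g])) \<otimes>\<^bsub>B\<^esub> gp_eps j [^]\<^bsub>B\<^esub> rep.F j i"
    if "(i, j, g) \<in> N \<or> (j, i, g) \<in> N" for i j g
  proof -
    have cl: "basis (Arrows [Loop k]) [^]\<^bsub>PAk\<^esub> (n :: nat) \<in> carrier PAk" "basis (Arrows [Arr i j g]) \<in> carrier PAk" for k n
      using PA_cl(2) PA_cl(3)[OF that] by auto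
    show ?thesis
      unfolding GQ.path.minus_eq_diff[OF GQ.path.m_closed[OF cl] GQ.path.m_closed[OF cl(2,1)], symmetric]
        f.hom_minus[OF GQ.path.m_closed[OF cl] GQ.path.m_closed[OF cl(2,1)]]
        f.hom_mult[OF cl] f.hom_mult[OF cl(2,1)] pow
      using arr[OF that] loop by (intro B.minus_eq_zero_iff) auto
  qed
  have gp_iff: "rep.gp_rep gp_eps gp_y gp_z \<longleftrightarrow> (\<forall>k. gp_eps k [^]\<^bsub>B\<^esub> c k = \<zero>\<^bsub>B\<^esub>) \<and>
      (\<forall>i j g. (i, j, g) \<in> N \<or> (j, i, g) \<in> N \<longrightarrow> gp_eps i [^]\<^bsub>B\<^esub> rep.F i j \<otimes>\<^bsub>B\<^esub> f (basis (Arrows [Arr i j g])) = f (basis (Arrows [Arr i j g])) \<otimes>\<^bsub>B\<^esub> gp_eps j [^]\<^bsub>B\<^esub> rep.F j i)"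
  proof
    assume gp: "rep.gp_rep gp_eps gp_y gp_z"
    note g = gp[unfolded rep.gp_rep_def gp_y_def gp_z_def prod.case]
    have 1: "gp_eps k [^]\<^bsub>B\<^esub> c k = \<zero>\<^bsub>B\<^esub>" for k using g by blast
    have 2: "gp_eps i [^]\<^bsub>B\<^esub> rep.F i j \<otimes>\<^bsub>B\<^esub> f (basis (Arrows [Arr i j g])) = f (basis (Arrows [Arr i j g])) \<otimes>\<^bsub>B\<^esub> gp_eps j [^]\<^bsub>B\<^esub> rep.F j i" if "(i, j, g) \<in> N" for i j g
      using conjunct1[OF conjunct2[OF g]] that by blast
    have 3: "gp_eps j [^]\<^bsub>B\<^esub> rep.F j i \<otimes>\<^bsub>B\<^esub> f (basis (Arrows [Arr j i g])) = f (basis (Arrows [Arr j i g])) \<otimes>\<^bsub>B\<^esub> gp_eps i [^]\<^bsub>B\<^esub> rep.F i j" if "(i, j, g) \<in> N" for i j g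
      using conjunct2[OF conjunct2[OF g]] that by blast
    show "(\<forall>k. gp_eps k [^]\<^bsub>B\<^esub> c k = \<zero>\<^bsub>B\<^esub>) \<and>
      (\<forall>i j g. (i, j, g) \<in> N \<or> (j, i, g) \<in> N \<longrightarrow> gp_eps i [^]\<^bsub>B\<^esub> rep.F i j \<otimes>\<^bsub>B\<^esub> f (basis (Arrows [Arr i j g])) = f (basis (Arrows [Arr i j g])) \<otimes>\<^bsub>B\<^esub> gp_eps j [^]\<^bsub>B\<^esub> rep.F j i)"
      by (intro conjI allI impI 1, elim disjE, erule 2, erule 3)
  next
    assume r: "(\<forall>k. gp_eps k [^]\<^bsub>B\<^esub> c k = \<zero>\<^bsub>B\<^esub>) \<and>
      (\<forall>i j g. (i, j, g) \<in> N \<or> (j, i, g) \<in> N \<longrightarrow> gp_eps i [^]\<^bsub>B\<^esub> rep.F i j \<otimes>\<^bsub>B\<^esub> f (basis (Arrows [Arr i j g])) = f (basis (Arrows [Arr i j g])) \<otimes>\<^bsub>B\<^esub> gp_eps j [^]\<^bsub>B\<^esub> rep.F j i)"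
    have r1: "gp_eps k [^]\<^bsub>B\<^esub> c k = \<zero>\<^bsub>B\<^esub>" for k using r by blast
    have r2: "gp_eps i [^]\<^bsub>B\<^esub> rep.F i j \<otimes>\<^bsub>B\<^esub> f (basis (Arrows [Arr i j g])) = f (basis (Arrows [Arr i j g])) \<otimes>\<^bsub>B\<^esub> gp_eps j [^]\<^bsub>B\<^esub> rep.F j i" if "(i, j, g) \<in> N" for i j g
      by (rule conjunct2[OF r, rule_format]) (rule disjI1[OF that])
    have r3: "gp_eps j [^]\<^bsub>B\<^esub> rep.F j i \<otimes>\<^bsub>B\<^esub> f (basis (Arrows [Arr j i g])) = f (basis (Arrows [Arr j i g])) \<otimes>\<^bsub>B\<^esub> gp_eps i [^]\<^bsub>B\<^esub> rep.F i j" if "(i, j, g) \<in> N" for i j g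
      by (rule conjunct2[OF r, rule_format]) (rule disjI2[OF that])
    have a1: "f (basis (Arrows [Arr i j g])) \<in> carrier B"
      "gp_e i \<otimes>\<^bsub>B\<^esub> f (basis (Arrows [Arr i j g])) = f (basis (Arrows [Arr i j g]))"
      "f (basis (Arrows [Arr i j g])) \<otimes>\<^bsub>B\<^esub> gp_e j = f (basis (Arrows [Arr i j g]))"
      if "(i, j, g) \<in> N" for i j g
      using arr[OF disjI1[OF that]] by blast+
    have a2: "f (basis (Arrows [Arr j i g])) \<in> carrier B"
      "gp_e j \<otimes>\<^bsub>B\<^esub> f (basis (Arrows [Arr j i g])) = f (basis (Arrows [Arr j i g]))"
      "f (basis (Arrows [Arr j i g])) \<otimes>\<^bsub>B\<^esub> gp_e i = f (basis (Arrows [Arr j i g]))"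
      if "(i, j, g) \<in> N" for i j g
      using arr[OF disjI2[OF that]] by blast+
    show "rep.gp_rep gp_eps gp_y gp_z"
      unfolding rep.gp_rep_def gp_y_def gp_z_def prod.case
      by (intro conjI allI impI) (rule loop r1 a1 a2 r2 r3; assumption)+
  qed
  have ball3: "(\<forall>r\<in>{A k |k. True} \<union> {G i j g |i j g. P i j g} \<union> {H i |i. True}. Z r) \<longleftrightarrow>
      (\<forall>k. Z (A k)) \<and> (\<forall>i j g. P i j g \<longrightarrow> Z (G i j g)) \<and> (\<forall>i. Z (H i))"
    for A H :: "'n \<Rightarrow> ('n, 'n gp_arrow) qpath \<Rightarrow>\<^sub>0 'k" and G :: "'n \<Rightarrow> 'n \<Rightarrow> nat \<Rightarrow> ('n, 'n gp_arrow) qpath \<Rightarrow>\<^sub>0 'k" and P Z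
    by blast
  show ?thesis
    unfolding gp_relations_eq ball3 hom_mesh pow gp_iff conj_assoc
    by (simp only: comm cong: imp_cong)
qed

end

context cartan_setup
begin

lemma gp_hom_exists:
  fixes B :: "('k::field, 'b) module"
  assumes rep: "cartan_algebra B e c N p" and gp: "cartan_algebra.gp_rep B e c N \<epsilon> y z"
  obtains f where "f \<in> alg_hom PA B" "\<And>i. f (basis (Trivial i)) = e i"
    "\<And>i. f (basis (Arrows [Loop i])) = \<epsilon> i"
    "\<And>i j g. (i, j, g) \<in> N \<Longrightarrow> f (basis (Arrows [Arr i j g])) = y (i, j, g)"
    "\<And>i j g. (i, j, g) \<in> N \<Longrightarrow> f (basis (Arrows [Arr j i g])) = z (i, j, g)"
proof -
  interpret cartan_algebra B e c N p by (rule rep)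
  \<comment> \<open>An arrow of the double whose triple is not in \<open>N\<close> is the reverse of
    one that is, and takes its value from z. By \<open>Omega_asym\<close> no triple lies in
    \<open>N\<close> together with its reverse.\<close>
  define v where "v a = (case a of Arr i j g \<Rightarrow> if (i, j, g) \<in> N then y (i, j, g) else z (j, i, g) | Loop i \<Rightarrow> \<epsilon> i)" for a
  have laws: "v a \<in> carrier B \<and> e (head GQ a) \<otimes>\<^bsub>B\<^esub> v a = v a \<and> v a \<otimes>\<^bsub>B\<^esub> e (tail GQ a) = v a" if "a \<in> arcs GQ" for a
  proof (cases a)
    case (Arr i j g)
    then have "(i, j, g) \<in> N \<or> (j, i, g) \<in> N" using that double_N by (auto simp: GQ_simps)
    then show ?thesis using gp unfolding gp_rep_def Arr v_def GQ_simps by (simp split: if_split) blast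
  next
    case (Loop i)
    then show ?thesis using gp unfolding gp_rep_def Loop v_def GQ_simps by simp
  qed
  have idem: "complete_idempotents B (verts GQ) e"
    using complete_idempotents_axioms by (simp add: GQ_simps)
  have vc: "\<And>a. a \<in> arcs GQ \<Longrightarrow> v a \<in> carrier B"
    and vl: "\<And>a. a \<in> arcs GQ \<Longrightarrow> e (head GQ a) \<otimes>\<^bsub>B\<^esub> v a = v a"
    and vr: "\<And>a. a \<in> arcs GQ \<Longrightarrow> v a \<otimes>\<^bsub>B\<^esub> e (tail GQ a) = v a"
    using laws by blast+
  obtain f where f: "f \<in> alg_hom (path_algebra GQ) B" "\<And>i. i \<in> verts GQ \<Longrightarrow> f (basis (Trivial i)) = e i"
    "\<And>a. a \<in> arcs GQ \<Longrightarrow> f (basis (Arrows [a])) = v a"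
    using GQ.path_algebra_hom[OF idem vc vl vr] by blast
  show thesis
  proof (rule that)
    show "f \<in> alg_hom PA B" using f(1) by (simp add: path_algebra_def)
    show "f (basis (Trivial i)) = e i" for i using f(2) by (simp add: GQ_simps)
    show "f (basis (Arrows [Loop i])) = \<epsilon> i" for i using f(3)[of "Loop i"] by (simp add: GQ_simps v_def)
    show "f (basis (Arrows [Arr i j g])) = y (i, j, g)" if "(i, j, g) \<in> N" for i j g
      using f(3)[of "Arr i j g"] that double_N[of i j g] by (auto simp: GQ_simps v_def)
    show "f (basis (Arrows [Arr j i g])) = z (i, j, g)" if "(i, j, g) \<in> N" for i j g
    proof -
      have "(j, i, g) \<notin> N" using that Omega_asym by (auto simp: N_def)
      then show ?thesis using f(3)[of "Arr j i g"] that double_N[of j i g] by (auto simp: GQ_simps v_def)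
    qed
  qed
qed

lemma gp_hom_unique:
  fixes B :: "('k::field, 'b) module"
  assumes B: "unital_algebra B" and f: "f \<in> alg_hom PA B" and f': "f' \<in> alg_hom PA B"
    and eq: "\<And>i. f (basis (Trivial i)) = f' (basis (Trivial i))"
      "\<And>i. f (basis (Arrows [Loop i])) = f' (basis (Arrows [Loop i]))"
      "\<And>i j g. (i, j, g) \<in> N \<Longrightarrow> f (basis (Arrows [Arr i j g])) = f' (basis (Arrows [Arr i j g]))"
      "\<And>i j g. (i, j, g) \<in> N \<Longrightarrow> f (basis (Arrows [Arr j i g])) = f' (basis (Arrows [Arr j i g]))"
    and x: "x \<in> carrier PA"
  shows "f x = f' x"
proof (rule GQ.path_algebra_hom_eqI[OF B])
  fix a assume "a \<in> arcs GQ"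
  then show "f (basis (Arrows [a])) = f' (basis (Arrows [a]))"
    using eq double_N by (cases a) (auto simp: GQ_simps)
qed (use f f' x eq in \<open>auto simp: path_algebra_def\<close>)

end

section \<open>The isomorphism\<close>

context cartan_algebra
begin

text \<open>The values of a constructed homomorphism are prescribed only on \<open>N\<close>, so its
  data agree with the given ones only there.\<close>

lemma gp_rep_cong:
  assumes "gp_rep \<epsilon> y z" "\<And>a. a \<in> N \<Longrightarrow> y' a = y a" "\<And>a. a \<in> N \<Longrightarrow> z' a = z a"
  shows "gp_rep \<epsilon> y' z'"
  using assms unfolding gp_rep_def by simp

lemma gp_mesh_cong:
  assumes "gp_rep \<epsilon> y z" "\<And>a. a \<in> N \<Longrightarrow> y' a = y a" "\<And>a. a \<in> N \<Longrightarrow> z' a = z a"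
  shows "gp_mesh \<epsilon> y' z' k = gp_mesh \<epsilon> y z k"
  unfolding gp_mesh_def
proof (intro finsum_cong')
  show "(\<lambda>a. case a of (i, j, g) \<Rightarrow>
    (if i = k then split_sum (F i j) (\<epsilon> i) (y (i, j, g) \<otimes> z (i, j, g)) else \<zero>) \<ominus>
    (if j = k then split_sum (F j i) (\<epsilon> j) (z (i, j, g) \<otimes> y (i, j, g)) else \<zero>)) \<in> N \<rightarrow> carrier B"
    using assms(1) unfolding gp_rep_def by (auto intro!: minus_closed split_sum_closed m_closed)
qed (use assms(2,3) in auto)

end

context ei_hom
begin

text \<open>The values on generators are part of the conclusion because the composites of the final
  comparison are evaluated on them.\<close>

lemma gp_hom_of_ei_hom:
  assumes "orbit_reps E0 L R" "f (ei_preproj_relation E0 L R) = \<zero>\<^bsub>B\<^esub>"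
  obtains h where "h \<in> alg_hom PA B" "\<And>r. r \<in> gp_relations C D \<Omega> \<Longrightarrow> h r = \<zero>\<^bsub>B\<^esub>"
    "\<And>i. h (basis (Trivial i)) = ei_h f i 0"
    "\<And>i. h (basis (Arrows [Loop i])) = ei_h f i 1 \<ominus>\<^bsub>B\<^esub> ei_h f i 0"
    "\<And>i j g. (i, j, g) \<in> N \<Longrightarrow> h (basis (Arrows [Arr i j g])) = ei_x f (i, j, g)"
    "\<And>i j g. (i, j, g) \<in> N \<Longrightarrow> h (basis (Arrows [Arr j i g])) =
      ei_x' f (i, j, g) \<otimes>\<^bsub>B\<^esub> ei_h f i (- int (rep.F i j))"
proof -
  note gp = rep.gp_rep_nilp
  obtain h where h: "h \<in> alg_hom PA B" "\<And>i. h (basis (Trivial i)) = ei_h f i 0"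
    "\<And>i. h (basis (Arrows [Loop i])) = rep.nilp (ei_h f) i"
    "\<And>i j g. (i, j, g) \<in> N \<Longrightarrow> h (basis (Arrows [Arr i j g])) = ei_x f (i, j, g)"
    "\<And>i j g. (i, j, g) \<in> N \<Longrightarrow> h (basis (Arrows [Arr j i g])) = rep.twist (ei_h f) (- 1) (ei_x' f) (i, j, g)"
    using gp_hom_exists[OF rep.cartan_algebra_axioms gp] by blast
  interpret h: gp_hom C D \<Omega> p B h
    by unfold_locales (rule B h(1) char_p)+
  have e: "h.gp_e = (\<lambda>i. ei_h f i 0)" and eps: "h.gp_eps = rep.nilp (ei_h f)"
    using h(2,3) by (simp_all add: fun_eq_iff h.gp_e_def h.gp_eps_def)
  have y: "h.gp_y a = ei_x f a" and z: "h.gp_z a = rep.twist (ei_h f) (- 1) (ei_x' f) a" if "a \<in> N" for a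
    using that h(4,5) by (cases a; simp add: h.gp_y_def h.gp_z_def)+
  have "rep.ei_mesh (ei_h f) (ei_x f) (ei_x' f) = \<zero>\<^bsub>B\<^esub>"
    using hom_ei_preproj_relation(2)[OF assms(1)] assms(2) by simp
  then have "rep.gp_mesh (rep.nilp (ei_h f)) (ei_x f) (rep.twist (ei_h f) (- 1) (ei_x' f)) k = \<zero>\<^bsub>B\<^esub>" for k
    using rep.ei_mesh_eq_zero_iff by blast
  then have "rep.gp_rep h.gp_eps h.gp_y h.gp_z \<and> (\<forall>i. rep.gp_mesh h.gp_eps h.gp_y h.gp_z i = \<zero>\<^bsub>B\<^esub>)"
    unfolding eps using rep.gp_rep_cong[OF gp y z] rep.gp_mesh_cong[OF gp y z] by simp
  then have kill: "\<forall>r\<in>gp_relations C D \<Omega>. h r = \<zero>\<^bsub>B\<^esub>"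
    using h.hom_kills_iff unfolding e by blast
  show thesis
    by (rule that[OF h(1)]) (use kill h in \<open>simp_all add: rep.nilp_def rep.twist_def\<close>)
qed

end

context gp_hom
begin

text \<open>The twist is recorded in both directions, since each of the two composites in the final
  comparison uses one of them.\<close>

lemma ei_hom_of_gp_hom:
  assumes reps: "orbit_reps E0 L R" and kill: "\<And>r. r \<in> gp_relations C D \<Omega> \<Longrightarrow> f r = \<zero>\<^bsub>B\<^esub>"
  obtains h where "h \<in> alg_hom EI B" "h (ei_preproj_relation E0 L R) = \<zero>\<^bsub>B\<^esub>"
    "\<And>i s. ei_h h i s = (\<one>\<^bsub>B\<^esub> \<oplus>\<^bsub>B\<^esub> gp_eps i) [^]\<^bsub>B\<^esub> nat (s mod int (c i)) \<otimes>\<^bsub>B\<^esub> gp_e i"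
    "\<And>i. ei_h h i 0 = gp_e i" "\<And>i. ei_h h i 1 \<ominus>\<^bsub>B\<^esub> gp_e i = gp_eps i"
    "\<And>i j g. (i, j, g) \<in> N \<Longrightarrow> ei_x h (i, j, g) = f (basis (Arrows [Arr i j g]))"
    "\<And>i j g. (i, j, g) \<in> N \<Longrightarrow> ei_x' h (i, j, g) =
      f (basis (Arrows [Arr j i g])) \<otimes>\<^bsub>B\<^esub> ei_h h i (int (rep.F i j))"
    "\<And>i j g. (i, j, g) \<in> N \<Longrightarrow> ei_x' h (i, j, g) \<otimes>\<^bsub>B\<^esub> ei_h h i (- int (rep.F i j)) =
      f (basis (Arrows [Arr j i g]))"
proof -
  have gp: "rep.gp_rep gp_eps gp_y gp_z" and mesh: "rep.gp_mesh gp_eps gp_y gp_z k = \<zero>\<^bsub>B\<^esub>" for k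
    using hom_kills_iff kill by blast+
  let ?x' = "rep.twist (rep.unip gp_eps) 1 gp_z"
  interpret r: ei_representation B gp_e c N p "rep.unip gp_eps" gp_y ?x'
    by unfold_locales (rule rep.ei_rep_unip(1)[OF gp])
  obtain h where h: "h \<in> alg_hom EI B" "\<And>i s. ei_h h i s = rep.unip gp_eps i s"
    "\<And>a. a \<in> N \<Longrightarrow> ei_x h a = gp_y a" "\<And>a. a \<in> N \<Longrightarrow> ei_x' h a = ?x' a"
    using ei_hom_exists[OF r.ei_representation_axioms] by blast
  interpret h: ei_hom C D \<Omega> p B h
    by unfold_locales (rule B h(1) char_p)+
  have hh: "ei_h h = rep.unip gp_eps" using h(2) by (simp add: fun_eq_iff)
  have e: "(\<lambda>i. ei_h h i 0) = gp_e" by (simp add: hh r.h_0)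
  have nilp: "rep.nilp (ei_h h) = gp_eps"
    unfolding hh using rep.ei_rep_unip(2)[OF gp] by (simp add: fun_eq_iff)
  have tw: "rep.twist (ei_h h) (- 1) (ei_x' h) a = gp_z a" if "a \<in> N" for a
  proof -
    obtain i j g where a: "a = (i, j, g)" by (cases a) auto
    have "rep.twist (ei_h h) (- 1) (ei_x' h) a = rep.twist (ei_h h) (- 1) ?x' a"
      using h(4)[OF that] by (simp add: a rep.twist_def)
    then show ?thesis unfolding hh using rep.ei_rep_unip(3)[OF gp] that a by simp
  qed
  have "rep.gp_mesh gp_eps (ei_x h) (rep.twist (ei_h h) (- 1) (ei_x' h)) k = \<zero>\<^bsub>B\<^esub>" for k
    using rep.gp_mesh_cong[OF gp h(3) tw] mesh by simp
  then have "rep.ei_mesh (ei_h h) (ei_x h) (ei_x' h) = \<zero>\<^bsub>B\<^esub>"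
    using h.rep.ei_mesh_eq_zero_iff unfolding e nilp by blast
  then have 0: "h (ei_preproj_relation E0 L R) = \<zero>\<^bsub>B\<^esub>"
    using h.hom_ei_preproj_relation(2)[OF reps] by simp
  show thesis
  proof (rule that[OF h(1) 0])
    show "ei_h h i s = (\<one>\<^bsub>B\<^esub> \<oplus>\<^bsub>B\<^esub> gp_eps i) [^]\<^bsub>B\<^esub> nat (s mod int (c i)) \<otimes>\<^bsub>B\<^esub> gp_e i" for i s
      by (simp add: h(2) rep.unip_def)
    show "ei_h h i 0 = gp_e i" for i using e by metis
    show "ei_h h i 1 \<ominus>\<^bsub>B\<^esub> gp_e i = gp_eps i" for i
      using nilp by (metis rep.nilp_def)
    fix i j g assume a: "(i, j, g) \<in> N"
    show "ei_x h (i, j, g) = f (basis (Arrows [Arr i j g]))"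
      using h(3)[OF a] by (simp add: gp_y_def)
    show "ei_x' h (i, j, g) = f (basis (Arrows [Arr j i g])) \<otimes>\<^bsub>B\<^esub> ei_h h i (int (rep.F i j))"
      using h(4)[OF a] by (simp add: gp_z_def rep.twist_def hh)
    show "ei_x' h (i, j, g) \<otimes>\<^bsub>B\<^esub> ei_h h i (- int (rep.F i j)) = f (basis (Arrows [Arr j i g]))"
      using tw[OF a] by (simp add: gp_z_def rep.twist_def)
  qed
qed

end

context cartan_setup
begin

text \<open>Each quotient projection kills its own relations, so it translates into a homomorphism
  from the other category algebra that kills the other relations and descends to the other quotient.
  The two maps obtained are mutually inverse because their composites fix the generators.\<close>

lemma preproj_algebras_isomorphic:
  fixes L R
  assumes char_p: "CHAR('k::field) = p" and reps: "orbit_reps E0 L R"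
  shows "algebras_isomorphic
    (ei_preproj_algebra E0 L R ::
      ('k, (('n, ('n \<times> 'n \<times> nat) + ('n \<times> 'n \<times> nat), int, (int \<times> int) set) ei_mor \<Rightarrow>\<^sub>0 'k) set) module)
    (generalized_preproj_algebra C D \<Omega>)"
proof -
  let ?EI = "EI :: ('k, ('n, ('n \<times> 'n \<times> nat) + ('n \<times> 'n \<times> nat), int, (int \<times> int) set) ei_mor \<Rightarrow>\<^sub>0 'k) module"
  let ?PA = "PA :: ('k, ('n, 'n gp_arrow) qpath \<Rightarrow>\<^sub>0 'k) module"
  define \<rho> where "\<rho> = (ei_preproj_relation E0 L R :: ('n, ('n \<times> 'n \<times> nat) + ('n \<times> 'n \<times> nat), int, (int \<times> int) set) ei_mor \<Rightarrow>\<^sub>0 'k)"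
  define S where "S = (gp_relations C D \<Omega> :: (('n, 'n gp_arrow) qpath \<Rightarrow>\<^sub>0 'k) set)"
  define J where "J = Idl\<^bsub>?EI\<^esub> {\<rho>}"
  define I where "I = Idl\<^bsub>?PA\<^esub> S"
  have uEI: "unital_algebra ?EI" by (rule ED.ei.unital_algebra_axioms)
  have uPA: "unital_algebra ?PA" by (rule GQ.path.unital_algebra_axioms)
  have \<rho>: "\<rho> \<in> carrier ?EI"
  proof -
    \<comment> \<open>The identity is used only as some homomorphism, to enter the locale in which
      membership of rho in the carrier is proved.\<close>
    have "id \<in> alg_hom ?EI ?EI" by (rule alg_homI) auto
    then interpret i: ei_hom C D \<Omega> p ?EI id
      by unfold_locales (rule uEI char_p | assumption)+
    show ?thesis unfolding \<rho>_def by (rule i.hom_ei_preproj_relation(1)[OF reps])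
  qed
  have S: "S \<subseteq> carrier ?PA"
  proof -
    have "id \<in> alg_hom ?PA ?PA" by (rule alg_homI) auto
    then interpret i: gp_hom C D \<Omega> p ?PA id
      by unfold_locales (rule uPA char_p | assumption)+
    show ?thesis unfolding S_def by (rule i.gp_relations_closed)
  qed
  interpret J: algebra_ideal ?EI J
    unfolding J_def algebra_ideal_def using \<rho> uEI ED.ei.genideal_ideal by blast
  interpret I: algebra_ideal ?PA I
    unfolding I_def algebra_ideal_def using S uPA GQ.path.genideal_ideal by blast
  let ?P1 = "quotient_algebra ?EI J" and ?P2 = "quotient_algebra ?PA I"
  let ?q1 = "(+>\<^bsub>?EI\<^esub>) J" and ?q2 = "(+>\<^bsub>?PA\<^esub>) I"
  note u1 = J.unital_algebra_quotient and u2 = I.unital_algebra_quotient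
  interpret q1: ei_hom C D \<Omega> p ?P1 ?q1
    by (intro ei_hom.intro ei_hom_axioms.intro cartan_setup_axioms u1 J.coset_alg_hom char_p)
  interpret q2: gp_hom C D \<Omega> p ?P2 ?q2
    by (intro gp_hom.intro gp_hom_axioms.intro cartan_setup_axioms u2 I.coset_alg_hom char_p)
  have "\<rho> \<in> J" unfolding J_def using \<rho> by (rule ED.ei.genideal_self')
  then have q1\<rho>: "?q1 (ei_preproj_relation E0 L R) = \<zero>\<^bsub>?P1\<^esub>"
    unfolding \<rho>_def[symmetric] by (rule J.alg_hom_eq_zero_coset)
  have "S \<subseteq> I" unfolding I_def using S by (rule GQ.path.genideal_self)
  then have q2S: "?q2 r = \<zero>\<^bsub>?P2\<^esub>" if "r \<in> gp_relations C D \<Omega>" for r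
    using that unfolding S_def[symmetric] by (intro I.alg_hom_eq_zero_coset) blast
  obtain \<phi> where \<phi>: "\<phi> \<in> alg_hom ?PA ?P1" "\<And>r. r \<in> gp_relations C D \<Omega> \<Longrightarrow> \<phi> r = \<zero>\<^bsub>?P1\<^esub>"
    "\<And>i. \<phi> (basis (Trivial i)) = ei_h ?q1 i 0"
    "\<And>i. \<phi> (basis (Arrows [Loop i])) = ei_h ?q1 i 1 \<ominus>\<^bsub>?P1\<^esub> ei_h ?q1 i 0"
    "\<And>i j g. (i, j, g) \<in> N \<Longrightarrow> \<phi> (basis (Arrows [Arr i j g])) = ei_x ?q1 (i, j, g)"
    "\<And>i j g. (i, j, g) \<in> N \<Longrightarrow> \<phi> (basis (Arrows [Arr j i g])) =
      ei_x' ?q1 (i, j, g) \<otimes>\<^bsub>?P1\<^esub> ei_h ?q1 i (- int (q1.rep.F i j))"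
    using q1.gp_hom_of_ei_hom[OF reps q1\<rho>] by blast
  obtain \<psi> where \<psi>: "\<psi> \<in> alg_hom ?EI ?P2" "\<psi> (ei_preproj_relation E0 L R) = \<zero>\<^bsub>?P2\<^esub>"
    "\<And>i s. ei_h \<psi> i s = (\<one>\<^bsub>?P2\<^esub> \<oplus>\<^bsub>?P2\<^esub> q2.gp_eps i) [^]\<^bsub>?P2\<^esub> nat (s mod int (c i)) \<otimes>\<^bsub>?P2\<^esub> q2.gp_e i"
    "\<And>i. ei_h \<psi> i 0 = q2.gp_e i" "\<And>i. ei_h \<psi> i 1 \<ominus>\<^bsub>?P2\<^esub> q2.gp_e i = q2.gp_eps i"
    "\<And>i j g. (i, j, g) \<in> N \<Longrightarrow> ei_x \<psi> (i, j, g) = ?q2 (basis (Arrows [Arr i j g]))"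
    "\<And>i j g. (i, j, g) \<in> N \<Longrightarrow> ei_x' \<psi> (i, j, g) =
      ?q2 (basis (Arrows [Arr j i g])) \<otimes>\<^bsub>?P2\<^esub> ei_h \<psi> i (int (q2.rep.F i j))"
    "\<And>i j g. (i, j, g) \<in> N \<Longrightarrow> ei_x' \<psi> (i, j, g) \<otimes>\<^bsub>?P2\<^esub> ei_h \<psi> i (- int (q2.rep.F i j)) =
      ?q2 (basis (Arrows [Arr j i g]))"
    using q2.ei_hom_of_gp_hom[OF reps q2S] by blast
  interpret \<phi>: unital_algebra_hom ?PA ?P1 \<phi> using uPA u1 \<phi>(1) by (simp add: unital_algebra_hom_def unital_algebra_hom_axioms_def)
  interpret \<psi>: unital_algebra_hom ?EI ?P2 \<psi> using uEI u2 \<psi>(1) by (simp add: unital_algebra_hom_def unital_algebra_hom_axioms_def)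
  have kerI: "\<phi> r = \<zero>\<^bsub>?P1\<^esub>" if "r \<in> I" for r
    using \<phi>.vanishes_on_genideal[OF S] \<phi>(2) that unfolding I_def S_def by blast
  have kerJ: "\<psi> r = \<zero>\<^bsub>?P2\<^esub>" if "r \<in> J" for r
    using \<psi>.vanishes_on_genideal[of "{\<rho>}"] \<rho> \<psi>(2) that unfolding J_def \<rho>_def by blast
  obtain \<phi>' where \<phi>': "\<phi>' \<in> alg_hom ?P2 ?P1" "\<And>x. x \<in> carrier ?PA \<Longrightarrow> \<phi>' (?q2 x) = \<phi> x"
    using I.quotient_lift[OF u1 \<phi>(1) kerI] by blast
  obtain \<psi>' where \<psi>': "\<psi>' \<in> alg_hom ?P1 ?P2" "\<And>x. x \<in> carrier ?EI \<Longrightarrow> \<psi>' (?q1 x) = \<psi> x"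
    using J.quotient_lift[OF u2 \<psi>(1) kerJ] by blast
  interpret \<phi>': unital_algebra_hom ?P2 ?P1 \<phi>' using u2 u1 \<phi>'(1) by (simp add: unital_algebra_hom_def unital_algebra_hom_axioms_def)
  interpret \<psi>': unital_algebra_hom ?P1 ?P2 \<psi>' using u1 u2 \<psi>'(1) by (simp add: unital_algebra_hom_def unital_algebra_hom_axioms_def)
  have arr: "basis (Arrows [Arr i j g]) \<in> carrier ?PA" "basis (Arrows [Arr j i g]) \<in> carrier ?PA"
    if "(i, j, g) \<in> N" for i j g
    using PA_closed(3) that by blast+
  have e_closed: "q2.gp_e i \<in> carrier ?P2" "q2.gp_eps i \<in> carrier ?P2" for i
    unfolding q2.gp_e_def q2.gp_eps_def using q2.f.hom_closed PA_closed(1,2) by blast+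
  have \<phi>'e: "\<phi>' (q2.gp_e i) = ei_h ?q1 i 0" "\<phi>' (q2.gp_eps i) = q1.rep.nilp (ei_h ?q1) i" for i
    unfolding q2.gp_e_def q2.gp_eps_def \<phi>'(2)[OF PA_closed(1)] \<phi>'(2)[OF PA_closed(2)] \<phi>(3,4) q1.rep.nilp_def
    by (rule refl)+
  \<comment> \<open>Powers of the group generator are recovered from eps = eta - e by
    \<open>unip_nilp\<close>.\<close>
  have h\<phi>: "\<phi>' (ei_h \<psi> i s) = ei_h ?q1 i s" for i s
  proof -
    have "\<phi>' (ei_h \<psi> i s) = q1.rep.unip (q1.rep.nilp (ei_h ?q1)) i s"
      unfolding \<psi>(3) q1.rep.unip_def using e_closed[of i]
      by (simp add: \<phi>'.hom_nat_pow \<phi>'e)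
    then show ?thesis by (simp add: q1.rep.unip_nilp)
  qed
  have h\<psi>: "\<psi>' (ei_h ?q1 i s) = ei_h \<psi> i s" for i s
    unfolding ei_h_def using \<psi>'(2)[OF Elt_in_carrier] .
  have elt_cl: "basis (arrow_elt (Inl a) (elt a 0 0)) \<in> carrier ?EI" "basis (arrow_elt (Inr a) (elt a 0 0)) \<in> carrier ?EI" if "a \<in> N" for a
    using arr_closed[OF u2 \<psi>(1) char_p that] by blast+
  have x\<psi>: "\<psi>' (ei_x ?q1 a) = ei_x \<psi> a" "\<psi>' (ei_x' ?q1 a) = ei_x' \<psi> a" if "a \<in> N" for a
    unfolding ei_x_def ei_x'_def using \<psi>'(2) elt_cl[OF that] by blast+
  have A: "\<phi>' (\<psi> x) = ?q1 x" if x: "x \<in> carrier ?EI" for x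
  proof -
    have "(\<phi>' \<circ> \<psi>) x = ?q1 x"
    proof (rule ei_hom_unique[OF u1 char_p alg_hom_comp[OF \<psi>(1) \<phi>'(1)] J.coset_alg_hom _ _ _ x])
      show "ei_h (\<phi>' \<circ> \<psi>) i s = ei_h ?q1 i s" for i s
        using h\<phi>[of i s] by (simp add: ei_h_def)
      fix a assume "a \<in> N"
      moreover obtain i j g where ijg: "a = (i, j, g)" by (cases a) auto
      ultimately have a: "(i, j, g) \<in> N" by simp
      have "ei_x (\<phi>' \<circ> \<psi>) a = \<phi>' (ei_x \<psi> a)" by (simp add: ei_x_def)
      also have "\<dots> = ei_x ?q1 a"
        unfolding ijg \<psi>(6)[OF a] \<phi>'(2)[OF arr(1)[OF a]] \<phi>(5)[OF a] ..
      finally show "ei_x (\<phi>' \<circ> \<psi>) a = ei_x ?q1 a" .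
      have "ei_x' (\<phi>' \<circ> \<psi>) a = \<phi>' (ei_x' \<psi> a)" by (simp add: ei_x'_def)
      also have "\<dots> = \<phi>' (?q2 (basis (Arrows [Arr j i g]))) \<otimes>\<^bsub>?P1\<^esub> \<phi>' (ei_h \<psi> i (int (q2.rep.F i j)))"
        unfolding ijg \<psi>(7)[OF a]
        unfolding ei_h_def by (rule \<phi>'.hom_mult[OF q2.f.hom_closed[OF arr(2)[OF a]] \<psi>.hom_closed[OF Elt_in_carrier]])
      \<comment> \<open>The twist built into \<psi> undoes the one built into \<phi>.\<close>
      also have "\<dots> = q1.rep.twist (ei_h ?q1) 1 (q1.rep.twist (ei_h ?q1) (- 1) (ei_x' ?q1)) a"
        unfolding h\<phi> \<phi>'(2)[OF arr(2)[OF a]] \<phi>(6)[OF a] ijg q1.rep.twist_def prod.case mult_minus1 mult_1 ..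
      also have "\<dots> = ei_x' ?q1 a" unfolding ijg by (rule q1.rep.twist_twist[OF a])
      finally show "ei_x' (\<phi>' \<circ> \<psi>) a = ei_x' ?q1 a" .
    qed
    then show ?thesis unfolding comp_apply .
  qed
  have B: "\<psi>' (\<phi> x) = ?q2 x" if x: "x \<in> carrier ?PA" for x
  proof -
    have "(\<psi>' \<circ> \<phi>) x = ?q2 x"
    proof (rule gp_hom_unique[OF u2 alg_hom_comp[OF \<phi>(1) \<psi>'(1)] I.coset_alg_hom _ _ _ _ x])
      show "(\<psi>' \<circ> \<phi>) (basis (Trivial i)) = ?q2 (basis (Trivial i))" for i
        unfolding comp_apply \<phi>(3) h\<psi> \<psi>(4) q2.gp_e_def ..
      show "(\<psi>' \<circ> \<phi>) (basis (Arrows [Loop i])) = ?q2 (basis (Arrows [Loop i]))" for i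
        unfolding comp_apply \<phi>(4) \<psi>'.hom_minus[OF q1.rep.h_closed q1.rep.h_closed] h\<psi> \<psi>(4,5) q2.gp_eps_def ..
      fix i j g assume a: "(i, j, g) \<in> N"
      show "(\<psi>' \<circ> \<phi>) (basis (Arrows [Arr i j g])) = ?q2 (basis (Arrows [Arr i j g]))"
        unfolding comp_apply \<phi>(5)[OF a] x\<psi>(1)[OF a] \<psi>(6)[OF a] ..
      have mult: "\<psi>' (ei_x' ?q1 (i, j, g) \<otimes>\<^bsub>?P1\<^esub> ei_h ?q1 i (- int (q1.rep.F i j))) =
          \<psi>' (ei_x' ?q1 (i, j, g)) \<otimes>\<^bsub>?P2\<^esub> \<psi>' (ei_h ?q1 i (- int (q1.rep.F i j)))"
        using q1.rep.x_laws(5)[OF a] q1.rep.h_closed by (rule \<psi>'.hom_mult)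
      show "(\<psi>' \<circ> \<phi>) (basis (Arrows [Arr j i g])) = ?q2 (basis (Arrows [Arr j i g]))"
        unfolding comp_apply \<phi>(6)[OF a] mult x\<psi>(2)[OF a] h\<psi> by (rule \<psi>(8)[OF a])
    qed
    then show ?thesis unfolding comp_apply .
  qed
  have "algebras_isomorphic ?P1 ?P2"
  proof (rule algebras_isomorphicI[OF \<psi>'(1) \<phi>'(1)])
    fix X assume "X \<in> carrier ?P1"
    then obtain x where x: "x \<in> carrier ?EI" "X = ?q1 x" unfolding J.quotient_simps(1) by blast
    show "\<phi>' (\<psi>' X) = X" unfolding x(2) \<psi>'(2)[OF x(1)] A[OF x(1)] ..
  next
    fix X assume "X \<in> carrier ?P2"
    then obtain x where x: "x \<in> carrier ?PA" "X = ?q2 x" unfolding I.quotient_simps(1) by blast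
    show "\<psi>' (\<phi>' X) = X" unfolding x(2) \<phi>'(2)[OF x(1)] B[OF x(1)] ..
  qed
  then show ?thesis
    unfolding ei_preproj_algebra_def generalized_preproj_algebra_def Let_def path_algebra_def
    unfolding J_def I_def \<rho>_def S_def .
qed

end

theorem corollary6p3:
  fixes C D :: "int^'n^'n"
    and \<Omega> :: "('n \<times> 'n) set"
    and p :: nat
    and L R :: "'n \<times> 'n \<times> nat \<Rightarrow> (int \<times> int) set set"
  assumes "CHAR('k::field) = p" and "p > 0"
    and "cartan_triple C D \<Omega>"
    and "\<forall>i. \<exists>m. diag_entry D i = p ^ m"
    and "orbit_reps (cartan_ei_quiver C D \<Omega>) L R"
  shows "algebras_isomorphic
    (ei_preproj_algebra (cartan_ei_quiver C D \<Omega>) L R ::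
      ('k, (('n, ('n \<times> 'n \<times> nat) + ('n \<times> 'n \<times> nat), int, (int \<times> int) set) ei_mor \<Rightarrow>\<^sub>0 'k) set) module)
    (generalized_preproj_algebra C D \<Omega>)"
proof -
  have "prime p" using assms(1,2) prime_CHAR_semidom[where 'a = 'k] by simp
  then interpret cartan_setup C D \<Omega> p
    using assms(3,4) by unfold_locales auto
  show ?thesis using assms(1,5) by (rule preproj_algebras_isomorphic)
qed

end
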